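(* Assume that $\det K(0)\neq 0$ (i.e. $0$ is a regular point for $H$). Suppose that $n_b\ge 2$ and $n_a=1$. Then the reduced time evolution operator satisfies $$\tilde U(t)=\lambda^2\,\frac{n_b!}{(it)^{n_b+1}}\,K(0)^{-1}\Gamma_{n_b}K(0)^{-1}+O(t^{-n_b-2})\qquad (t\to\infty).$$ If instead $n_b=1$ and $n_a\ge 1$, the same formula holds with the error term $O(t^{-n_b-2})$ replaced by $O(t^{-3}\log t)$.
   Context: Let $N\ge 1$ and $\mathcal H=\mathbb C^N\oplus L^2((0,\infty))$, where $|1\rangle,\dots,|N\rangle$ is the standard orthonormal basis of $\mathbb C^N$; vectors are written $|c\rangle+|f\rangle$ with $c\in\mathbb C^N$, $f\in L^2((0,\infty))$, and the inner product is $\langle d|c\rangle+\int_0^\infty g^*f\,d\omega$. Let $\omega_1\le\dots\le\omega_N$ be real numbers, $\lambda\in\mathbb R\setminus\{0\}$, and $v_1,\dots,v_N\in L^2((0,\infty))$ (form factors). The Hamiltonian is $H=H_0+\lambda V$ with $H_0(|c\rangle+|f\rangle)=\sum_n\omega_nc_n|n\rangle+\omega f(\omega)$ on $D(H_0)=\{|c\rangle+|f\rangle:\int_0^\infty|\omega f(\omega)|^2d\omega<\infty\}$ and $V(|c\rangle+|f\rangle)=\sum_n\langle v_n|f\rangle|n\rangle+\sum_n c_n v_n$; $H$ is self-adjoint on $D(H_0)$. Form-factor assumption: for all $m,n$, $v_m^*(\omega)v_n(\omega)=\pi_{mn}(\omega)/\rho_{mn}(\omega)$ with polynomials $\pi_{mn},\rho_{mn}$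 such that $\deg\rho_{mn}\ge\deg\pi_{mn}+2$, $\rho_{mn}$ has no zeros in $[0,\infty)$, and $\pi_{mn}(0)=0$. $\Gamma(z)$ denotes the $N\times N$ matrix whose entries are the meromorphic continuations $v_m^*(z)v_n(z)$ of these rational functions. Self energy: $S_{mn}(z)=\int_0^\infty\frac{v_m^*(\omega)v_n(\omega)}{\omega-z}d\omega$ for $z\in\mathbb C\setminus[0,\infty)$, and $S_{mn}(0)=\int_0^\infty v_m^*(\omega)v_n(\omega)\omega^{-1}d\omega$. Let $K_0=\mathrm{diag}(\omega_1,\dots,\omega_N)$, $K(z)=K_0-\lambda^2S(z)$, $K(0)=K_0-\lambda^2S(0)$. For $\omega>0$ let $D_{mn}(\omega)=P\!\int_0^\infty\frac{v_m^*(\omega')v_n(\omega')}{\omega'-\omega}d\omega'$ (principal value) and $K^\pm(\omega)=K_0-\lambda^2D(\omega)\mp i\pi\lambda^2\Gamma(\omega)$. Standing assumption: $\det[K^\pm(\omega)-\omega]\neq0$ for all $\omega>0$. Define the matrix function $A(z)$ by $S(z)=S(0)+A(z)-\log(-z)\,\Gamma(z)$ for $z\in\mathbb C\setminus[0,\infty)$, where $0<\arg z<2\pi$ and $\arg(-z)=\arg z-\pi$; $A$ is rational, regular on $[0,\infty)$, with $A(0)=0$. Taylor-expand at $\omega=0$: $\Gamma(\omega)=\sum_{k\ge1}\omega^k\Gamma_k$ and $\tilde A(\omega):=\omega/\lambda^2+A(\omega)=\sum_{k\ge1}\omega^k\tilde A_k$; $n_b$ (resp. $n_a$) is the smallest $k$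 with $\Gamma_k\neq0$ (resp. $\tilde A_k\neq0$). Let $\{E(B)\}$ be the spectral measure of $H$ and $P=E((0,\infty))$. The reduced time evolution operator $\tilde U(t)$ is the $N\times N$ matrix with entries $\tilde U_{mn}(t)=\langle m|Pe^{-itH}P|n\rangle$. *)

theory Defs
  imports "HOL-Analysis.Analysis" "HOL-Library.Landau_Symbols"
    "HOL-Computational_Algebra.Polynomial"
begin

text \<open>Friedrichs-type model on C^N (+) L^2((0,oo)).  The index set {1..N} is a
finite linearly ordered type 'n; w :: 'n => real are the energies omega_n,
lam the coupling, v the form factors, pp/rr the numerator/denominator
polynomials of the products cnj(v_m) v_n.\<close>

definition inner_pos :: "(real \<Rightarrow> complex) \<Rightarrow> (real \<Rightarrow> complex) \<Rightarrow> complex" where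
  "inner_pos g f = set_lebesgue_integral lborel {0<..} (\<lambda>x. cnj (g x) * f x)"

definition L2pos :: "(real \<Rightarrow> complex) \<Rightarrow> bool" where
  "L2pos f \<longleftrightarrow> f \<in> borel_measurable lborel \<and>
     set_integrable lborel {0<..} (\<lambda>x. (cmod (f x))\<^sup>2)"

text \<open>(c,f) solves (H - z)(|c> + |f>) = |n>, with |c>+|f> in D(H_0).\<close>
definition resolvent_sol ::
  "('n::finite \<Rightarrow> real) \<Rightarrow> real \<Rightarrow> ('n \<Rightarrow> real \<Rightarrow> complex) \<Rightarrow> complex \<Rightarrow> 'n
     \<Rightarrow> complex^'n \<Rightarrow> (real \<Rightarrow> complex) \<Rightarrow> bool" where
  "resolvent_sol w lam v z n c f \<longleftrightarrow>
     L2pos f \<and> L2pos (\<lambda>x. complex_of_real x * f x) \<and>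
     (\<forall>k. (complex_of_real (w k) - z) * c$k + complex_of_real lam * inner_pos (v k) f
            = (if k = n then 1 else 0)) \<and>
     (AE x in lborel. 0 < x \<longrightarrow>
        (complex_of_real x - z) * f x + complex_of_real lam * (\<Sum>k\<in>UNIV. c$k * v k x) = 0)"

definition resolvent_entry ::
  "('n::finite \<Rightarrow> real) \<Rightarrow> real \<Rightarrow> ('n \<Rightarrow> real \<Rightarrow> complex) \<Rightarrow> complex \<Rightarrow> 'n \<Rightarrow> 'n \<Rightarrow> complex" where
  "resolvent_entry w lam v z m n = (THE c. \<exists>f. resolvent_sol w lam v z n c f) $ m"

definition resolvent_form ::
  "('n::finite \<Rightarrow> real) \<Rightarrow> real \<Rightarrow> ('n \<Rightarrow> real \<Rightarrow> complex) \<Rightarrow> complex \<Rightarrow> complex^'n \<Rightarrow> complex" where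
  "resolvent_form w lam v z u =
     (\<Sum>m\<in>UNIV. \<Sum>n\<in>UNIV. cnj (u$m) * u$n * resolvent_entry w lam v z m n)"

text \<open>The spectral measure B |-> <u|E(B)|u> of H, characterised as the unique finite
Borel measure whose Stieltjes transform is the resolvent form.\<close>
definition is_spectral_measure ::
  "('n::finite \<Rightarrow> real) \<Rightarrow> real \<Rightarrow> ('n \<Rightarrow> real \<Rightarrow> complex) \<Rightarrow> complex^'n \<Rightarrow> real measure \<Rightarrow> bool" where
  "is_spectral_measure w lam v u \<mu> \<longleftrightarrow>
     finite_measure \<mu> \<and> sets \<mu> = sets borel \<and>
     (\<forall>z. Im z \<noteq> 0 \<longrightarrow>
        resolvent_form w lam v z u = integral\<^sup>L \<mu> (\<lambda>x. 1 / (complex_of_real x - z)))"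

definition spec_meas ::
  "('n::finite \<Rightarrow> real) \<Rightarrow> real \<Rightarrow> ('n \<Rightarrow> real \<Rightarrow> complex) \<Rightarrow> complex^'n \<Rightarrow> real measure" where
  "spec_meas w lam v u = (THE \<mu>. is_spectral_measure w lam v u \<mu>)"

text \<open>Reduced time evolution U~_{mn}(t) = <m|P e^{-itH} P|n>, P = E((0,oo)),
obtained by polarisation: <x|A y> = 1/4 sum_k i^{-k} <x + i^k y|A(x + i^k y)>.\<close>
definition reduced_evolution ::
  "('n::finite \<Rightarrow> real) \<Rightarrow> real \<Rightarrow> ('n \<Rightarrow> real \<Rightarrow> complex) \<Rightarrow> real \<Rightarrow> 'n \<Rightarrow> 'n \<Rightarrow> complex" where
  "reduced_evolution w lam v t m n =
     (1/4) * (\<Sum>k\<in>{..<4::nat}. cnj (\<i> ^ k) *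
        set_lebesgue_integral (spec_meas w lam v (\<chi> j. (if j = m then 1 else 0) + \<i> ^ k * (if j = n then 1 else 0)))
          {0<..} (\<lambda>x. exp (- \<i> * complex_of_real t * complex_of_real x)))"

definition self_energy :: "('n \<Rightarrow> real \<Rightarrow> complex) \<Rightarrow> complex \<Rightarrow> 'n \<Rightarrow> 'n \<Rightarrow> complex" where
  "self_energy v z m n =
     set_lebesgue_integral lborel {0<..} (\<lambda>x. cnj (v m x) * v n x / (complex_of_real x - z))"

definition Kmat ::
  "('n::finite \<Rightarrow> real) \<Rightarrow> real \<Rightarrow> ('n \<Rightarrow> real \<Rightarrow> complex) \<Rightarrow> complex \<Rightarrow> complex^'n^'n" where
  "Kmat w lam v z = (\<chi> m n. (if m = n then complex_of_real (w m) else 0)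
                              - complex_of_real (lam\<^sup>2) * self_energy v z m n)"

definition Gam :: "('n \<Rightarrow> 'n \<Rightarrow> complex poly) \<Rightarrow> ('n \<Rightarrow> 'n \<Rightarrow> complex poly) \<Rightarrow> complex \<Rightarrow> 'n \<Rightarrow> 'n \<Rightarrow> complex" where
  "Gam pp rr z m n = poly (pp m n) z / poly (rr m n) z"

definition Gcoeff :: "('n::finite \<Rightarrow> 'n \<Rightarrow> complex poly) \<Rightarrow> ('n \<Rightarrow> 'n \<Rightarrow> complex poly) \<Rightarrow> nat \<Rightarrow> complex^'n^'n" where
  "Gcoeff pp rr k = (\<chi> m n. (deriv ^^ k) (\<lambda>z. Gam pp rr z m n) 0 / fact k)"

text \<open>A(z) = S(z) - S(0) + log(-z) Gamma(z) on C \ [0,oo); with 0 < arg z < 2 pi and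
arg(-z) = arg z - pi, log(-z) is the principal logarithm Ln(-z).\<close>
definition Aent ::
  "('n \<Rightarrow> real \<Rightarrow> complex) \<Rightarrow> ('n \<Rightarrow> 'n \<Rightarrow> complex poly) \<Rightarrow> ('n \<Rightarrow> 'n \<Rightarrow> complex poly)
     \<Rightarrow> complex \<Rightarrow> 'n \<Rightarrow> 'n \<Rightarrow> complex" where
  "Aent v pp rr z m n = self_energy v z m n - self_energy v 0 m n + Ln (- z) * Gam pp rr z m n"

text \<open>Taylor coefficient A_k at 0 of the (rational, regular at 0) continuation of A,
computed as the limit of the k-th derivative from C \ [0,oo).\<close>
definition Acoeff ::
  "('n::finite \<Rightarrow> real \<Rightarrow> complex) \<Rightarrow> ('n \<Rightarrow> 'n \<Rightarrow> complex poly) \<Rightarrow> ('n \<Rightarrow> 'n \<Rightarrow> complex poly)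
     \<Rightarrow> nat \<Rightarrow> complex^'n^'n" where
  "Acoeff v pp rr k = (\<chi> m n. Lim (at 0 within - (complex_of_real ` {0..}))
       (\<lambda>z. (deriv ^^ k) (\<lambda>y. Aent v pp rr y m n) z / fact k))"

text \<open>Taylor coefficient of A~(omega) = omega/lam^2 + A(omega).\<close>
definition Atil_coeff ::
  "real \<Rightarrow> ('n::finite \<Rightarrow> real \<Rightarrow> complex) \<Rightarrow> ('n \<Rightarrow> 'n \<Rightarrow> complex poly) \<Rightarrow> ('n \<Rightarrow> 'n \<Rightarrow> complex poly)
     \<Rightarrow> nat \<Rightarrow> complex^'n^'n" where
  "Atil_coeff lam v pp rr k = (\<chi> m n. (if k = 1 \<and> m = n then complex_of_real (1 / lam\<^sup>2) else 0)
                                      + Acoeff v pp rr k $ m $ n)"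

definition is_nb :: "('n::finite \<Rightarrow> 'n \<Rightarrow> complex poly) \<Rightarrow> ('n \<Rightarrow> 'n \<Rightarrow> complex poly) \<Rightarrow> nat \<Rightarrow> bool" where
  "is_nb pp rr k \<longleftrightarrow> 1 \<le> k \<and> Gcoeff pp rr k \<noteq> 0 \<and> (\<forall>j. 1 \<le> j \<and> j < k \<longrightarrow> Gcoeff pp rr j = 0)"

definition is_na :: "real \<Rightarrow> ('n::finite \<Rightarrow> real \<Rightarrow> complex) \<Rightarrow> ('n \<Rightarrow> 'n \<Rightarrow> complex poly)
     \<Rightarrow> ('n \<Rightarrow> 'n \<Rightarrow> complex poly) \<Rightarrow> nat \<Rightarrow> bool" where
  "is_na lam v pp rr k \<longleftrightarrow> 1 \<le> k \<and> Atil_coeff lam v pp rr k \<noteq> 0 \<and>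
      (\<forall>j. 1 \<le> j \<and> j < k \<longrightarrow> Atil_coeff lam v pp rr j = 0)"

definition PV_D :: "('n \<Rightarrow> real \<Rightarrow> complex) \<Rightarrow> real \<Rightarrow> 'n \<Rightarrow> 'n \<Rightarrow> complex" where
  "PV_D v x0 m n = Lim (at_right 0) (\<lambda>\<epsilon>::real.
      set_lebesgue_integral lborel ({0<..} - {x0 - \<epsilon> .. x0 + \<epsilon>})
        (\<lambda>x. cnj (v m x) * v n x / complex_of_real (x - x0)))"

text \<open>K^+ (s = 1) and K^- (s = -1), minus omega times the identity.\<close>
definition Kpm_shift ::
  "('n::finite \<Rightarrow> real) \<Rightarrow> real \<Rightarrow> ('n \<Rightarrow> real \<Rightarrow> complex) \<Rightarrow> ('n \<Rightarrow> 'n \<Rightarrow> complex poly)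
     \<Rightarrow> ('n \<Rightarrow> 'n \<Rightarrow> complex poly) \<Rightarrow> real \<Rightarrow> real \<Rightarrow> complex^'n^'n" where
  "Kpm_shift w lam v pp rr s x0 = (\<chi> m n.
      (if m = n then complex_of_real (w m) - complex_of_real x0 else 0)
      - complex_of_real (lam\<^sup>2) * PV_D v x0 m n
      - complex_of_real s * \<i> * complex_of_real (pi * lam\<^sup>2) * Gam pp rr (complex_of_real x0) m n)"

end

theory Submission
  imports Defs "HOL-Complex_Analysis.Complex_Analysis" "HOL-Probability.Probability"
    "HOL-Real_Asymp.Real_Asymp"
begin

text \<open>Eliminating the continuum component reduces the resolvent of \<open>H\<close> on \<open>\<complex>\<^sup>N\<close> to
  \<open>R(z) = (K(z) - z)\<^sup>-\<^sup>1\<close>. Its quadratic forms are Herglotz functions, which gives the spectral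
  measures, and Stieltjes inversion shows that on \<open>(0, \<infinity>)\<close> they have the density
  \<open>\<lambda>\<^sup>2 R\<^sup>+ \<Gamma> R\<^sup>-\<close>, because \<open>K\<^sup>- - K\<^sup>+ = 2 \<pi> \<i> \<lambda>\<^sup>2 \<Gamma>\<close>. Since
  \<open>S(z) = B(z) - log(-z) \<Gamma>(z)\<close> with \<open>B\<close> rational, this density continues to a holomorphic
  function in a sector around \<open>(0, \<infinity>)\<close> that decays quadratically and equals
  \<open>\<lambda>\<^sup>2 K(0)\<^sup>-\<^sup>1 \<Gamma>\<^bsub>n\<^sub>b\<^esub> K(0)\<^sup>-\<^sup>1 z\<^bsup>n\<^sub>b\<^esup>\<close> up to a term of order \<open>z\<^bsup>n\<^sub>b + 1\<^esup>\<close>, times a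
  logarithm if \<open>n\<^sub>b = 1\<close>. Rotating the contour of its Fourier integral into the lower half
  plane turns this pointwise bound into the asserted asymptotics.\<close>

section \<open>Contour rotation and the half plane\<close>

text \<open>\<open>spec_meas\<close> is a definite description, so the evolution can be computed
  only after both existence of the measure (from the sign and the 1/z decay of the resolvent form)
  and its uniqueness are known; the operator itself enters only through solutions of the resolvent
  equation. The rotation needs a density that is holomorphic on a whole sector, while the standing
  assumption controls det(K+ - x) and det(K- - x) on the axis only. Compactness thickens bounded
  segments away from 0; the two ends need their own arguments, det K(0) \<noteq> 0 near 0 and the
  dominance of -z near infinity. Both error terms have one origin: the deviation of the continued
  resolvents from the inverse of K(0) contains log(z) \<Gamma>(z). For n_b \<ge> 2 this is O(z),
  like the analytic contributions; for n_b = 1 a term z log z survives. The parameter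
  \<open>b\<close>, equal to 0 or 1, carries this distinction from the matrix entries to the final
  integral. The factor n_b!/(it)^(n_b+1) is the Laplace integral of s^n_b along the rotated
  ray.\<close>

lemma integrable_lborel_inverse_1_plus_square: "integrable lborel (\<lambda>x::real. 1 / (1 + x\<^sup>2))"
  using integrable_inverse_1_plus_square[unfolded set_integrable_def]
  by (simp add: einterval_def inverse_eq_divide)

lemma set_integrable_decay:
  fixes f :: "real \<Rightarrow> complex"
  assumes "f \<in> borel_measurable lborel" "A \<in> sets lborel" "\<And>x. x \<in> A \<Longrightarrow> norm (f x) \<le> C / (1 + x\<^sup>2)"
  shows "set_integrable lborel A f"
  unfolding set_integrable_def
proof (rule Bochner_Integration.integrable_bound)
  show "integrable lborel (\<lambda>x::real. \<bar>C\<bar> * (1 / (1 + x\<^sup>2)))"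
    using integrable_lborel_inverse_1_plus_square by (rule integrable_mult_right)
  show "(\<lambda>x. indicat_real A x *\<^sub>R f x) \<in> borel_measurable lborel"
    using assms by measurable
  have "norm (indicat_real A x *\<^sub>R f x) \<le> norm (\<bar>C\<bar> * (1 / (1 + x\<^sup>2)))" for x
  proof (cases "x \<in> A")
    case True
    have "C / (1 + x\<^sup>2) \<le> \<bar>C\<bar> / (1 + x\<^sup>2)" by (intro divide_right_mono) (auto intro: add_nonneg_nonneg)
    then show ?thesis using assms(3)[OF True] True by (simp add: abs_mult)
  qed auto
  then show "AE x in lborel. norm (indicat_real A x *\<^sub>R f x) \<le> norm (\<bar>C\<bar> * (1 / (1 + x\<^sup>2)))" by simp
qed

text \<open>Link between two integrals: the definitions use the Lebesgue integral over the open half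
  line, whereas contour integrals and the fundamental theorem of calculus deliver gauge integrals
  over \<open>{0..b}\<close>. The endpoint 0 is a null set, and the decay bound provides
  integrability.\<close>

lemma tendsto_integral_decay:
  fixes f :: "real \<Rightarrow> complex"
  assumes cont: "continuous_on {0..} f" and bnd: "\<And>x. 0 \<le> x \<Longrightarrow> norm (f x) \<le> C / (1 + x\<^sup>2)"
  shows "set_integrable lborel {0<..} f"
    and "((\<lambda>b. integral {0..b} f) \<longlongrightarrow> (LBINT x:{0<..}. f x)) at_top"
proof -
  \<comment> \<open>\<open>f\<close> is controlled on \<open>{0..}\<close> only; cutting it off
    there makes it measurable on the whole line.\<close>
  define g where "g x = indicator {0..} x *\<^sub>R f x" for x
  have gm: "g \<in> borel_measurable lborel"
    using borel_measurable_continuous_on_indicator[OF _ cont] by (simp add: g_def[abs_def])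
  have gi: "set_integrable lborel {0..} g"
    by (rule set_integrable_decay[OF gm, where C = C]) (use bnd in \<open>auto simp: g_def\<close>)
  then have fi: "set_integrable lborel {0..} f"
    by (rule set_integrable_cong[THEN iffD1, rotated -1]) (auto simp: g_def)
  show "set_integrable lborel {0<..} f"
    by (rule set_integrable_subset[OF fi]) auto
  have "(LBINT x:{0<..}. f x) = (LBINT x:{0..}. f x)"
    unfolding set_lebesgue_integral_def
  proof (rule integral_cong_AE)
    show "AE x in lborel. indicat_real {0<..} x *\<^sub>R f x = indicat_real {0..} x *\<^sub>R f x"
      using AE_lborel_singleton[of "0::real"] by eventually_elim (auto simp: indicator_def)
    show "(\<lambda>x. indicat_real {0..} x *\<^sub>R f x) \<in> borel_measurable lborel"
      using gm by (simp add: g_def[abs_def])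
    have "(\<lambda>x. indicat_real {0<..} x *\<^sub>R f x) = (\<lambda>x. indicat_real {0<..} x *\<^sub>R g x)"
      by (auto simp: g_def indicator_def)
    then show "(\<lambda>x. indicat_real {0<..} x *\<^sub>R f x) \<in> borel_measurable lborel"
      using gm by simp
  qed
  moreover have "((\<lambda>b. LBINT x:{0..b}. f x) \<longlongrightarrow> (LBINT x:{0..}. f x)) at_top"
    by (rule tendsto_set_lebesgue_integral_at_top[OF _ fi]) auto
  moreover have "(LBINT x:{0..b}. f x) = integral {0..b} f" for b
    by (rule set_borel_integral_eq_integral(2)) (rule set_integrable_subset[OF fi], auto)
  ultimately show "((\<lambda>b. integral {0..b} f) \<longlongrightarrow> (LBINT x:{0<..}. f x)) at_top" by simp
qed

text \<open>The substitution z = x d carries the real segment from 0 to b to the ray of direction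
  \<open>d\<close>; both contour integrals unfold to the same integral over
  \<open>{0..1}\<close>.\<close>

lemma contour_integral_linepath_ray:
  assumes "continuous_on {0..b} (\<lambda>x. f (of_real x * d))" "0 < b"
  shows "(f has_contour_integral d * integral {0..b} (\<lambda>x. f (of_real x * d))) (linepath 0 (of_real b * d))"
proof -
  have "((\<lambda>z. f (z * d) * d) has_contour_integral d * integral {0..b} (\<lambda>x. f (of_real x * d))) (linepath 0 (of_real b))"
    unfolding has_contour_integral_linepath_Reals_iff[of 0 "of_real b" for b, simplified] using assms(2)
    by (subst has_contour_integral_linepath_Reals_iff)
       (auto simp: mult.commute[of _ d] intro!: has_integral_mult_right integrable_integral integrable_continuous_interval assms(1)[unfolded mult.commute[of _ d]])
  then have "((\<lambda>x. d * f (of_real b * of_real x * d) * of_real b) has_integral d * integral {0..b} (\<lambda>x. f (of_real x * d))) {0..1}"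
    unfolding has_contour_integral_linepath by (simp add: linepath_def scaleR_conv_of_real mult_ac)
  then show ?thesis
    unfolding has_contour_integral_linepath by (simp add: linepath_def scaleR_conv_of_real mult_ac)
qed

text \<open>For \<tau> > 0 the inequalities force Re z \<ge> 0, so this is the closed wedge between
  the positive axis and the ray of direction 1 - i\<tau>. Being convex, it contains the triangles to
  which Cauchy's theorem is applied.\<close>

definition lower_wedge :: "real \<Rightarrow> complex set" where
  "lower_wedge \<tau> = {z. - \<tau> * Re z \<le> Im z \<and> Im z \<le> 0}"

lemma convex_lower_wedge: "convex (lower_wedge \<tau>)"
proof -
  have "lower_wedge \<tau> = {z. inner (Complex (-\<tau>) (-1)) z \<le> 0} \<inter> {z. inner (Complex 0 1) z \<le> 0}"
    by (auto simp: lower_wedge_def inner_complex_def)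
  then show ?thesis by (auto intro!: convex_Int convex_halfspace_le)
qed

lemma ray_in_lower_wedge:
  assumes "0 \<le> \<tau>" "0 \<le> x"
  shows "complex_of_real x * Complex 1 (-\<tau>) \<in> lower_wedge \<tau>" "complex_of_real x \<in> lower_wedge \<tau>"
  using assms by (auto simp: lower_wedge_def)

text \<open>Cauchy's theorem on the triangle 0, b, b d. The side opposite to 0 has length b\<tau>
  and the integrand is at most C/b^2 on it, so its contribution C\<tau>/b disappears as b grows.
  Only continuity is required on the boundary, in particular at 0, where the intended integrand
  carries a logarithm.\<close>

lemma rotate_ray:
  fixes f :: "complex \<Rightarrow> complex"
  assumes \<tau>: "0 < \<tau>" and cont: "continuous_on (lower_wedge \<tau>) f"
    and hol: "f holomorphic_on interior (lower_wedge \<tau>)"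
    and bnd: "\<And>z. z \<in> lower_wedge \<tau> \<Longrightarrow> norm (f z) \<le> C / (1 + (norm z)\<^sup>2)"
  shows "(LBINT x:{0<..}. f (of_real x)) = Complex 1 (-\<tau>) * (LBINT x:{0<..}. f (of_real x * Complex 1 (-\<tau>)))"
proof -
  define d where "d = Complex 1 (-\<tau>)"
  have nd: "norm d \<ge> 1" by (simp add: d_def cmod_def real_le_rsqrt)
  have C0: "0 \<le> C"
    using order_trans[OF norm_ge_zero bnd[of 0]] by (simp add: lower_wedge_def)
  have c1: "continuous_on {0..} (\<lambda>x. f (of_real x))"
    by (rule continuous_on_compose2[OF cont]) (use \<tau> in \<open>auto intro!: continuous_intros simp: ray_in_lower_wedge\<close>)
  have c2: "continuous_on {0..} (\<lambda>x. f (of_real x * d))"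
    by (rule continuous_on_compose2[OF cont]) (use \<tau> in \<open>auto intro!: continuous_intros simp: ray_in_lower_wedge d_def\<close>)
  have b2: "norm (f (of_real x * d)) \<le> C / (1 + x\<^sup>2)" if "0 \<le> x" for x
  proof -
    have "norm (f (of_real x * d)) \<le> C / (1 + (norm (of_real x * d))\<^sup>2)"
      using bnd that \<tau> unfolding d_def by (simp add: ray_in_lower_wedge)
    also have "\<dots> \<le> C / (1 + x\<^sup>2)"
    proof (intro divide_left_mono C0 add_left_mono)
      have "x * 1 \<le> x * norm d" using nd that by (rule mult_left_mono)
      then show "x\<^sup>2 \<le> (norm (of_real x * d))\<^sup>2" using that by (intro power_mono) (auto simp: norm_mult)
    qed (auto intro!: mult_pos_pos add_pos_nonneg)
    finally show ?thesis .
  qed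
  have b1: "norm (f (of_real x)) \<le> C / (1 + x\<^sup>2)" if "0 \<le> x" for x
    using bnd[of "of_real x"] that \<tau> by (simp add: ray_in_lower_wedge)
  note t1 = tendsto_integral_decay(2)[OF c1 b1]
  note t2 = tendsto_integral_decay(2)[OF c2 b2]
  have diff: "norm (integral {0..b} (\<lambda>x. f (of_real x)) - d * integral {0..b} (\<lambda>x. f (of_real x * d))) \<le> C * \<tau> / b"
    if b: "0 < b" for b
  proof -
    have sub: "convex hull {0, of_real b, of_real b * d} \<subseteq> lower_wedge \<tau>"
      using b \<tau> by (intro hull_minimal convex_lower_wedge) (auto simp: lower_wedge_def d_def)
    have tri: "(f has_contour_integral 0) (linepath 0 (of_real b) +++ linepath (of_real b) (of_real b * d) +++ linepath (of_real b * d) 0)"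
      by (rule Cauchy_theorem_triangle_interior)
         (rule continuous_on_subset[OF cont sub] holomorphic_on_subset[OF hol interior_mono[OF sub]])+
    have i1: "(f has_contour_integral integral {0..b} (\<lambda>x. f (of_real x))) (linepath 0 (of_real b))"
      using contour_integral_linepath_ray[of b f 1] b continuous_on_subset[OF c1, of "{0..b}"] by auto
    have i2: "(f has_contour_integral d * integral {0..b} (\<lambda>x. f (of_real x * d))) (linepath 0 (of_real b * d))"
      using contour_integral_linepath_ray[of b f d] b continuous_on_subset[OF c2, of "{0..b}"] by auto
    have i2': "(f has_contour_integral - (d * integral {0..b} (\<lambda>x. f (of_real x * d)))) (linepath (of_real b * d) 0)"
      using has_contour_integral_reversepath[OF _ i2] by simp
    have seg: "closed_segment (of_real b) (of_real b * d) \<subseteq> convex hull {0, of_real b, of_real b * d}"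
      by (simp add: segment_convex_hull hull_mono)
    have "continuous_on (closed_segment (of_real b) (of_real b * d)) f"
      using cont sub seg by (meson continuous_on_subset)
    then obtain I where I: "(f has_contour_integral I) (linepath (of_real b) (of_real b * d))"
      using contour_integrable_continuous_linepath contour_integrable_on_def by blast
    have "(f has_contour_integral integral {0..b} (\<lambda>x. f (of_real x)) + (I + - (d * integral {0..b} (\<lambda>x. f (of_real x * d)))))
       (linepath 0 (of_real b) +++ linepath (of_real b) (of_real b * d) +++ linepath (of_real b * d) 0)"
      by (intro has_contour_integral_join i1 I i2' valid_path_join) auto
    with tri have eq: "integral {0..b} (\<lambda>x. f (of_real x)) + (I + - (d * integral {0..b} (\<lambda>x. f (of_real x * d)))) = 0"
      by (metis has_contour_integral_unique)
    have "norm I \<le> C / b\<^sup>2 * norm (of_real b * d - of_real b)"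
    proof (rule has_contour_integral_bound_linepath[OF I])
      show "0 \<le> C / b\<^sup>2" using C0 by simp
      fix z assume z: "z \<in> closed_segment (complex_of_real b) (of_real b * d)"
      then obtain u where u: "z = (1 - u) *\<^sub>R of_real b + u *\<^sub>R (of_real b * d)" by (auto simp: in_segment)
      \<comment> \<open>Both endpoints have real part b, so this side is vertical and keeps distance
        at least b from 0.\<close>
      have "Re z = b" unfolding u d_def by (simp add: algebra_simps)
      then have "b \<le> norm z" using complex_Re_le_cmod by metis
      then have "b\<^sup>2 \<le> 1 + (norm z)\<^sup>2" using b by (smt (verit) power_mono)
      moreover have "norm (f z) \<le> C / (1 + (norm z)\<^sup>2)" using bnd z seg sub by blast
      ultimately show "norm (f z) \<le> C / b\<^sup>2"
        using b C0 by (smt (verit) divide_left_mono mult_pos_pos zero_less_power)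
    qed
    also have "of_real b * d - of_real b = of_real b * (- \<i> * of_real \<tau>)"
      by (simp add: d_def complex_eq_iff)
    also have "C / b\<^sup>2 * norm (complex_of_real b * (- \<i> * of_real \<tau>)) = C * \<tau> / b"
      using b \<tau> by (simp add: norm_mult power2_eq_square)
    finally have "norm I \<le> C * \<tau> / b" .
    moreover have "integral {0..b} (\<lambda>x. f (of_real x)) - d * integral {0..b} (\<lambda>x. f (of_real x * d)) = - I"
      using eq by (simp add: algebra_simps add_eq_0_iff)
    ultimately show ?thesis by simp
  qed
  have "((\<lambda>b. integral {0..b} (\<lambda>x. f (of_real x)) - d * integral {0..b} (\<lambda>x. f (of_real x * d))) \<longlongrightarrow> 0) at_top"
  proof (rule Lim_null_comparison)
    show "\<forall>\<^sub>F b in at_top. norm (integral {0..b} (\<lambda>x. f (of_real x)) - d * integral {0..b} (\<lambda>x. f (of_real x * d))) \<le> C * \<tau> / b"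
      using eventually_gt_at_top[of 0] by eventually_elim (rule diff)
    show "((\<lambda>b. C * \<tau> / b) \<longlongrightarrow> 0) at_top" by real_asymp
  qed
  moreover have "((\<lambda>b. integral {0..b} (\<lambda>x. f (of_real x)) - d * integral {0..b} (\<lambda>x. f (of_real x * d))) \<longlongrightarrow>
     (LBINT x:{0<..}. f (of_real x)) - d * (LBINT x:{0<..}. f (of_real x * d))) at_top"
    by (intro tendsto_intros t1 t2)
  ultimately have "(LBINT x:{0<..}. f (of_real x)) - d * (LBINT x:{0<..}. f (of_real x * d)) = 0"
    by (meson tendsto_unique trivial_limit_at_top_linorder)
  then show ?thesis by (simp add: d_def)
qed

text \<open>The interval from -b to b is closed by the two slanted sides through ib. On them |Re z|
  + Im z = b, hence |z|^2 \<ge> b^2/2 and |f| \<le> 2C/b^2; each side has length at most 2b, which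
  yields the bound 8C/b.\<close>

lemma integral_upper_half_plane_0:
  fixes f :: "complex \<Rightarrow> complex"
  assumes cont: "continuous_on {z. 0 \<le> Im z} f"
    and hol: "f holomorphic_on {z. 0 < Im z}"
    and bnd: "\<And>z. 0 \<le> Im z \<Longrightarrow> norm (f z) \<le> C / (1 + (norm z)\<^sup>2)"
  shows "integrable lborel (\<lambda>x. f (of_real x))" "(LBINT x. f (of_real x)) = 0"
proof -
  have c1: "continuous_on UNIV (\<lambda>x. f (complex_of_real x))"
    by (rule continuous_on_compose2[OF cont]) (auto intro!: continuous_intros)
  have C0: "0 \<le> C"
    using order_trans[OF norm_ge_zero bnd[of 0]] by simp
  have "set_integrable lborel UNIV (\<lambda>x. f (complex_of_real x))"
    using bnd[of "of_real x" for x] borel_measurable_continuous_onI[OF c1] 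
    by (intro set_integrable_decay[where C = C]) auto
  then show fi: "integrable lborel (\<lambda>x. f (of_real x))" by (simp add: set_integrable_def)
  have lim: "(\<lambda>n. LBINT x:{-real n..real n}. f (of_real x)) \<longlonglongrightarrow> (LBINT x. f (of_real x))"
    unfolding set_lebesgue_integral_def
  proof (rule integral_dominated_convergence[where w = "\<lambda>x. norm (f (of_real x))"])
    show "AE x in lborel. (\<lambda>n. indicat_real {- real n..real n} x *\<^sub>R f (complex_of_real x)) \<longlonglongrightarrow> f (complex_of_real x)"
    proof (rule AE_I2)
      fix x :: real
      obtain N where N: "\<bar>x\<bar> \<le> real N" using real_arch_simple by blast
      have "\<forall>\<^sub>F n in sequentially. indicat_real {- real n..real n} x *\<^sub>R f (complex_of_real x) = f (complex_of_real x)"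
        using eventually_ge_at_top[of N] 
        by eventually_elim (use N in \<open>auto simp: indicator_def\<close>)
      then show "(\<lambda>n. indicat_real {- real n..real n} x *\<^sub>R f (complex_of_real x)) \<longlonglongrightarrow> f (complex_of_real x)"
        by (rule tendsto_eventually)
    qed
  qed (use fi borel_measurable_continuous_onI[OF c1] in \<open>auto simp: indicator_def\<close>)
  have est: "norm (LBINT x:{-b..b}. f (of_real x)) \<le> 8 * C / b" if b: "0 < b" for b
  proof -
    let ?b = "complex_of_real b"
    have "convex {z. 0 \<le> Im z}" 
      using convex_halfspace_ge[of 0 \<i>] by (simp add: inner_complex_def)
    then have sub: "convex hull {-?b, ?b, \<i> * ?b} \<subseteq> {z. 0 \<le> Im z}"
      using b by (intro hull_minimal) auto
    have int: "interior {z. 0 \<le> Im z} = {z. 0 < Im z}"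
      using interior_halfspace_ge[of \<i> 0] by (simp add: inner_complex_def)
    have tri: "(f has_contour_integral 0) (linepath (-?b) ?b +++ linepath ?b (\<i> * ?b) +++ linepath (\<i> * ?b) (-?b))"
      using interior_mono[OF sub] unfolding int
      by (intro Cauchy_theorem_triangle_interior)
         (auto intro: continuous_on_subset[OF cont sub] holomorphic_on_subset[OF hol])
    have bi: "set_integrable lborel {-b..b} (\<lambda>x. f (of_real x))"
      by (rule borel_integrable_atLeastAtMost') (rule continuous_on_subset[OF c1], simp)
    have i1: "(f has_contour_integral (LBINT x:{-b..b}. f (of_real x))) (linepath (-?b) ?b)"
      using b by (subst has_contour_integral_linepath_Reals_iff)
         (auto simp: set_borel_integral_eq_integral[OF bi])
    have bound: "norm I \<le> 2 * C / b\<^sup>2 * norm (q - p)"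
      if I: "(f has_contour_integral I) (linepath p q)" and pq: "(p = ?b \<and> q = \<i> * ?b) \<or> (p = \<i> * ?b \<and> q = -?b)" for I p q
    proof (rule has_contour_integral_bound_linepath[OF I])
      show "0 \<le> 2 * C / b\<^sup>2" using C0 by simp
      fix z assume z: "z \<in> closed_segment p q"
      then obtain u where u: "z = (1 - u) *\<^sub>R p + u *\<^sub>R q" "0 \<le> u" "u \<le> 1" by (auto simp: in_segment)
      have zz: "Re z = (1 - u) * Re p + u * Re q" "Im z = (1 - u) * Im p + u * Im q" by (auto simp: u)
      have "Im z = u * b \<and> \<bar>Re z\<bar> = (1 - u) * b \<or> Im z = (1 - u) * b \<and> \<bar>Re z\<bar> = u * b"
        using pq u(2,3) b unfolding zz by (elim disjE) (simp_all add: abs_mult)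
      then have im: "0 \<le> Im z" "\<bar>Re z\<bar> + Im z = b"
        using u(2,3) b by (elim disjE conjE; simp add: left_diff_distrib)+
      have "b\<^sup>2 = (\<bar>Re z\<bar> + Im z)\<^sup>2" by (simp only: im(2))
      then have "b\<^sup>2 \<le> 2 * (norm z)\<^sup>2"
        using sum_squares_bound[of "\<bar>Re z\<bar>" "Im z"] by (simp only: power2_sum cmod_power2) simp
      then have "b\<^sup>2 / 2 \<le> 1 + (norm z)\<^sup>2" by simp
      then have "C / (1 + (norm z)\<^sup>2) \<le> C / (b\<^sup>2 / 2)" using b C0 by (intro divide_left_mono) (auto intro!: mult_pos_pos add_pos_nonneg)
      then show "norm (f z) \<le> 2 * C / b\<^sup>2" using bnd[OF im(1)] by (simp add: mult.commute)
    qed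
    have "continuous_on (closed_segment ?b (\<i> * ?b)) f"
      by (rule continuous_on_subset[OF continuous_on_subset[OF cont sub]]) (simp add: segment_convex_hull hull_mono)
    then obtain I where I: "(f has_contour_integral I) (linepath ?b (\<i> * ?b))"
      using contour_integrable_continuous_linepath contour_integrable_on_def by blast
    have "continuous_on (closed_segment (\<i> * ?b) (-?b)) f"
      by (rule continuous_on_subset[OF continuous_on_subset[OF cont sub]]) (simp add: segment_convex_hull hull_mono)
    then obtain J where J: "(f has_contour_integral J) (linepath (\<i> * ?b) (-?b))"
      using contour_integrable_continuous_linepath contour_integrable_on_def by blast
    have "(f has_contour_integral (LBINT x:{-b..b}. f (of_real x)) + (I + J))
       (linepath (-?b) ?b +++ linepath ?b (\<i> * ?b) +++ linepath (\<i> * ?b) (-?b))"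
      by (intro has_contour_integral_join i1 I J valid_path_join) auto
    with tri have eq: "(LBINT x:{-b..b}. f (of_real x)) = - (I + J)"
      using has_contour_integral_unique by (metis eq_neg_iff_add_eq_0)
    have n1: "norm (\<i> * ?b - ?b) \<le> 2 * b" "norm (- ?b - \<i> * ?b) \<le> 2 * b"
      using b norm_triangle_ineq4[of "\<i> * ?b" ?b] norm_triangle_ineq4[of "-?b" "\<i> * ?b"] by (auto simp: norm_mult)
    have "norm I \<le> 2 * C / b\<^sup>2 * (2 * b)" "norm J \<le> 2 * C / b\<^sup>2 * (2 * b)"
      by (rule order_trans[OF bound[OF I]], simp, rule mult_left_mono[OF n1(1)], use C0 in simp)
         (rule order_trans[OF bound[OF J]], simp, rule mult_left_mono[OF n1(2)], use C0 in simp)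
    then have "norm I + norm J \<le> 8 * C / b" using b by (simp add: power2_eq_square field_simps)
    then show ?thesis unfolding eq norm_minus_cancel using norm_triangle_ineq[of I J] by linarith
  qed
  have "(\<lambda>n. LBINT x:{-real n..real n}. f (of_real x)) \<longlonglongrightarrow> 0"
  proof (rule Lim_null_comparison)
    show "\<forall>\<^sub>F n in sequentially. norm (LBINT x:{-real n..real n}. f (of_real x)) \<le> 8 * C / real n"
      using eventually_gt_at_top[of 0] by eventually_elim (rule est, simp)
    show "(\<lambda>n. 8 * C / real n) \<longlonglongrightarrow> 0" by real_asymp
  qed
  with lim show "(LBINT x. f (of_real x)) = 0" by (rule LIMSEQ_unique)
qed

section \<open>Stieltjes transforms of finite measures\<close>

lemma Im_inverse_shift: "Im (1 / (complex_of_real x - Complex s e)) = e / ((x - s)\<^sup>2 + e\<^sup>2)"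
  by (simp add: Im_divide)

lemma norm_stieltjes_kernel_le:
  assumes "Im z \<noteq> 0"
  shows "norm (1 / (complex_of_real x - z)) \<le> 1 / \<bar>Im z\<bar>"
proof -
  have "\<bar>Im z\<bar> \<le> norm (complex_of_real x - z)" using abs_Im_le_cmod[of "complex_of_real x - z"] by simp
  then show ?thesis using assms by (auto simp: norm_divide intro!: divide_left_mono mult_pos_pos)
qed

lemma integrable_stieltjes_kernel:
  assumes "finite_measure \<mu>" "sets \<mu> = sets borel" "Im z \<noteq> 0"
  shows "integrable \<mu> (\<lambda>x. 1 / (complex_of_real x - z))"
proof -
  interpret finite_measure \<mu> by fact
  show ?thesis
    by (rule integrable_const_bound[where B = "1 / \<bar>Im z\<bar>"])
       (use assms norm_stieltjes_kernel_le in \<open>auto simp: measurable_cong_sets[OF assms(2) refl]\<close>)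
qed

lemma Im_stieltjes:
  assumes "finite_measure \<mu>" "sets \<mu> = sets borel" "0 < e"
  shows "Im (\<integral>x. 1 / (complex_of_real x - Complex s e) \<partial>\<mu>) = (\<integral>x. e / ((x - s)\<^sup>2 + e\<^sup>2) \<partial>\<mu>)"
proof -
  have "Im (\<integral>x. 1 / (complex_of_real x - Complex s e) \<partial>\<mu>) = (\<integral>x. Im (1 / (complex_of_real x - Complex s e)) \<partial>\<mu>)"
    by (rule integral_bounded_linear[OF bounded_linear_Im, symmetric])
       (use integrable_stieltjes_kernel[of \<mu> "Complex s e"] assms in auto)
  then show ?thesis unfolding Im_inverse_shift .
qed

lemma has_derivative_arctan_poisson:
  assumes "0 < e"
  shows "((\<lambda>s. arctan ((s - x) / e)) has_real_derivative e / ((x - s)\<^sup>2 + e\<^sup>2)) (at s)"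
proof -
  have "((\<lambda>s. arctan ((s - x) / e)) has_real_derivative (1 / e) * inverse (1 + ((s - x) / e)\<^sup>2)) (at s)"
    using assms by (auto intro!: derivative_eq_intros)
  also have "(1 / e) * inverse (1 + ((s - x) / e)\<^sup>2) = e / ((x - s)\<^sup>2 + e\<^sup>2)"
    using assms by (simp add: power_divide divide_simps power2_commute) (simp add: power2_eq_square algebra_simps)
  finally show ?thesis .
qed

text \<open>The Poisson kernel is nonnegative, so Tonelli permits integrating over s first, where
  the arctangent is a primitive.\<close>

lemma integral_Im_stieltjes:
  assumes fin: "finite_measure \<mu>" and sets: "sets \<mu> = sets borel" and e: "0 < e" and ab: "a \<le> b"
  shows "(LBINT s:{a..b}. Im (\<integral>x. 1 / (complex_of_real x - Complex s e) \<partial>\<mu>))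
         = (\<integral>x. arctan ((b - x) / e) - arctan ((a - x) / e) \<partial>\<mu>)"
proof -
  interpret finite_measure \<mu> by fact
  note sf = sigma_finite_measure_axioms
  interpret pair_sigma_finite lborel \<mu> by unfold_locales
  define k where "k s x = e / ((x - s)\<^sup>2 + e\<^sup>2)" for s x :: real
  have k_nn: "0 \<le> k s x" and k_le: "k s x \<le> 1 / e" for s x
  proof -
    have "e * e \<le> (x - s)\<^sup>2 + e\<^sup>2" by (simp add: power2_eq_square)
    then show "k s x \<le> 1 / e" using e by (simp add: k_def divide_simps add_nonneg_pos)
  qed (use e in \<open>auto simp: k_def\<close>)
  have km: "(\<lambda>(s, x). k s x) \<in> borel_measurable (lborel \<Otimes>\<^sub>M \<mu>)"
    by (simp add: k_def measurable_cong_sets[OF sets_pair_measure_cong[OF refl sets] refl])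
  have km1: "k s \<in> borel_measurable \<mu>" for s
    unfolding k_def[abs_def] by (simp add: measurable_cong_sets[OF sets refl])
  have ki: "integrable \<mu> (k s)" for s
    by (rule integrable_const_bound[where B = "1 / e"]) (use k_nn k_le km1 in auto)
  have inner: "(\<integral>\<^sup>+s. ennreal (indicator {a..b} s * k s x) \<partial>lborel) = ennreal (arctan ((b - x) / e) - arctan ((a - x) / e))" for x
  proof -
    have "(\<integral>\<^sup>+s. ennreal (k s x) * indicator {a..b} s \<partial>lborel) = ennreal (arctan ((b - x) / e) - arctan ((a - x) / e))"
      by (rule nn_integral_FTC_Icc)
         (use has_derivative_arctan_poisson[OF e] k_nn ab in \<open>auto simp: k_def intro: has_field_derivative_at_within\<close>)
    then show ?thesis by (simp add: ennreal_mult' ennreal_indicator mult.commute k_nn)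
  qed
  have gm: "(\<lambda>s. \<integral>x. k s x \<partial>\<mu>) \<in> borel_measurable lborel"
    using sigma_finite_measure.borel_measurable_lebesgue_integral[OF sf, of "\<lambda>s x. k s x"] km by simp
  have am: "arctan ((a - x) / e) \<le> arctan ((b - x) / e)" for x
    using ab e by (intro arctan_monotone') (simp add: divide_right_mono)
  have "(\<integral>\<^sup>+s. ennreal (indicator {a..b} s * (\<integral>x. k s x \<partial>\<mu>)) \<partial>lborel)
      = (\<integral>\<^sup>+s. (\<integral>\<^sup>+x. ennreal (indicator {a..b} s * k s x) \<partial>\<mu>) \<partial>lborel)"
  proof (intro nn_integral_cong)
    fix s :: real
    have "(\<integral>\<^sup>+x. ennreal (indicator {a..b} s * k s x) \<partial>\<mu>) = ennreal (\<integral>x. indicator {a..b} s * k s x \<partial>\<mu>)"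
      by (rule nn_integral_eq_integral) (use ki k_nn in auto)
    then show "ennreal (indicator {a..b} s * (\<integral>x. k s x \<partial>\<mu>)) = (\<integral>\<^sup>+x. ennreal (indicator {a..b} s * k s x) \<partial>\<mu>)"
      by simp
  qed
  also have "\<dots> = (\<integral>\<^sup>+x. (\<integral>\<^sup>+s. ennreal (indicator {a..b} s * k s x) \<partial>lborel) \<partial>\<mu>)"
    by (rule Fubini'[symmetric]) (use km in \<open>simp add: split_beta'\<close>)
  also have "\<dots> = (\<integral>\<^sup>+x. ennreal (arctan ((b - x) / e) - arctan ((a - x) / e)) \<partial>\<mu>)"
    unfolding inner ..
  finally have "(\<integral>\<^sup>+s. ennreal (indicator {a..b} s * (\<integral>x. k s x \<partial>\<mu>)) \<partial>lborel)
     = (\<integral>\<^sup>+x. ennreal (arctan ((b - x) / e) - arctan ((a - x) / e)) \<partial>\<mu>)" .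
  moreover have "(\<integral>s. indicator {a..b} s * (\<integral>x. k s x \<partial>\<mu>) \<partial>lborel) =
     enn2real (\<integral>\<^sup>+s. ennreal (indicator {a..b} s * (\<integral>x. k s x \<partial>\<mu>)) \<partial>lborel)"
    by (rule integral_eq_nn_integral) (use gm k_nn in \<open>auto intro!: mult_nonneg_nonneg\<close>)
  moreover have "(\<integral>x. arctan ((b - x) / e) - arctan ((a - x) / e) \<partial>\<mu>) =
     enn2real (\<integral>\<^sup>+x. ennreal (arctan ((b - x) / e) - arctan ((a - x) / e)) \<partial>\<mu>)"
    by (rule integral_eq_nn_integral) (use am in \<open>auto simp: measurable_cong_sets[OF sets refl]\<close>)
  ultimately show ?thesis
    by (simp add: set_lebesgue_integral_def Im_stieltjes[OF fin sets e] k_def)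
qed

lemma tendsto_arctan_sgn: "(\<lambda>n. arctan (c / (1 / real (Suc n)))) \<longlonglongrightarrow> pi / 2 * sgn c"
proof -
  consider "c > 0" | "c = 0" | "c < 0" by linarith
  then show ?thesis
  proof cases
    case 1 then show ?thesis by simp real_asymp
  next
    case 3 then show ?thesis by simp real_asymp
  qed simp
qed

text \<open>As the height 1/(n+1) tends to 0, the arctangents converge to \<pi>/2 times signs,
  dominated by \<pi>. For a < b the limit is \<pi> times the sum of the mass of the open interval
  and half the masses of the two endpoints, since sgn 0 = 0.\<close>

lemma stieltjes_inversion:
  assumes fin: "finite_measure \<mu>" and sets: "sets \<mu> = sets borel" and ab: "a \<le> b"
  shows "(\<lambda>n. LBINT s:{a..b}. Im (\<integral>x. 1 / (complex_of_real x - Complex s (1 / real (Suc n))) \<partial>\<mu>))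
     \<longlonglongrightarrow> (\<integral>x. pi / 2 * sgn (b - x) - pi / 2 * sgn (a - x) \<partial>\<mu>)"
proof -
  interpret finite_measure \<mu> by fact
  have "(\<lambda>n. \<integral>x. arctan ((b - x) / (1 / real (Suc n))) - arctan ((a - x) / (1 / real (Suc n))) \<partial>\<mu>)
     \<longlonglongrightarrow> (\<integral>x. pi / 2 * sgn (b - x) - pi / 2 * sgn (a - x) \<partial>\<mu>)"
  proof (rule integral_dominated_convergence[where w = "\<lambda>_. pi"])
    show "AE x in \<mu>. (\<lambda>n. arctan ((b - x) / (1 / real (Suc n))) - arctan ((a - x) / (1 / real (Suc n))))
        \<longlonglongrightarrow> pi / 2 * sgn (b - x) - pi / 2 * sgn (a - x)"
      by (intro AE_I2 tendsto_diff tendsto_arctan_sgn)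
    have "\<bar>arctan u - arctan v\<bar> \<le> pi" for u v
      using arctan_bounded[of u] arctan_bounded[of v] by linarith
    then show "AE x in \<mu>. norm (arctan ((b - x) / (1 / real (Suc n))) - arctan ((a - x) / (1 / real (Suc n)))) \<le> pi" for n
      by simp
  qed (auto simp: measurable_cong_sets[OF sets refl])
  then show ?thesis using integral_Im_stieltjes[OF fin sets _ ab] by simp
qed

text \<open>Moving endpoints \<open>l n\<close> and \<open>u n\<close> remove the half weights of
  atoms at the ends: the hypothesis \<open>lim\<close> says that each point is eventually counted in
  full or not at all.\<close>

lemma sgn_integral_tendsto_measure:
  assumes fin: "finite_measure \<mu>" and sets: "sets \<mu> = sets borel" and A: "A \<in> sets borel"
    and lim: "\<And>x. \<forall>\<^sub>F n in sequentially. sgn (u n - x) - sgn (l n - x) = 2 * indicat_real A x"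
  shows "(\<lambda>n. \<integral>x. pi / 2 * sgn (u n - x) - pi / 2 * sgn (l n - x) \<partial>\<mu>) \<longlonglongrightarrow> pi * measure \<mu> A"
proof -
  interpret finite_measure \<mu> by fact
  have "(\<lambda>n. \<integral>x. pi / 2 * sgn (u n - x) - pi / 2 * sgn (l n - x) \<partial>\<mu>) \<longlonglongrightarrow> (\<integral>x. pi * indicat_real A x \<partial>\<mu>)"
  proof (rule integral_dominated_convergence[where w = "\<lambda>_. pi"])
    show "AE x in \<mu>. (\<lambda>n. pi / 2 * sgn (u n - x) - pi / 2 * sgn (l n - x)) \<longlonglongrightarrow> pi * indicat_real A x"
    proof (rule AE_I2)
      fix x
      from lim[of x] have "\<forall>\<^sub>F n in sequentially. pi / 2 * sgn (u n - x) - pi / 2 * sgn (l n - x) = pi * indicat_real A x"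
        by eventually_elim (simp add: right_diff_distrib[symmetric] flip: times_divide_eq_left)
      then show "(\<lambda>n. pi / 2 * sgn (u n - x) - pi / 2 * sgn (l n - x)) \<longlonglongrightarrow> pi * indicat_real A x"
        by (rule tendsto_eventually)
    qed
    show "AE x in \<mu>. norm (pi / 2 * sgn (u n - x) - pi / 2 * sgn (l n - x)) \<le> pi" for n
      by (rule AE_I2) (auto simp: sgn_if)
  qed (use A in \<open>auto simp: measurable_cong_sets[OF sets refl]\<close>)
  also have "(\<integral>x. pi * indicat_real A x \<partial>\<mu>) = pi * measure \<mu> A"
    using A by (simp add: sets)
  finally show ?thesis .
qed

text \<open>The upper end approaches b from the right, so an atom at b counts in full; the lower end
  escapes to minus infinity.\<close>

lemma sgn_diff_eventually_Iic:
  "\<forall>\<^sub>F n in sequentially. sgn (b + 1 / real (Suc n) - x) - sgn (- real n - x) = 2 * indicat_real {..b} x"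
proof -
  have e1: "\<forall>\<^sub>F n in sequentially. - real n < x" by real_asymp
  show ?thesis
  proof (cases "x \<le> b")
    case True
    show ?thesis using e1 
    proof eventually_elim
      case (elim n)
      have "0 < 1 / real (Suc n)" by simp
      then have "0 < b + 1 / real (Suc n) - x" using True by linarith
      then show ?case using elim True by (simp add: sgn_if)
    qed
  next
    case False
    then have "\<forall>\<^sub>F n in sequentially. b + 1 / real (Suc n) < x" by real_asymp
    with e1 show ?thesis by eventually_elim (use False in \<open>simp add: sgn_if\<close>)
  qed
qed

text \<open>Both ends are approached from the right: an atom at b is included and one at 0 is
  excluded, as the projection E((0,\<infinity>)) demands.\<close>

lemma sgn_diff_eventually_Ioc:
  assumes "0 < b"
  shows "\<forall>\<^sub>F n in sequentially. sgn (b + 1 / real (Suc n) - x) - sgn (1 / real (Suc n) - x) = 2 * indicat_real {0<..b} x"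
proof -
  consider "x \<le> 0" | "0 < x" "x \<le> b" | "b < x" by linarith
  then show ?thesis
  proof cases
    case 1
    have "sgn (b + p - x) - sgn (p - x) = 2 * indicat_real {0<..b} x" if "0 < p" for p
      using that 1 assms by (simp add: sgn_if)
    note this[of "1 / real (Suc n)" for n]
    then show ?thesis by simp
  next
    case 2
    then have "\<forall>\<^sub>F n in sequentially. 1 / real (Suc n) < x" by real_asymp
    then show ?thesis
    proof eventually_elim
      case (elim n)
      have "0 < 1 / real (Suc n)" by simp
      then have "0 < b + 1 / real (Suc n) - x" using 2 by linarith
      then show ?case using elim 2 by (simp add: sgn_if)
    qed
  next
    case 3
    then have "\<forall>\<^sub>F n in sequentially. b + 1 / real (Suc n) < x" by real_asymp
    then show ?thesis
    proof eventually_elim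
      case (elim n)
      then show ?case using 3 assms by (simp add: sgn_if)
    qed
  qed
qed

text \<open>Inversion over moving intervals recovers both distribution functions from the common
  transform. Together with existence this justifies the definite description in
  \<open>spec_meas\<close>.\<close>

lemma stieltjes_unique:
  assumes "finite_measure \<mu>" "sets \<mu> = sets borel" "finite_measure \<nu>" "sets \<nu> = sets borel"
    and eq: "\<And>z. 0 < Im z \<Longrightarrow> (\<integral>x. 1 / (complex_of_real x - z) \<partial>\<mu>) = (\<integral>x. 1 / (complex_of_real x - z) \<partial>\<nu>)"
  shows "\<mu> = \<nu>"
proof (rule cdf_unique')
  show "finite_borel_measure \<mu>" "finite_borel_measure \<nu>"
    using assms by (auto simp: finite_borel_measure_def finite_borel_measure_axioms_def)
  have int: "(\<integral>x. pi / 2 * sgn (b - x) - pi / 2 * sgn (a - x) \<partial>\<mu>) = (\<integral>x. pi / 2 * sgn (b - x) - pi / 2 * sgn (a - x) \<partial>\<nu>)"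
    if "a \<le> b" for a b
    using stieltjes_inversion[OF assms(1,2) that] stieltjes_inversion[OF assms(3,4) that]
    by (simp add: eq LIMSEQ_unique)
  show "cdf \<mu> = cdf \<nu>"
  proof
    fix b
    let ?I = "\<lambda>M n. \<integral>x. pi / 2 * sgn (b + 1 / real (Suc n) - x) - pi / 2 * sgn (- real n - x) \<partial>M"
    have l: "?I M \<longlonglongrightarrow> pi * measure M {..b}" if "finite_measure M" "sets M = sets borel" for M
      by (rule sgn_integral_tendsto_measure[OF that _ sgn_diff_eventually_Iic]) simp
    have "\<forall>\<^sub>F n in sequentially. - real n \<le> b + 1 / real (Suc n)" by real_asymp
    then have "\<forall>\<^sub>F n in sequentially. ?I \<mu> n = ?I \<nu> n" by eventually_elim (rule int)
    then have "?I \<mu> \<longlonglongrightarrow> pi * measure \<nu> {..b}" using l[OF assms(3,4)] by (simp add: tendsto_cong)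
    with l[OF assms(1,2)] show "cdf \<mu> b = cdf \<nu> b" using LIMSEQ_unique by (fastforce simp: cdf_def)
  qed
qed

text \<open>\<open>G\<close> continues the transform up to the positive axis from above, in a wedge
  without its vertex. Inversion on compact intervals gives \<pi> \<mu>((0,b]) as the integral of Im
  G, and equality of distribution functions identifies \<pi>\<mu> on (0,\<infinity>) with the
  density Im G. Mass at 0 or on the negative axis is not restricted.\<close>

lemma stieltjes_density:
  fixes G :: "complex \<Rightarrow> complex" and \<phi> :: "real \<Rightarrow> complex"
  assumes fin: "finite_measure \<mu>" and sets: "sets \<mu> = sets borel" and \<tau>: "0 < \<tau>"
    and cont: "continuous_on {z. 0 < Re z \<and> 0 \<le> Im z \<and> Im z \<le> \<tau> * Re z} G"
    and eq: "\<And>z. 0 < Re z \<Longrightarrow> 0 < Im z \<Longrightarrow> Im z \<le> \<tau> * Re z \<Longrightarrow> (\<integral>x. 1 / (complex_of_real x - z) \<partial>\<mu>) = G z"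
    and int: "set_integrable lborel {0<..} (\<lambda>s. Im (G (of_real s)))"
    and \<phi>: "\<phi> \<in> borel_measurable borel"
  shows "pi * (LINT x:{0<..}|\<mu>. \<phi> x) = (LBINT x:{0<..}. of_real (Im (G (of_real x))) * \<phi> x)"
proof -
  interpret finite_measure \<mu> by fact
  define h where "h s = Im (G (of_real s))" for s
  define W where "W = {z. 0 < Re z \<and> 0 \<le> Im z \<and> Im z \<le> \<tau> * Re z}"
  have hc: "continuous_on {0<..} h"
    unfolding h_def by (intro continuous_intros continuous_on_compose2[OF cont]) (use \<tau> in auto)
  \<comment> \<open>\<open>N1\<close> is \<pi>\<mu> restricted to (0,\<infinity>) and
    \<open>N2\<close> has density Im G there; the goal is their equality.\<close>
  define N1 where "N1 = density \<mu> (\<lambda>x. ennreal (pi * indicator {0<..} x))"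
  define N2 where "N2 = density lborel (\<lambda>x. ennreal (indicator {0<..} x * h x))"
  have conv: "(\<lambda>n. Im (G (Complex s (1 / real (Suc n))))) \<longlonglongrightarrow> h s" if s: "0 < s" for s
  proof -
    have cs: "(\<lambda>n. Complex s (1 / real (Suc n))) \<longlonglongrightarrow> Complex s 0"
      by (intro tendsto_Complex tendsto_const) real_asymp
    have "\<forall>\<^sub>F n in sequentially. 1 / real (Suc n) \<le> \<tau> * s"
      using mult_pos_pos[OF \<tau> s] by real_asymp
    then have "\<forall>\<^sub>F n in sequentially. Complex s (1 / real (Suc n)) \<in> W"
      by eventually_elim (use s in \<open>auto simp: W_def\<close>)
    then have "(\<lambda>n. G (Complex s (1 / real (Suc n)))) \<longlonglongrightarrow> G (Complex s 0)"
      by (intro continuous_on_tendsto_compose[OF cont cs, folded W_def]) (use s \<tau> in \<open>auto simp: W_def\<close>)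
    then show ?thesis by (auto simp: h_def complex_of_real_def intro: tendsto_Im)
  qed
  \<comment> \<open>Nonnegativity is inherited from the Poisson integrals of \<mu>, and it makes
    \<open>h\<close> admissible as a density.\<close>
  have h_nn: "0 \<le> h s" if s: "0 < s" for s
  proof (rule tendsto_lowerbound[OF conv[OF s]])
    have "\<forall>\<^sub>F n in sequentially. 1 / real (Suc n) \<le> \<tau> * s"
      using mult_pos_pos[OF \<tau> s] by real_asymp
    then show "\<forall>\<^sub>F n in sequentially. 0 \<le> Im (G (Complex s (1 / real (Suc n))))"
    proof eventually_elim
      case (elim n)
      then have "G (Complex s (1 / real (Suc n))) = (\<integral>x. 1 / (complex_of_real x - Complex s (1 / real (Suc n))) \<partial>\<mu>)"
        using s by (intro eq[symmetric]) auto
      then show ?case by (simp add: Im_stieltjes[OF fin sets])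
    qed
  qed simp
  have hm: "(\<lambda>x. indicator {0<..} x * h x) \<in> borel_measurable borel"
    using borel_measurable_continuous_on_indicator[OF _ hc] by simp
  have hi: "integrable lborel (\<lambda>x. indicator {0<..} x * h x)"
    using int by (simp add: h_def set_integrable_def)
  have hnn: "0 \<le> indicator {0<..} x * h x" for x
    using h_nn by (auto simp: indicator_def)
  have L: "pi * measure \<mu> {0<..b} = (LBINT s:{0<..b}. h s)" if b: "0 < b" for b
  proof -
    have c: "(\<lambda>n. LBINT s:{a..c}. Im (\<integral>x. 1 / (complex_of_real x - Complex s (1 / real (Suc n))) \<partial>\<mu>)) \<longlonglongrightarrow> (LBINT s:{a..c}. h s)"
      (is "?X \<longlonglongrightarrow> _") if a: "0 < a" "a \<le> c" for a c
    proof -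
      have at: "0 < \<tau> * a" using a \<tau> by simp
      \<comment> \<open>\<open>G\<close> need not be bounded near 0, but it is bounded on this
        compact rectangle over [a, c], which supplies the dominating constant as soon as 1/(n+1)
        \<le> \<tau>a.\<close>
      define K where "K = cbox (Complex a 0) (Complex c (\<tau> * a))"
      have KW: "K \<subseteq> W"
      proof
        fix z assume "z \<in> K"
        then have "a \<le> Re z" "0 \<le> Im z" "Im z \<le> \<tau> * a" by (auto simp: K_def in_cbox_complex_iff)
        moreover have "\<tau> * a \<le> \<tau> * Re z" using \<open>a \<le> Re z\<close> \<tau> by simp
        ultimately show "z \<in> W" using a by (auto simp: W_def)
      qed
      have "compact (G ` K)"
        by (intro compact_continuous_image continuous_on_subset[OF cont KW[unfolded W_def]]) (simp add: K_def)
      then obtain B where B: "\<And>z. z \<in> K \<Longrightarrow> norm (G z) \<le> B"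
        using compact_imp_bounded bounded_iff by (metis imageI)
      obtain N where N: "1 / real (Suc n) \<le> \<tau> * a" if "N \<le> n" for n
      proof -
        have "\<forall>\<^sub>F n in sequentially. 1 / real (Suc n) \<le> \<tau> * a" using at by real_asymp
        then show ?thesis using that by (auto simp: eventually_sequentially)
      qed
      let ?e = "\<lambda>n. 1 / real (Suc (n + N))"
      have inK: "Complex s (?e n) \<in> K" if "s \<in> {a..c}" for s n
        using that N[of "n + N"] by (auto simp: K_def in_cbox_complex_iff)
      have "(\<lambda>n. LBINT s:{a..c}. Im (G (Complex s (?e n)))) \<longlonglongrightarrow> (LBINT s:{a..c}. h s)"
        unfolding set_lebesgue_integral_def
      proof (rule integral_dominated_convergence[where w = "\<lambda>s. indicator {a..c} s *\<^sub>R B"])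
        show "integrable lborel (\<lambda>s. indicator {a..c} s *\<^sub>R B)"
          using borel_integrable_atLeastAtMost'[of a c "\<lambda>_. B"] by (simp add: set_integrable_def)
        have "continuous_on {a..c} h" by (rule continuous_on_subset[OF hc]) (use a in auto)
        then show "(\<lambda>s. indicator {a..c} s *\<^sub>R h s) \<in> borel_measurable lborel"
          using borel_measurable_continuous_on_indicator[of "{a..c}" h] by simp
        show "(\<lambda>s. indicator {a..c} s *\<^sub>R Im (G (Complex s (?e n)))) \<in> borel_measurable lborel" for n
        proof -
          have cG: "continuous_on {a..c} (\<lambda>s. Im (G (Complex s (?e n))))"
            by (intro continuous_intros continuous_on_compose2[OF continuous_on_subset[OF cont KW[unfolded W_def]]])
               (use inK in \<open>auto intro!: continuous_intros simp: Complex_eq\<close>)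
          show ?thesis
            using borel_measurable_continuous_on_indicator[OF _ cG] by simp
        qed
        show "AE s in lborel. (\<lambda>n. indicator {a..c} s *\<^sub>R Im (G (Complex s (?e n)))) \<longlonglongrightarrow> indicator {a..c} s *\<^sub>R h s"
        proof (rule AE_I2)
          fix s
          show "(\<lambda>n. indicator {a..c} s *\<^sub>R Im (G (Complex s (?e n)))) \<longlonglongrightarrow> indicator {a..c} s *\<^sub>R h s"
          proof (cases "s \<in> {a..c}")
            case True
            then have "0 < s" using a by auto
            from LIMSEQ_ignore_initial_segment[OF conv[OF this], of N] True show ?thesis by simp
          qed simp
        qed
        show "AE s in lborel. norm (indicator {a..c} s *\<^sub>R Im (G (Complex s (?e n)))) \<le> indicator {a..c} s *\<^sub>R B" for n
          using order_trans[OF abs_Im_le_cmod B[OF inK]] by (intro AE_I2) (auto simp: indicator_def)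
      qed
      moreover have "(LBINT s:{a..c}. Im (G (Complex s (?e n)))) =
          (LBINT s:{a..c}. Im (\<integral>x. 1 / (complex_of_real x - Complex s (?e n)) \<partial>\<mu>))" for n
      proof (rule set_lebesgue_integral_cong, simp, intro allI impI)
        fix s assume "s \<in> {a..c}"
        from inK[OF this, of n] KW have "Complex s (?e n) \<in> W" by auto
        then show "Im (G (Complex s (?e n))) = Im (\<integral>x. 1 / (complex_of_real x - Complex s (?e n)) \<partial>\<mu>)"
          by (subst eq) (auto simp: W_def)
      qed
      ultimately have "(\<lambda>n. ?X (n + N)) \<longlonglongrightarrow> (LBINT s:{a..c}. h s)" by simp
      then show ?thesis by (rule LIMSEQ_offset)
    qed
    have I: "(\<integral>x. pi / 2 * sgn (c - x) - pi / 2 * sgn (a - x) \<partial>\<mu>) = (LBINT s:{a..c}. h s)"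
      if a: "0 < a" "a \<le> c" for a c
      using LIMSEQ_unique[OF stieltjes_inversion[OF fin sets a(2)] c[OF a]] .
    have l1: "(\<lambda>n. \<integral>x. pi / 2 * sgn (b + 1 / real (Suc n) - x) - pi / 2 * sgn (1 / real (Suc n) - x) \<partial>\<mu>)
        \<longlonglongrightarrow> pi * measure \<mu> {0<..b}"
      by (rule sgn_integral_tendsto_measure[OF fin sets _ sgn_diff_eventually_Ioc[OF b]]) simp
    have l1': "(\<lambda>n. LBINT s:{1 / real (Suc n)..b + 1 / real (Suc n)}. h s) \<longlonglongrightarrow> pi * measure \<mu> {0<..b}"
      using l1 I[of "1 / real (Suc n)" "b + 1 / real (Suc n)" for n] b by simp
    \<comment> \<open>The passage of the left end to 0 is dominated by \<open>h\<close> itself,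
      which is integrable by hypothesis although possibly unbounded near 0.\<close>
    have l2: "(\<lambda>n. LBINT s:{1 / real (Suc n)..b + 1 / real (Suc n)}. h s) \<longlonglongrightarrow> (LBINT s:{0<..b}. h s)"
      unfolding set_lebesgue_integral_def
    proof (rule integral_dominated_convergence[where w = "\<lambda>x. indicator {0<..} x * h x"])
      have eq0: "(\<lambda>x. indicator A x *\<^sub>R h x) = (\<lambda>x. indicator A x *\<^sub>R (indicator {0<..} x * h x))" if "A \<subseteq> {0<..}" for A
        by (intro ext) (use that in \<open>auto simp: indicator_def\<close>)
      show "(\<lambda>x. indicator {0<..b} x *\<^sub>R h x) \<in> borel_measurable lborel"
        by (subst eq0) (use hm in auto)
      have sub: "{1 / real (Suc n)..b + 1 / real (Suc n)} \<subseteq> {0<..}" for n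
      proof -
        have "0 < 1 / real (Suc n)" by simp
        then show ?thesis by (meson atLeastAtMost_iff greaterThan_iff less_le_trans subsetI)
      qed
      show "(\<lambda>x. indicator {1 / real (Suc n)..b + 1 / real (Suc n)} x *\<^sub>R h x) \<in> borel_measurable lborel" for n
        by (subst eq0[OF sub]) (use hm in auto)
      show "AE x in lborel. norm (indicator {1 / real (Suc n)..b + 1 / real (Suc n)} x *\<^sub>R h x) \<le> indicator {0<..} x * h x" for n
        using sub[of n] h_nn by (intro AE_I2) (auto simp: indicator_def)
      show "AE x in lborel. (\<lambda>n. indicator {1 / real (Suc n)..b + 1 / real (Suc n)} x *\<^sub>R h x) \<longlonglongrightarrow> indicator {0<..b} x *\<^sub>R h x"
      proof (rule AE_I2, rule tendsto_eventually)
        fix x :: real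
        consider "x \<le> 0" | "0 < x" "x \<le> b" | "b < x" by linarith
        then show "\<forall>\<^sub>F n in sequentially. indicator {1 / real (Suc n)..b + 1 / real (Suc n)} x *\<^sub>R h x = indicator {0<..b} x *\<^sub>R h x"
        proof cases
          case 1
          then have "x \<notin> {1 / real (Suc n)..b + 1 / real (Suc n)}" for n using sub[of n] by fastforce
          then show ?thesis using 1 by simp
        next
          case 2
          then have "\<forall>\<^sub>F n in sequentially. 1 / real (Suc n) < x" by real_asymp
          then show ?thesis
          proof eventually_elim
            case (elim n)
            have "0 < 1 / real (Suc n)" by simp
            then have "x \<le> b + 1 / real (Suc n)" using 2 by linarith
            then show ?case using elim 2 by simp
          qed
        next
          case 3
          then have "\<forall>\<^sub>F n in sequentially. b + 1 / real (Suc n) < x" by real_asymp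
          then show ?thesis by eventually_elim (use 3 in simp)
        qed
      qed
    qed (rule hi)
    show ?thesis using LIMSEQ_unique[OF l1' l2] .
  qed
  have e1: "emeasure N1 {..b} = ennreal (pi * measure \<mu> {0<..b})" for b
  proof -
    have "emeasure N1 {..b} = (\<integral>\<^sup>+x. ennreal pi * indicator {0<..b} x \<partial>\<mu>)"
      unfolding N1_def by (subst emeasure_density)
        (auto simp: sets measurable_cong_sets[OF sets refl] indicator_def intro!: nn_integral_cong)
    also have "\<dots> = ennreal (pi * measure \<mu> {0<..b})"
      by (subst nn_integral_cmult_indicator) (auto simp: sets emeasure_eq_measure ennreal_mult)
    finally show ?thesis .
  qed
  have e2: "emeasure N2 {..b} = ennreal (LBINT s:{0<..b}. h s)" for b
  proof -
    have "emeasure N2 {..b} = (\<integral>\<^sup>+x. ennreal (indicator {0<..b} x * h x) \<partial>lborel)"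
      unfolding N2_def using hm by (subst emeasure_density) (auto simp: indicator_def intro!: nn_integral_cong)
    also have "\<dots> = ennreal (\<integral>x. indicator {0<..b} x * h x \<partial>lborel)"
    proof (rule nn_integral_eq_integral)
      have "integrable lborel (\<lambda>x. indicator {..b} x *\<^sub>R (indicator {0<..} x * h x))"
        by (rule integrable_mult_indicator[OF _ hi]) simp
      then show "integrable lborel (\<lambda>x. indicator {0<..b} x * h x)"
        by (rule Bochner_Integration.integrable_cong[THEN iffD1, rotated -1]) (auto simp: indicator_def)
      show "AE x in lborel. 0 \<le> indicator {0<..b} x * h x" using h_nn by (intro AE_I2) (auto simp: indicator_def)
    qed
    finally show ?thesis by (simp add: set_lebesgue_integral_def)
  qed
  have f1: "finite_measure N1"
  proof (rule finite_measureI)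
    have "emeasure N1 (space N1) = (\<integral>\<^sup>+x. ennreal (pi * indicator {0<..} x) * indicator (space N1) x \<partial>\<mu>)"
      unfolding N1_def by (subst emeasure_density) (auto simp: measurable_cong_sets[OF sets refl])
    also have "\<dots> \<le> (\<integral>\<^sup>+x. ennreal pi \<partial>\<mu>)"
      by (rule nn_integral_mono) (auto simp: indicator_def)
    also have "\<dots> < \<infinity>" by (simp add: emeasure_eq_measure ennreal_mult_less_top)
    finally show "emeasure N1 (space N1) \<noteq> \<infinity>" by auto
  qed
  have f2: "finite_measure N2"
  proof (rule finite_measureI)
    have "emeasure N2 (space N2) = (\<integral>\<^sup>+x. ennreal (indicator {0<..} x * h x) \<partial>lborel)"
      unfolding N2_def using hm by (subst emeasure_density) (auto intro!: nn_integral_cong)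
    also have "\<dots> = ennreal (\<integral>x. indicator {0<..} x * h x \<partial>lborel)"
      using hi hnn by (intro nn_integral_eq_integral) auto
    finally show "emeasure N2 (space N2) \<noteq> \<infinity>" by auto
  qed
  have "N1 = N2"
  proof (rule cdf_unique')
    show "finite_borel_measure N1" "finite_borel_measure N2"
      using f1 f2 by (auto simp: finite_borel_measure_def finite_borel_measure_axioms_def N1_def N2_def sets)
    show "cdf N1 = cdf N2"
    proof
      fix b
      show "cdf N1 b = cdf N2 b"
        using e1[of b] e2[of b] L[of b] by (cases "0 < b") (simp_all add: cdf_def measure_def set_lebesgue_integral_def)
    qed
  qed
  have "pi * (LINT x:{0<..}|\<mu>. \<phi> x) = (\<integral>x. (pi * indicator {0<..} x) *\<^sub>R \<phi> x \<partial>\<mu>)"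
    by (simp add: set_lebesgue_integral_def scaleR_conv_of_real mult.assoc)
  also have "\<dots> = (\<integral>x. \<phi> x \<partial>N1)"
    unfolding N1_def using \<phi>
    by (subst integral_density) (auto simp: measurable_cong_sets[OF sets refl])
  also have "\<dots> = (\<integral>x. \<phi> x \<partial>N2)" using \<open>N1 = N2\<close> by simp
  also have "\<dots> = (\<integral>x. (indicator {0<..} x * h x) *\<^sub>R \<phi> x \<partial>lborel)"
    unfolding N2_def using \<phi> hm hnn by (subst integral_density) auto
  finally show ?thesis
    by (simp add: set_lebesgue_integral_def scaleR_conv_of_real mult.assoc h_def)
qed

section \<open>Poisson formula and Herglotz representation in the upper half plane\<close>

lemma decay_from_far:
  fixes f :: "complex \<Rightarrow> complex"
  assumes cont: "continuous_on S f" and S: "closed S"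
    and far: "\<And>z. z \<in> S \<Longrightarrow> R \<le> norm z \<Longrightarrow> norm (f z) \<le> B / (norm z)\<^sup>2"
  obtains C where "\<And>z. z \<in> S \<Longrightarrow> norm (f z) \<le> C / (1 + (norm z)\<^sup>2)"
proof -
  define r where "r = max 1 R"
  have "compact (f ` (S \<inter> cball 0 r))"
    by (intro compact_continuous_image continuous_on_subset[OF cont] closed_Int_compact S) auto
  then obtain M where M: "\<And>z. z \<in> S \<Longrightarrow> norm z \<le> r \<Longrightarrow> norm (f z) \<le> M"
    using compact_imp_bounded bounded_iff by (metis IntI imageI mem_cball_0)
  have "norm (f z) \<le> (\<bar>M\<bar> * (1 + r\<^sup>2) + 2 * \<bar>B\<bar>) / (1 + (norm z)\<^sup>2)" if z: "z \<in> S" for z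
  proof (cases "norm z \<le> r")
    case True
    then have "1 + (norm z)\<^sup>2 \<le> 1 + r\<^sup>2" by (intro add_left_mono power_mono) auto
    then have "\<bar>M\<bar> * (1 + (norm z)\<^sup>2) \<le> \<bar>M\<bar> * (1 + r\<^sup>2)" by (intro mult_left_mono) auto
    then have "\<bar>M\<bar> \<le> (\<bar>M\<bar> * (1 + r\<^sup>2) + 2 * \<bar>B\<bar>) / (1 + (norm z)\<^sup>2)"
      by (subst pos_le_divide_eq) (auto intro: add_pos_nonneg)
    then show ?thesis using M[OF z True] by linarith
  next
    case False
    then have n1: "1 \<le> norm z" "R \<le> norm z" by (auto simp: r_def)
    then have "1 \<le> (norm z)\<^sup>2" by simp
    then have "\<bar>B\<bar> / (norm z)\<^sup>2 \<le> 2 * \<bar>B\<bar> / (1 + (norm z)\<^sup>2)"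
      using mult_left_mono[of 1 "(norm z)\<^sup>2" "\<bar>B\<bar>"] by (simp add: divide_simps) (simp add: algebra_simps)
    also have "\<dots> \<le> (\<bar>M\<bar> * (1 + r\<^sup>2) + 2 * \<bar>B\<bar>) / (1 + (norm z)\<^sup>2)"
      by (intro divide_right_mono) auto
    finally have "\<bar>B\<bar> / (norm z)\<^sup>2 \<le> (\<bar>M\<bar> * (1 + r\<^sup>2) + 2 * \<bar>B\<bar>) / (1 + (norm z)\<^sup>2)" .
    moreover have "B / (norm z)\<^sup>2 \<le> \<bar>B\<bar> / (norm z)\<^sup>2" by (intro divide_right_mono) auto
    ultimately show ?thesis using far[OF z n1(2)] by linarith
  qed
  then show ?thesis by (rule that)
qed

lemma integral_upper_half_plane_0_far:
  fixes f :: "complex \<Rightarrow> complex"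
  assumes cont: "continuous_on {z. 0 \<le> Im z} f"
    and hol: "f holomorphic_on {z. 0 < Im z}"
    and far: "\<And>z. 0 \<le> Im z \<Longrightarrow> R \<le> norm z \<Longrightarrow> norm (f z) \<le> B / (norm z)\<^sup>2"
  shows "integrable lborel (\<lambda>x. f (of_real x))" "(LBINT x. f (of_real x)) = 0"
proof -
  have cl: "closed {z. 0 \<le> Im z}" using closed_halfspace_Im_ge[of 0] by simp
  obtain C where "\<And>z. z \<in> {z. 0 \<le> Im z} \<Longrightarrow> norm (f z) \<le> C / (1 + (norm z)\<^sup>2)"
    using decay_from_far[OF cont cl, of R B] far by auto
  then show "integrable lborel (\<lambda>x. f (of_real x))" "(LBINT x. f (of_real x)) = 0"
    using integral_upper_half_plane_0[OF cont hol, of C] by auto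
qed

lemma poisson_kernel_integral:
  assumes e: "0 < e"
  shows "integrable lborel (\<lambda>x. e / ((x - s)\<^sup>2 + e\<^sup>2))" "(LBINT x. e / ((x - s)\<^sup>2 + e\<^sup>2)) = pi"
proof -
  have d: "((\<lambda>x. arctan ((x - s) / e)) has_real_derivative e / ((x - s)\<^sup>2 + e\<^sup>2)) (at x)" for x
    using has_derivative_arctan_poisson[OF e, of s x] by (simp add: power2_commute)
  have c: "isCont (\<lambda>x. e / ((x - s)\<^sup>2 + e\<^sup>2)) x" for x
    using e by (intro continuous_intros) (simp add: add_nonneg_pos less_imp_neq[symmetric])
  have l1: "((\<lambda>x. arctan ((x - s) / e)) \<longlongrightarrow> pi / 2) at_top"
    by (rule filterlim_compose[OF tendsto_arctan_at_top]) (use e in real_asymp)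
  have l2: "((\<lambda>x. arctan ((x - s) / e)) \<longlongrightarrow> - (pi / 2)) at_bot"
    by (rule filterlim_compose[OF tendsto_arctan_at_bot]) (use e in real_asymp)
  have l1': "(((\<lambda>x. arctan ((x - s) / e)) \<circ> real_of_ereal) \<longlongrightarrow> pi / 2) (at_left \<infinity>)"
    using l1 unfolding ereal_tendsto_simps by simp
  have l2': "(((\<lambda>x. arctan ((x - s) / e)) \<circ> real_of_ereal) \<longlongrightarrow> - (pi / 2)) (at_right (-\<infinity>))"
    using l2 unfolding ereal_tendsto_simps by simp
  note F = interval_integral_FTC_nonneg[of "-\<infinity>" "\<infinity>" "\<lambda>x. arctan ((x - s) / e)" "\<lambda>x. e / ((x - s)\<^sup>2 + e\<^sup>2)", OF _ d c _ l2' l1']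
  show "integrable lborel (\<lambda>x. e / ((x - s)\<^sup>2 + e\<^sup>2))"
    using F(1) e by (simp add: einterval_def set_integrable_def)
  show "(LBINT x. e / ((x - s)\<^sup>2 + e\<^sup>2)) = pi"
    using F(2) e by (simp add: einterval_def interval_lebesgue_integral_def set_lebesgue_integral_def)
qed

lemma upper_half_plane_shift:
  assumes "0 \<le> Im \<zeta>" "0 < e"
  shows "(norm \<zeta>)\<^sup>2 + e\<^sup>2 \<le> (norm (\<zeta> + \<i> * of_real e))\<^sup>2" "norm \<zeta> \<le> norm (\<zeta> + \<i> * of_real e)"
proof -
  have "(Im \<zeta>)\<^sup>2 + e\<^sup>2 \<le> (Im \<zeta> + e)\<^sup>2" using assms by (simp add: power2_sum)
  then show 1: "(norm \<zeta>)\<^sup>2 + e\<^sup>2 \<le> (norm (\<zeta> + \<i> * of_real e))\<^sup>2" by (simp add: cmod_power2)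
  have "(norm \<zeta>)\<^sup>2 \<le> (norm (\<zeta> + \<i> * of_real e))\<^sup>2" using 1 zero_le_power2[of e] by linarith
  then show "norm \<zeta> \<le> norm (\<zeta> + \<i> * of_real e)" by (rule power2_le_imp_le) simp
qed

text \<open>Cauchy's formula for the upper half plane, with \<open>\<kappa>(\<zeta>) = (z - cnj z) / (\<zeta> - cnj z)\<close> subtracted
  in order to get quadratic decay, and the vanishing of the integral of \<open>G(x) / (x - cnj z)\<close>,
  combine to the Poisson formula.\<close>

lemma poisson_half_plane:
  fixes G :: "complex \<Rightarrow> complex"
  assumes cont: "continuous_on {z. 0 \<le> Im z} G" and hol: "G holomorphic_on {z. 0 < Im z}"
    and far: "\<And>z. 0 \<le> Im z \<Longrightarrow> R \<le> norm z \<Longrightarrow> norm (G z) \<le> B / norm z"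
    and z: "0 < Im z"
    and int: "integrable lborel (\<lambda>x. Im (G (of_real x)))"
  shows "(LBINT x. of_real (Im (G (of_real x))) / (of_real x - z)) = pi * G z"
proof -
  have cz: "Im (cnj z) < 0" using z by simp
  have ne: "\<zeta> \<noteq> cnj z" if "0 \<le> Im \<zeta>" for \<zeta> using cz that by auto
  define f3 where "f3 \<zeta> = G \<zeta> / (\<zeta> - cnj z)" for \<zeta>
  \<comment> \<open>Far out, \<zeta> has distance at least |\<zeta>|/2 from z and from its
    conjugate, which turns the 1/|\<zeta>| bound on \<open>G\<close> into quadratic decay of the
    quotients.\<close>
  have R0: "norm z \<le> norm \<zeta> / 2 \<and> 0 < norm \<zeta> \<and> norm \<zeta> / 2 \<le> norm (\<zeta> - cnj z) \<and> norm \<zeta> / 2 \<le> norm (\<zeta> - z)"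
    if "2 * norm z + 1 \<le> norm \<zeta>" for \<zeta>
    using norm_triangle_ineq2[of \<zeta> "cnj z"] norm_triangle_ineq2[of \<zeta> z] that norm_ge_zero[of z] by (auto simp del: norm_ge_zero)
  define R1 where "R1 = max R (2 * norm z + 1)"
  have b3: "norm (f3 \<zeta>) \<le> 2 * \<bar>B\<bar> / (norm \<zeta>)\<^sup>2" if "0 \<le> Im \<zeta>" "R1 \<le> norm \<zeta>" for \<zeta>
  proof -
    have r: "R \<le> norm \<zeta>" "0 < norm \<zeta>" "norm \<zeta> / 2 \<le> norm (\<zeta> - cnj z)" using R0[of \<zeta>] that by (auto simp: R1_def)
    have "norm (G \<zeta>) \<le> \<bar>B\<bar> / norm \<zeta>" using far[OF that(1) r(1)] r(2) by (smt (verit) divide_right_mono)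
    then have "norm (f3 \<zeta>) \<le> (\<bar>B\<bar> / norm \<zeta>) / (norm \<zeta> / 2)"
      unfolding f3_def norm_divide using r by (intro frac_le) auto
    then show ?thesis by (simp add: power2_eq_square mult.commute)
  qed
  have c3: "continuous_on {z. 0 \<le> Im z} f3" "f3 holomorphic_on {z. 0 < Im z}"
    unfolding f3_def using ne by (auto intro!: continuous_intros cont holomorphic_intros hol)
  note I3 = integral_upper_half_plane_0_far[OF c3 b3]
  \<comment> \<open>The numerator vanishes at z because \<kappa>(z) = 1, so the singularity is
    removable and the right value there is the derivative.\<close>
  define f2 where "f2 \<zeta> = (if \<zeta> = z then deriv (\<lambda>\<zeta>. G \<zeta> - G z * ((z - cnj z) / (\<zeta> - cnj z))) z
      else (G \<zeta> - G z * ((z - cnj z) / (\<zeta> - cnj z))) / (\<zeta> - z))" for \<zeta>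
  have zz: "z - cnj z \<noteq> 0" using ne[of z] z by auto
  have op: "open {z. 0 < Im z}" by (simp add: open_halfspace_Im_gt)
  have h2: "f2 holomorphic_on {z. 0 < Im z}"
  proof (rule pole_theorem_open_0)
    show "(\<lambda>\<zeta>. G \<zeta> - G z * ((z - cnj z) / (\<zeta> - cnj z))) holomorphic_on {z. 0 < Im z}"
      using ne by (auto intro!: holomorphic_intros hol)
  qed (use op z zz in \<open>auto simp: f2_def\<close>)
  have k2: "continuous_on {z. 0 \<le> Im z} f2"
    unfolding continuous_on_eq_continuous_within
  proof
    fix \<zeta> assume \<zeta>: "\<zeta> \<in> {z. 0 \<le> Im z}"
    show "continuous (at \<zeta> within {z. 0 \<le> Im z}) f2"
    proof (cases "\<zeta> = z")
      case True
      have "f2 field_differentiable at z" using h2 op z by (simp add: holomorphic_on_imp_differentiable_at)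
      then show ?thesis unfolding True
        by (rule continuous_at_imp_continuous_within[OF field_differentiable_imp_continuous_at])
    next
      case False
      have "continuous_on ({z. 0 \<le> Im z} - {z}) (\<lambda>\<zeta>. (G \<zeta> - G z * ((z - cnj z) / (\<zeta> - cnj z))) / (\<zeta> - z))"
        using ne by (auto intro!: continuous_intros continuous_on_subset[OF cont])
      then have "continuous_on ({z. 0 \<le> Im z} - {z}) f2"
        by (rule continuous_on_eq) (auto simp: f2_def)
      then have "continuous (at \<zeta> within ({z. 0 \<le> Im z} - {z})) f2"
        using \<zeta> False by (auto simp: continuous_on_eq_continuous_within)
      moreover have "at \<zeta> within ({z. 0 \<le> Im z} - {z}) = at \<zeta> within {z. 0 \<le> Im z}"
        by (rule at_within_nhd[of _ "- {z}"]) (use False in auto)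
      ultimately show ?thesis by simp
    qed
  qed
  have b2: "norm (f2 \<zeta>) \<le> 2 * (\<bar>B\<bar> + 2 * norm (G z * (z - cnj z))) / (norm \<zeta>)\<^sup>2"
    if "0 \<le> Im \<zeta>" "R1 \<le> norm \<zeta>" for \<zeta>
  proof -
    have r: "R \<le> norm \<zeta>" "0 < norm \<zeta>" "norm \<zeta> / 2 \<le> norm (\<zeta> - cnj z)" "norm \<zeta> / 2 \<le> norm (\<zeta> - z)" "norm z \<le> norm \<zeta> / 2"
      using R0[of \<zeta>] that by (auto simp: R1_def)
    have nz: "\<zeta> \<noteq> z" using r by auto
    have "norm (G \<zeta>) \<le> \<bar>B\<bar> / norm \<zeta>" using far[OF that(1) r(1)] r(2) by (smt (verit) divide_right_mono)
    moreover have "norm (G z * ((z - cnj z) / (\<zeta> - cnj z))) \<le> norm (G z * (z - cnj z)) / (norm \<zeta> / 2)"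
      unfolding times_divide_eq_right norm_divide using r by (intro divide_left_mono mult_pos_pos) auto
    ultimately have "norm (G \<zeta> - G z * ((z - cnj z) / (\<zeta> - cnj z))) \<le> \<bar>B\<bar> / norm \<zeta> + norm (G z * (z - cnj z)) / (norm \<zeta> / 2)"
      by (intro order_trans[OF norm_triangle_ineq4] add_mono)
    also have "\<dots> = (\<bar>B\<bar> + 2 * norm (G z * (z - cnj z))) / norm \<zeta>" by (simp add: add_divide_distrib)
    finally have "norm (f2 \<zeta>) \<le> ((\<bar>B\<bar> + 2 * norm (G z * (z - cnj z))) / norm \<zeta>) / (norm \<zeta> / 2)"
      using nz r unfolding f2_def by (simp only: if_False norm_divide) (intro frac_le, auto)
    then show ?thesis by (simp add: power2_eq_square mult.commute)
  qed
  note I2 = integral_upper_half_plane_0_far[OF k2 h2 b2]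
  have xz: "of_real x - z \<noteq> 0" "of_real x - cnj z \<noteq> 0" for x using z ne[of "of_real x"] by auto
  \<comment> \<open>On the real line the subtracted term becomes \<open>G z\<close> times 2i times
    the Poisson kernel at z, whose integral is \<pi>.\<close>
  have ker: "(z - cnj z) / ((of_real x - cnj z) * (of_real x - z)) = 2 * \<i> * of_real (Im z / ((x - Re z)\<^sup>2 + (Im z)\<^sup>2))" for x
  proof -
    have "(of_real x - cnj z) * (of_real x - z) = of_real ((x - Re z)\<^sup>2 + (Im z)\<^sup>2)"
      by (simp add: complex_eq_iff power2_eq_square algebra_simps)
    moreover have "z - cnj z = 2 * \<i> * of_real (Im z)" by (simp add: complex_eq_iff)
    ultimately show ?thesis by simp
  qed
  have f2x: "f2 (of_real x) = G (of_real x) / (of_real x - z) - G z * (2 * \<i> * of_real (Im z / ((x - Re z)\<^sup>2 + (Im z)\<^sup>2)))" for x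
  proof -
    have "f2 (of_real x) = G (of_real x) / (of_real x - z) - G z * ((z - cnj z) / ((of_real x - cnj z) * (of_real x - z)))"
    proof -
      have "f2 (of_real x) = (G (of_real x) - G z * ((z - cnj z) / (of_real x - cnj z))) / (of_real x - z)"
        using xz[of x] by (auto simp: f2_def)
      then show ?thesis
        by (simp only: diff_divide_distrib[of "G (of_real x)"] times_divide_eq_right divide_divide_eq_left)
    qed
    then show ?thesis unfolding ker .
  qed
  have P: "integrable lborel (\<lambda>x. G z * (2 * \<i> * of_real (Im z / ((x - Re z)\<^sup>2 + (Im z)\<^sup>2))))"
    "(LBINT x. G z * (2 * \<i> * of_real (Im z / ((x - Re z)\<^sup>2 + (Im z)\<^sup>2)))) = G z * (2 * \<i> * pi)"
    using poisson_kernel_integral[OF z, of "Re z"] by (auto simp del: of_real_divide)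
  have J: "integrable lborel (\<lambda>x. G (of_real x) / (of_real x - z))"
    "(LBINT x. G (of_real x) / (of_real x - z)) = G z * (2 * \<i> * pi)"
  proof -
    have i: "integrable lborel (\<lambda>x. f2 (of_real x) + G z * (2 * \<i> * of_real (Im z / ((x - Re z)\<^sup>2 + (Im z)\<^sup>2))))"
      using I2(1) P(1) by (rule Bochner_Integration.integrable_add)
    then show "integrable lborel (\<lambda>x. G (of_real x) / (of_real x - z))" by (simp add: f2x)
    have "(LBINT x. f2 (of_real x) + G z * (2 * \<i> * of_real (Im z / ((x - Re z)\<^sup>2 + (Im z)\<^sup>2)))) = 0 + G z * (2 * \<i> * pi)"
      by (simp only: Bochner_Integration.integral_add[OF I2(1) P(1)] I2(2) P(2))
    then show "(LBINT x. G (of_real x) / (of_real x - z)) = G z * (2 * \<i> * pi)" by (simp add: f2x)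
  qed
  \<comment> \<open>Conjugating the vanishing integral of G(x)/(x - cnj z) shows that the conjugate
    of G contributes nothing to the integral of 2i Im G = G - cnj G against 1/(x - z).\<close>
  have cnj3: "cnj (f3 (of_real x)) = cnj (G (of_real x)) / (of_real x - z)" for x by (simp add: f3_def)
  have J': "integrable lborel (\<lambda>x. cnj (G (of_real x)) / (of_real x - z))"
    "(LBINT x. cnj (G (of_real x)) / (of_real x - z)) = 0"
    using integrable_cnj[OF I3(1)] I3(2) integral_bounded_linear[OF bounded_linear_cnj I3(1)]
    unfolding cnj3 by auto
  have "2 * \<i> * (LBINT x. of_real (Im (G (of_real x))) / (of_real x - z))
     = (LBINT x. G (of_real x) / (of_real x - z) - cnj (G (of_real x)) / (of_real x - z))"
    unfolding integral_mult_right_zero[symmetric]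
    by (intro Bochner_Integration.integral_cong refl)
       (simp add: diff_divide_distrib[symmetric] complex_diff_cnj)
  also have "\<dots> = G z * (2 * \<i> * pi)" using J J' by simp
  finally show ?thesis by simp
qed

text \<open>A shift by ie makes F continuous on the closed half plane, where Poisson's formula
  represents it by the density Im F(x + ie)/\<pi>. The normalisation F ~ -1/z, uniform on Im z \<ge>
  e, gives these densities mass 1 and makes them tight as e decreases to 0; a weak limit point is
  the measure sought.\<close>

theorem herglotz_stieltjes:
  fixes F :: "complex \<Rightarrow> complex"
  assumes hol: "F holomorphic_on {z. 0 < Im z}"
    and nn: "\<And>z. 0 < Im z \<Longrightarrow> 0 \<le> Im (F z)"
    and asymp: "\<And>e. 0 < e \<Longrightarrow> \<exists>C. \<forall>z. e \<le> Im z \<longrightarrow> norm (F z + 1 / z) \<le> C / (norm z)\<^sup>2"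
  shows "\<exists>\<mu>. real_distribution \<mu> \<and> (\<forall>z. 0 < Im z \<longrightarrow> (\<integral>x. 1 / (complex_of_real x - z) \<partial>\<mu>) = F z)"
proof -
  define p where "p e x = Im (F (of_real x + \<i> * of_real e)) / pi" for e x :: real
  have shol: "(\<lambda>\<zeta>. F (\<zeta> + \<i> * of_real e)) holomorphic_on {z. - e < Im z}" for e
    by (rule holomorphic_on_compose_gen[OF _ hol, unfolded o_def]) (auto intro!: holomorphic_intros)
  have p_nn: "0 \<le> p e x" if "0 < e" for e x using nn that by (simp add: p_def)
  have pint: "integrable lborel (p e)" "(LBINT x. p e x) = 1" if e: "0 < e" for e
  proof -
    obtain C where C: "\<And>z. e \<le> Im z \<Longrightarrow> norm (F z + 1 / z) \<le> C / (norm z)\<^sup>2" using asymp[OF e] by blast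
    \<comment> \<open>Adding 1/(\<zeta> + ie) cancels the leading term, so the integral of
      \<open>f\<close> over the real line vanishes; its imaginary part compares the mass of
      \<open>p e\<close> with that of a Poisson kernel.\<close>
    define f where "f \<zeta> = F (\<zeta> + \<i> * of_real e) + 1 / (\<zeta> + \<i> * of_real e)" for \<zeta>
    have nz: "\<zeta> + \<i> * of_real e \<noteq> 0" if "- e < Im \<zeta>" for \<zeta>
      using that by (auto simp: complex_eq_iff)
    have fh: "f holomorphic_on {z. - e < Im z}"
      unfolding f_def using nz by (intro holomorphic_intros shol) auto
    have far: "norm (f \<zeta>) \<le> \<bar>C\<bar> / (norm \<zeta>)\<^sup>2" if "0 \<le> Im \<zeta>" "1 \<le> norm \<zeta>" for \<zeta>
    proof -
      have "norm (f \<zeta>) \<le> C / (norm (\<zeta> + \<i> * of_real e))\<^sup>2" unfolding f_def using that by (intro C) auto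
      also have "\<dots> \<le> \<bar>C\<bar> / (norm (\<zeta> + \<i> * of_real e))\<^sup>2" by (intro divide_right_mono) auto
      also have "\<dots> \<le> \<bar>C\<bar> / (norm \<zeta>)\<^sup>2"
        using that upper_half_plane_shift(2)[OF that(1) e]
        by (intro divide_left_mono mult_pos_pos) auto
      finally show ?thesis .
    qed
    have fc: "continuous_on {z. 0 \<le> Im z} f"
      by (rule continuous_on_subset[OF holomorphic_on_imp_continuous_on[OF fh]]) (use e in auto)
    have fh': "f holomorphic_on {z. 0 < Im z}"
      by (rule holomorphic_on_subset[OF fh]) (use e in auto)
    note I = integral_upper_half_plane_0_far[OF fc fh' far]
    have fx: "Im (f (of_real x)) = pi * p e x - e / ((x - 0)\<^sup>2 + e\<^sup>2)" for x
      by (simp add: f_def p_def Im_divide power2_eq_square)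
    have i1: "integrable lborel (\<lambda>x. Im (f (of_real x)))" "(LBINT x. Im (f (of_real x))) = 0"
      using integrable_bounded_linear[OF bounded_linear_Im I(1)] integral_bounded_linear[OF bounded_linear_Im I(1)] I(2) by auto
    note P = poisson_kernel_integral[OF e, of 0]
    have "integrable lborel (\<lambda>x. (Im (f (of_real x)) + e / ((x - 0)\<^sup>2 + e\<^sup>2)) / pi)"
      by (intro integrable_divide Bochner_Integration.integrable_add i1(1) P(1))
    then show "integrable lborel (p e)" by (simp add: fx)
    have "(LBINT x. (Im (f (of_real x)) + e / ((x - 0)\<^sup>2 + e\<^sup>2)) / pi) = (0 + pi) / pi"
      by (simp only: integral_divide_zero Bochner_Integration.integral_add[OF i1(1) P(1)] i1(2) P(2))
    then show "(LBINT x. p e x) = 1" by (simp add: fx)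
  qed
  have pois: "(LBINT x. of_real (p e x) / (of_real x - z)) = F (z + \<i> * of_real e)" if e: "0 < e" and z: "0 < Im z" for e z
  proof -
    obtain C where C: "\<And>z. e \<le> Im z \<Longrightarrow> norm (F z + 1 / z) \<le> C / (norm z)\<^sup>2" using asymp[OF e] by blast
    let ?G = "\<lambda>\<zeta>. F (\<zeta> + \<i> * of_real e)"
    have far: "norm (?G \<zeta>) \<le> (\<bar>C\<bar> + 1) / norm \<zeta>" if "0 \<le> Im \<zeta>" "1 \<le> norm \<zeta>" for \<zeta>
    proof -
      let ?w = "\<zeta> + \<i> * of_real e"
      have w: "norm \<zeta> \<le> norm ?w" "1 \<le> norm ?w"
        using upper_half_plane_shift(2)[OF that(1) e] that by linarith+
      have "norm (?G \<zeta>) \<le> norm (?G \<zeta> + 1 / ?w) + norm (1 / ?w)"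
        using norm_triangle_ineq4[of "?G \<zeta> + 1 / ?w" "1 / ?w"] by simp
      also have "norm (?G \<zeta> + 1 / ?w) \<le> C / (norm ?w)\<^sup>2" using that by (intro C) auto
      also have "\<dots> \<le> \<bar>C\<bar> / (norm ?w)\<^sup>2" by (intro divide_right_mono) auto
      also have "\<dots> \<le> \<bar>C\<bar> / norm \<zeta>"
      proof (intro divide_left_mono mult_pos_pos)
        have "norm ?w * 1 \<le> norm ?w * norm ?w" using w by (intro mult_left_mono) auto
        then show "norm \<zeta> \<le> (norm ?w)\<^sup>2" using w by (simp add: power2_eq_square)
      qed (use w that in auto)
      also have "norm (1 / ?w) \<le> 1 / norm \<zeta>" using w that by (auto simp: norm_divide intro!: divide_left_mono mult_pos_pos)
      finally show ?thesis by (simp add: add_divide_distrib)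
    qed
    have c: "continuous_on {z. 0 \<le> Im z} ?G"
      by (rule continuous_on_subset[OF holomorphic_on_imp_continuous_on[OF shol]]) (use e in auto)
    have h: "?G holomorphic_on {z. 0 < Im z}"
      by (rule holomorphic_on_subset[OF shol]) (use e in auto)
    have "integrable lborel (\<lambda>x. pi * p e x)" using pint(1)[OF e] by simp
    then have i: "integrable lborel (\<lambda>x. Im (?G (of_real x)))" by (simp add: p_def)
    have "(LBINT x. of_real (p e x) / (of_real x - z)) = (LBINT x. of_real (Im (?G (of_real x))) / (of_real x - z) / pi)"
      by (simp add: p_def mult.commute)
    also have "\<dots> = pi * ?G z / pi"
      by (simp only: integral_divide_zero poisson_half_plane[OF c h far z i])
    finally show ?thesis by simp
  qed
  define N where "N e = density lborel (\<lambda>x. ennreal (p e x))" for e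
  have pm: "p e \<in> borel_measurable borel" if "0 < e" for e using pint(1)[OF that] by auto
  have rdN: "real_distribution (N e)" if e: "0 < e" for e
  proof -
    have "emeasure (N e) (space (N e)) = (\<integral>\<^sup>+x. ennreal (p e x) \<partial>lborel)"
      unfolding N_def using pm[OF e] by (subst emeasure_density) auto
    also have "\<dots> = ennreal (LBINT x. p e x)"
      by (rule nn_integral_eq_integral) (use pint(1)[OF e] p_nn[OF e] in auto)
    finally have "prob_space (N e)" by (intro prob_spaceI) (simp add: pint(2)[OF e])
    then show ?thesis by (simp add: real_distribution_def real_distribution_axioms_def N_def)
  qed
  have Nint: "(\<integral>x. 1 / (complex_of_real x - z) \<partial>N e) = F (z + \<i> * of_real e)" if e: "0 < e" and z: "0 < Im z" for e z
  proof -
    have "(\<integral>x. 1 / (complex_of_real x - z) \<partial>N e) = (\<integral>x. p e x *\<^sub>R (1 / (complex_of_real x - z)) \<partial>lborel)"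
      unfolding N_def by (rule integral_density) (use pm[OF e] p_nn[OF e] in auto)
    also have "\<dots> = F (z + \<i> * of_real e)"
      using pois[OF e z] by (simp add: scaleR_conv_of_real)
    finally show ?thesis .
  qed
  define M where "M n = N (1 / real (Suc n))" for n
  have rd: "real_distribution (M n)" for n unfolding M_def by (rule rdN) simp
  have Mint: "(\<integral>x. 1 / (complex_of_real x - z) \<partial>M n) = F (z + \<i> * of_real (1 / real (Suc n)))" if z: "0 < Im z" for n z
    unfolding M_def by (rule Nint[OF _ z]) simp
  have "tight M"
    unfolding tight_def
  proof (intro conjI allI impI rd)
    fix \<delta> :: real assume \<delta>: "0 < \<delta>"
    obtain C where C: "\<And>z. 1 \<le> Im z \<Longrightarrow> norm (F z + 1 / z) \<le> C / (norm z)\<^sup>2" using asymp[of 1] by auto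
    have "\<forall>\<^sub>F y in at_top. 2 * (y / (y + 1) - \<bar>C\<bar> / y) - 1 > 1 - \<delta>"
    proof -
      have "((\<lambda>y. 2 * (y / (y + 1) - \<bar>C\<bar> / y) - 1) \<longlongrightarrow> 1) at_top" by real_asymp
      then show ?thesis by (rule order_tendstoD(1)) (use \<delta> in simp)
    qed
    then have "\<forall>\<^sub>F y in at_top. 2 * (y / (y + 1) - \<bar>C\<bar> / y) - 1 > 1 - \<delta> \<and> 1 \<le> (y::real)"
      using eventually_ge_at_top[of 1] by (rule eventually_conj)
    then obtain y where y: "2 * (y / (y + 1) - \<bar>C\<bar> / y) - 1 > 1 - \<delta>" "1 \<le> y"
      using eventually_happens'[OF trivial_limit_at_top_linorder] by blast
    \<comment> \<open>A value of y Im F(i(y + e)) near 1 forces mass into (-y, y]: with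
      \<open>k\<close> the Poisson kernel at height y, the function 2 y k - 1 is at most 1
      everywhere and nonpositive for |x| \<ge> y, so its integral bounds that mass from below,
      uniformly in e.\<close>
    have Ny: "measure (N e) {-y<..y} > 1 - \<delta>" if e1: "0 < e" "e \<le> 1" for e
    proof -
      interpret real_distribution "N e" by (rule rdN[OF e1(1)])
      let ?w = "\<i> * of_real (y + e)"
      have "Im (1 / (\<i> * of_real r)) = - (1 / r)" for r :: real
        by (simp add: Im_divide power2_eq_square)
      from this[of "y + e"] have "Im (F ?w) = Im (F ?w + 1 / ?w) + 1 / (y + e)" by (simp only: plus_complex.sel)
      moreover have "\<bar>Im (F ?w + 1 / ?w)\<bar> \<le> \<bar>C\<bar> / y\<^sup>2"
      proof -
        have "\<bar>Im (F ?w + 1 / ?w)\<bar> \<le> norm (F ?w + 1 / ?w)" by (rule abs_Im_le_cmod)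
        also have "\<dots> \<le> C / (norm ?w)\<^sup>2" using y e1 by (intro C) auto
        also have "\<dots> \<le> \<bar>C\<bar> / (norm ?w)\<^sup>2" by (intro divide_right_mono) auto
        also have "norm ?w = y + e" using y e1 by (simp only: norm_mult norm_of_real norm_ii) simp
        also have "\<bar>C\<bar> / (y + e)\<^sup>2 \<le> \<bar>C\<bar> / y\<^sup>2" using y e1 by (intro divide_left_mono power_mono mult_pos_pos) auto
        finally show ?thesis .
      qed
      ultimately have "1 / (y + e) - \<bar>C\<bar> / y\<^sup>2 \<le> Im (F ?w)" by linarith
      then have "y * (1 / (y + e) - \<bar>C\<bar> / y\<^sup>2) \<le> y * Im (F ?w)" using y by (intro mult_left_mono) auto
      moreover have "y * (1 / (y + e) - \<bar>C\<bar> / y\<^sup>2) = y / (y + e) - \<bar>C\<bar> / y"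
        using y by (simp add: right_diff_distrib power2_eq_square)
      moreover have "y / (y + 1) \<le> y / (y + e)" using y e1 by (intro divide_left_mono mult_pos_pos) auto
      ultimately have 1: "y / (y + 1) - \<bar>C\<bar> / y \<le> y * Im (F ?w)" by linarith
      have Fw: "Im (F ?w) = (\<integral>x. y / ((x - 0)\<^sup>2 + y\<^sup>2) \<partial>N e)"
      proof -
        have "F ?w = (\<integral>x. 1 / (complex_of_real x - Complex 0 y) \<partial>N e)"
          using y by (subst Nint[OF e1(1)]) (auto simp: Complex_eq algebra_simps)
        then show ?thesis using y Im_stieltjes[OF finite_measure_axioms _, of y 0] by simp
      qed
      define k where "k x = y / (x\<^sup>2 + y\<^sup>2)" for x
      have pos: "0 < x\<^sup>2 + y\<^sup>2" for x using y by (simp add: add_nonneg_pos)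
      have yk: "y * k x \<le> 1" for x
        using pos[of x] by (simp add: k_def divide_le_eq_1 flip: power2_eq_square)
      have k0: "0 \<le> k x" for x using pos[of x] y by (simp add: k_def)
      have ik: "integrable (N e) k"
      proof (rule integrable_const_bound[where B = "1 / y"])
        show "AE x in N e. norm (k x) \<le> 1 / y" using yk k0 y by (simp add: pos_le_divide_eq mult.commute)
        show "k \<in> borel_measurable (N e)" unfolding k_def[abs_def] by simp
      qed
      have ik2: "integrable (N e) (\<lambda>x. 2 * (y * k x))" using ik by simp
      have "(\<integral>x. 2 * (y * k x) - 1 \<partial>N e) = 2 * (y * (\<integral>x. k x \<partial>N e)) - 1"
        using prob_space by (subst Bochner_Integration.integral_diff[OF ik2]) auto
      moreover have "Im (F ?w) = (\<integral>x. k x \<partial>N e)" using Fw by (simp only: k_def diff_zero)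
      ultimately have 2: "2 * (y * Im (F ?w)) - 1 = (\<integral>x. 2 * (y * k x) - 1 \<partial>N e)" by simp
      also have "\<dots> \<le> (\<integral>x. indicator {-y<..y} x \<partial>N e)"
      proof (rule integral_mono)
        show "integrable (N e) (\<lambda>x. 2 * (y * k x) - 1)" using ik2 by simp
        show "integrable (N e) (indicat_real {-y<..y})" by (rule integrable_const_bound[where B = 1]) auto
        fix x :: real
        show "2 * (y * k x) - 1 \<le> indicat_real {-y<..y} x"
        proof (cases "x \<in> {-y<..y}")
          case True
          then show ?thesis using yk[of x] by simp
        next
          case False
          then have "\<bar>y\<bar> \<le> \<bar>x\<bar>" using y by auto
          then have "y\<^sup>2 \<le> x\<^sup>2" by (simp only: abs_le_square_iff)
          then have "2 * (y * y) / (x\<^sup>2 + y\<^sup>2) \<le> 1"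
            using pos[of x] by (simp add: divide_le_eq_1 power2_eq_square)
          then show ?thesis using False by (simp add: k_def)
        qed
      qed
      also have "\<dots> = measure (N e) {-y<..y}" by simp
      finally have "2 * (y * Im (F ?w)) - 1 \<le> measure (N e) {-y<..y}" .
      moreover have "2 * (y / (y + 1) - \<bar>C\<bar> / y) - 1 \<le> 2 * (y * Im (F ?w)) - 1"
        by (intro diff_right_mono mult_left_mono 1) simp
      ultimately show ?thesis using y(1) by (meson less_le_trans)
    qed
    have "measure (M n) {-y<..y} > 1 - \<delta>" for n unfolding M_def by (rule Ny) auto
    then show "\<exists>a b. a < b \<and> (\<forall>n. measure (M n) {a<..b} > 1 - \<delta>)"
      using y(2) by (intro exI[of _ "-y"] exI[of _ y]) auto
  qed
  then obtain r \<mu> where r: "strict_mono r" and \<mu>: "real_distribution \<mu>" and w: "weak_conv_m (M \<circ> id \<circ> r) \<mu>"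
    using tight_imp_convergent_subsubsequence[of M id, OF _ strict_mono_id] by blast
  have "(\<integral>x. 1 / (complex_of_real x - z) \<partial>\<mu>) = F z" if z: "0 < Im z" for z
  proof -
    have "(\<lambda>n. \<integral>x. 1 / (complex_of_real x - z) \<partial>((M \<circ> id \<circ> r) n)) \<longlonglongrightarrow> (\<integral>x. 1 / (complex_of_real x - z) \<partial>\<mu>)"
    proof (rule weak_conv_imp_integral_bdd_continuous_conv[OF _ \<mu> w])
      show "isCont (\<lambda>x. 1 / (complex_of_real x - z)) x" for x
        using z by (intro continuous_intros) auto
      show "norm (1 / (complex_of_real x - z)) \<le> 1 / \<bar>Im z\<bar>" for x
        using z by (intro norm_stieltjes_kernel_le) auto
    qed (simp add: rd)
    then have "(\<lambda>n. F (z + \<i> * of_real (1 / real (Suc (r n))))) \<longlonglongrightarrow> (\<integral>x. 1 / (complex_of_real x - z) \<partial>\<mu>)"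
      by (simp only: o_apply id_apply Mint[OF z])
    moreover have "(\<lambda>n. F (z + \<i> * of_real (1 / real (Suc (r n))))) \<longlonglongrightarrow> F z"
    proof -
      have "(\<lambda>n. 1 / real (Suc (r n))) \<longlonglongrightarrow> 0"
        using LIMSEQ_subseq_LIMSEQ[OF LIMSEQ_Suc[OF lim_1_over_n] r] by (simp add: o_def)
      from tendsto_add[OF tendsto_const tendsto_mult[OF tendsto_const tendsto_of_real[OF this]], of z \<i>]
      have "(\<lambda>n. z + \<i> * of_real (1 / real (Suc (r n)))) \<longlonglongrightarrow> z" by simp
      moreover have "isCont F z"
        using hol z continuous_on_interior[OF holomorphic_on_imp_continuous_on[OF hol]]
        by (simp add: interior_open open_halfspace_Im_gt)
      ultimately show ?thesis by (rule isCont_tendsto_compose[rotated])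
    qed
    ultimately show ?thesis by (rule LIMSEQ_unique)
  qed
  then show ?thesis using \<mu> by blast
qed

section \<open>Watson's lemma on a rotated ray\<close>

lemma power_le_fact_mult_exp:
  assumes "0 \<le> (x::real)"
  shows "x ^ k \<le> fact k * exp x"
proof -
  have "(\<Sum>n\<in>{k}. x ^ n /\<^sub>R fact n) \<le> (\<Sum>n. x ^ n /\<^sub>R fact n)"
    by (rule sum_le_suminf) (use assms summable_exp_generic[of x] in auto)
  then have "x ^ k / fact k \<le> exp x" by (simp add: exp_def divide_inverse mult.commute)
  then show ?thesis by (simp add: divide_le_eq mult.commute)
qed

text \<open>Each s^j exp(-as) is at most j!/a^j; the cases j = k and j = k + 2 together yield the
  denominator 1 + s^2.\<close>

lemma power_mult_exp_decay:
  fixes a :: real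
  assumes "0 < a"
  obtains C where "\<And>s. 0 \<le> s \<Longrightarrow> s ^ k * exp (- a * s) \<le> C / (1 + s\<^sup>2)"
proof -
  have b: "s ^ j * exp (- a * s) \<le> fact j / a ^ j" if "0 \<le> s" for s j
  proof -
    have "a ^ j * s ^ j \<le> fact j * exp (a * s)"
      using power_le_fact_mult_exp[of "a * s" j] that assms by (simp add: power_mult_distrib)
    then have "a ^ j * s ^ j * exp (- a * s) \<le> fact j * exp (a * s) * exp (- a * s)"
      by (rule mult_right_mono) simp
    also have "\<dots> = fact j" by (simp add: mult.assoc flip: exp_add)
    finally show ?thesis using assms by (simp add: pos_le_divide_eq mult_ac)
  qed
  have "s ^ k * exp (- a * s) \<le> (fact k / a ^ k + fact (k + 2) / a ^ (k + 2)) / (1 + s\<^sup>2)" if "0 \<le> s" for s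
  proof -
    have "s ^ k * exp (- a * s) * (1 + s\<^sup>2) = s ^ k * exp (- a * s) + s ^ (k + 2) * exp (- a * s)"
      by (simp add: algebra_simps power_add power2_eq_square)
    also have "\<dots> \<le> fact k / a ^ k + fact (k + 2) / a ^ (k + 2)"
      by (intro add_mono b that)
    finally show ?thesis by (subst pos_le_divide_eq) (auto intro: add_pos_nonneg)
  qed
  then show ?thesis by (rule that)
qed

lemma norm_power_exp:
  fixes a :: complex
  assumes "0 \<le> s"
  shows "norm (complex_of_real s ^ k * exp (- a * of_real s)) = s ^ k * exp (- Re a * s)"
  using assms by (simp add: norm_mult norm_power norm_exp_eq_Re)

text \<open>Integrating the derivative of s^(k+1) exp(-as) gives the recursion I(k+1) = (k+1)
  I(k)/a, as the boundary terms vanish at both ends. The rate is complex because the rotated Fourier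
  kernel has a = it(1 - i\<tau>).\<close>

lemma power_exp_integral:
  fixes a :: complex
  assumes a: "0 < Re a"
  shows "set_integrable lborel {0<..} (\<lambda>s. complex_of_real s ^ k * exp (- a * of_real s))"
    and "(LBINT s:{0<..}. complex_of_real s ^ k * exp (- a * of_real s)) = fact k / a ^ (k + 1)"
proof -
  let ?f = "\<lambda>k s. complex_of_real s ^ k * exp (- a * of_real s)"
  have c: "continuous_on S (?f k)" for k S by (intro continuous_intros)
  have C: "\<exists>C. \<forall>s\<ge>0. norm (?f k s) \<le> C / (1 + s\<^sup>2)" for k
    using power_mult_exp_decay[OF a, of k] norm_power_exp[of _ k a] by metis
  have T: "set_integrable lborel {0<..} (?f k)" "((\<lambda>b. integral {0..b} (?f k)) \<longlongrightarrow> (LBINT s:{0<..}. ?f k s)) at_top" for k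
    using C[of k] tendsto_integral_decay[OF c] by blast+
  show "set_integrable lborel {0<..} (?f k)" by (rule T(1))
  have z: "((\<lambda>b. ?f k b) \<longlongrightarrow> 0) at_top" for k
  proof -
    obtain C where C: "\<And>s. 0 \<le> s \<Longrightarrow> norm (?f k s) \<le> C / (1 + s\<^sup>2)" using C[of k] by blast
    show ?thesis
    proof (rule Lim_null_comparison)
      show "\<forall>\<^sub>F b in at_top. norm (?f k b) \<le> C / (1 + b\<^sup>2)"
        using eventually_ge_at_top[of 0] by eventually_elim (rule C)
      show "((\<lambda>b. C / (1 + b\<^sup>2)) \<longlongrightarrow> 0) at_top" by real_asymp
    qed
  qed
  have a0: "a \<noteq> 0" using a by auto
  show "(LBINT s:{0<..}. ?f k s) = fact k / a ^ (k + 1)"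
  proof (induction k)
    case 0
    have "integral {0..b} (?f 0) = 1 / a - ?f 0 b / a" if "0 \<le> b" for b
    proof -
      have d: "((\<lambda>s. - ?f 0 s / a) has_vector_derivative ?f 0 s) (at s within {0..b})" for s
      proof -
        have "((\<lambda>z. - (z ^ 0 * exp (- a * z)) / a) has_field_derivative (of_real s ^ 0 * exp (- a * of_real s))) (at (of_real s))"
          by (rule derivative_eq_intros refl | use a0 in simp)+
        then show ?thesis by (rule has_vector_derivative_real_field)
      qed
      have "(?f 0 has_integral - ?f 0 b / a - (- ?f 0 0 / a)) {0..b}"
        by (rule fundamental_theorem_of_calculus[OF that d])
      then show ?thesis by (simp add: integral_unique)
    qed
    then have "\<forall>\<^sub>F b in at_top. integral {0..b} (?f 0) = 1 / a - ?f 0 b / a"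
      by (rule eventually_mono[OF eventually_ge_at_top[of 0]])
    moreover have "((\<lambda>b. 1 / a - ?f 0 b / a) \<longlongrightarrow> 1 / a - 0 / a) at_top"
      using z[of 0] by (intro tendsto_intros) (use a0 in auto)
    ultimately have "((\<lambda>b. integral {0..b} (?f 0)) \<longlongrightarrow> 1 / a) at_top"
      by (simp add: tendsto_cong)
    with T(2)[of 0] show ?case using tendsto_unique[OF trivial_limit_at_top_linorder] by fastforce
  next
    case (Suc k)
    have "of_nat (Suc k) * integral {0..b} (?f k) - a * integral {0..b} (?f (Suc k)) = ?f (Suc k) b" if "0 \<le> b" for b
    proof -
      have i: "(?f k has_integral integral {0..b} (?f k)) {0..b}" for k
        by (intro integrable_integral integrable_continuous_interval c)
      have d: "((\<lambda>s. ?f (Suc k) (s::real)) has_vector_derivative (of_nat (Suc k) * ?f k s - a * ?f (Suc k) s)) (at s within {0..b})" for s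
      proof -
        have "((\<lambda>z. z ^ Suc k * exp (- a * z)) has_field_derivative
            (of_nat (Suc k) * (of_real s ^ k * exp (- a * of_real s)) - a * (of_real s ^ Suc k * exp (- a * of_real s)))) (at (of_real s))"
          by (rule derivative_eq_intros refl)+ (simp add: algebra_simps)
        then show ?thesis by (rule has_vector_derivative_real_field)
      qed
      have h1: "((\<lambda>s. of_nat (Suc k) * ?f k s - a * ?f (Suc k) s) has_integral ?f (Suc k) b - ?f (Suc k) 0) {0..b}"
        by (rule fundamental_theorem_of_calculus[OF that d])
      have h2: "((\<lambda>s. of_nat (Suc k) * ?f k s - a * ?f (Suc k) s) has_integral
          (of_nat (Suc k) * integral {0..b} (?f k) - a * integral {0..b} (?f (Suc k)))) {0..b}"
        by (intro has_integral_diff has_integral_mult_right i)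
      show ?thesis using has_integral_unique[OF h2 h1] by simp
    qed
    then have "\<forall>\<^sub>F b in at_top. of_nat (Suc k) * integral {0..b} (?f k) - a * integral {0..b} (?f (Suc k)) = ?f (Suc k) b"
      by (rule eventually_mono[OF eventually_ge_at_top[of 0]])
    then have l1: "((\<lambda>b. of_nat (Suc k) * integral {0..b} (?f k) - a * integral {0..b} (?f (Suc k))) \<longlongrightarrow> 0) at_top"
      using z[of "Suc k"] by (simp only: tendsto_cong)
    have l2: "((\<lambda>b. of_nat (Suc k) * integral {0..b} (?f k) - a * integral {0..b} (?f (Suc k))) \<longlongrightarrow>
      of_nat (Suc k) * (LBINT s:{0<..}. ?f k s) - a * (LBINT s:{0<..}. ?f (Suc k) s)) at_top"
      by (intro tendsto_intros T(2))
    have "of_nat (Suc k) * (LBINT s:{0<..}. ?f k s) - a * (LBINT s:{0<..}. ?f (Suc k) s) = 0"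
      by (rule tendsto_unique[OF trivial_limit_at_top_linorder l2 l1])
    then show ?case using a0 unfolding Suc.IH by (simp add: field_simps)
  qed
qed

lemma power_exp_integral_real:
  fixes a :: real
  assumes a: "0 < a"
  shows "set_integrable lborel {0<..} (\<lambda>s. s ^ k * exp (- a * s))"
    and "(LBINT s:{0<..}. s ^ k * exp (- a * s)) = fact k / a ^ (k + 1)"
proof -
  note C = power_exp_integral[of "of_real a" k]
  have eq: "complex_of_real s ^ k * exp (- of_real a * of_real s) = of_real (s ^ k * exp (- a * s))" for s
    by (simp flip: exp_of_real)
  have "integrable lborel (\<lambda>s. complex_of_real (indicat_real {0<..} s *\<^sub>R (s ^ k * exp (- a * s))))"
    using C(1) a unfolding eq set_integrable_def by (simp add: scaleR_conv_of_real)
  then show "set_integrable lborel {0<..} (\<lambda>s. s ^ k * exp (- a * s))"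
    unfolding set_integrable_def complex_of_real_integrable_eq .
  have "complex_of_real (LBINT s:{0<..}. s ^ k * exp (- a * s)) = of_real (fact k / a ^ (k + 1))"
    using C(2)[unfolded eq] a by (simp only: set_integral_complex_of_real) simp
  then show "(LBINT s:{0<..}. s ^ k * exp (- a * s)) = fact k / a ^ (k + 1)"
    by (simp only: of_real_eq_iff)
qed

text \<open>Write ln s = ln(st) - ln t and use |ln u| \<le> u + 1/u for u = st. The relevant scale
  in the Laplace integrals is s ~ 1/t, where u is of order one, so only ln t is left as
  growth.\<close>

lemma abs_ln_le:
  fixes s t :: real
  assumes "0 < s" "1 \<le> t"
  shows "\<bar>ln s\<bar> \<le> ln t + s * t + 1 / (s * t)"
proof -
  have st: "0 < s * t" using assms by (auto intro!: mult_pos_pos)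
  have "ln (s * t) \<le> s * t" using ln_le_minus_one[OF st] by simp
  moreover have "- ln u \<le> 1 / u" if "0 < u" for u :: real
    using ln_le_minus_one[of "1 / u"] that by (simp add: ln_div)
  from this[OF st] have "- ln (s * t) \<le> 1 / (s * t)" .
  moreover have "0 < 1 / (s * t)" using st by simp
  moreover have "ln (s * t) = ln s + ln t" using assms by (intro ln_mult_pos) auto
  moreover have "0 \<le> ln t" using assms by simp
  ultimately show ?thesis using st by linarith
qed

text \<open>Rotating the contour to the ray of direction \<open>1 - \<i>\<tau>\<close> makes the Fourier kernel decay, so
  that pointwise bounds near the origin suffice. The parameter \<open>b\<close> switches the logarithm on.\<close>

lemma watson_rotated:
  fixes g :: "complex \<Rightarrow> complex"
  assumes \<tau>: "0 < \<tau>" and cont: "continuous_on (lower_wedge \<tau>) g"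
    and hol: "g holomorphic_on interior (lower_wedge \<tau>)"
    and bnd: "\<And>z. z \<in> lower_wedge \<tau> \<Longrightarrow> norm (g z) \<le> C / (1 + (norm z)\<^sup>2)"
    and b: "0 \<le> b" and D: "0 \<le> D"
    and exp: "\<And>z. z \<in> lower_wedge \<tau> \<Longrightarrow> z \<noteq> 0 \<Longrightarrow> norm (g z - c * z ^ k) \<le> D * norm z ^ (k + 1) * (1 + b * \<bar>ln (norm z)\<bar>)"
  shows "\<exists>E. \<forall>t\<ge>1. norm ((LBINT s:{0<..}. g (of_real s) * exp (- \<i> * of_real t * of_real s)) - c * fact k / (\<i> * of_real t) ^ (k + 1))
      \<le> E * (1 + b * ln t) / t ^ (k + 2)"
proof -
  define d where "d = Complex 1 (-\<tau>)"
  define m where "m = norm d"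
  have m1: "1 \<le> m" by (simp add: m_def d_def cmod_def real_le_rsqrt)
  define E where "E = m * (D * m ^ (k + 1)) * ((1 + b * ln m) * fact (k + 1) / \<tau> ^ (k + 2) + fact (k + 1) / \<tau> ^ (k + 2)
      + b * fact (k + 2) / \<tau> ^ (k + 3) + b * fact k / \<tau> ^ (k + 1))"
  show ?thesis
  proof (intro exI[of _ E] allI impI)
    fix t :: real assume t: "1 \<le> t"
    define q where "q = t * \<tau>"
    have q: "0 < q" using t \<tau> by (simp add: q_def)
    define A where "A z = exp (- \<i> * of_real t * z)" for z
    have nA: "norm (A z) = exp (t * Im z)" for z by (simp add: A_def norm_exp_eq_Re)
    \<comment> \<open>Along the ray the kernel is exp(-as) with Re a = t\<tau>, so oscillation has
      become exponential decay at a rate proportional to t.\<close>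
    define a where "a = \<i> * of_real t * d"
    have Rea: "Re a = q" by (simp add: a_def d_def q_def)
    have W: "of_real s * d \<in> lower_wedge \<tau>" if "0 \<le> s" for s
      using ray_in_lower_wedge(1)[of \<tau> s] that \<tau> by (simp add: d_def)
    have r: "(LBINT s:{0<..}. g (of_real s) * A (of_real s)) = d * (LBINT s:{0<..}. g (of_real s * d) * A (of_real s * d))"
      unfolding d_def
    proof (rule rotate_ray[OF \<tau>, of "\<lambda>z. g z * A z" C])
      show "continuous_on (lower_wedge \<tau>) (\<lambda>z. g z * A z)" unfolding A_def by (intro continuous_intros cont)
      show "(\<lambda>z. g z * A z) holomorphic_on interior (lower_wedge \<tau>)" unfolding A_def by (intro holomorphic_intros hol)
      fix z assume z: "z \<in> lower_wedge \<tau>"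
      then have "Im z \<le> 0" by (simp add: lower_wedge_def)
      then have "norm (A z) \<le> 1" using t unfolding nA by (simp add: mult_nonneg_nonpos)
      then have "norm (g z) * norm (A z) \<le> norm (g z)" by (simp add: mult_left_le)
      then show "norm (g z * A z) \<le> C / (1 + (norm z)\<^sup>2)" using bnd[OF z] by (simp add: norm_mult)
    qed
    have As: "A (of_real s * d) = exp (- a * of_real s)" for s by (simp add: A_def a_def mult_ac)
    have gi: "set_integrable lborel {0<..} (\<lambda>s. g (of_real s * d) * exp (- a * of_real s))"
    proof (rule tendsto_integral_decay(1)[where C = "\<bar>C\<bar>"])
      have "continuous_on {0..} (\<lambda>s. g (of_real s * d))"
        by (rule continuous_on_compose2[OF cont]) (auto intro!: continuous_intros W)
      then show "continuous_on {0..} (\<lambda>s. g (of_real s * d) * exp (- a * of_real s))" by (intro continuous_intros)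
      fix s :: real assume s: "0 \<le> s"
      have "norm (exp (- a * of_real s)) \<le> 1" using q s Rea by (simp add: norm_exp_eq_Re)
      then have "norm (g (of_real s * d) * exp (- a * of_real s)) \<le> norm (g (of_real s * d))"
        by (simp add: norm_mult mult_left_le)
      also have "\<dots> \<le> C / (1 + (norm (of_real s * d))\<^sup>2)" by (rule bnd[OF W[OF s]])
      also have "\<dots> \<le> \<bar>C\<bar> / (1 + (norm (of_real s * d))\<^sup>2)" by (intro divide_right_mono) (auto intro: add_nonneg_nonneg)
      also have "\<dots> \<le> \<bar>C\<bar> / (1 + s\<^sup>2)"
      proof (intro divide_left_mono add_left_mono)
        have "s * 1 \<le> s * norm d" using m1 s unfolding m_def by (rule mult_left_mono)
        then show "s\<^sup>2 \<le> (norm (of_real s * d))\<^sup>2" using s by (intro power_mono) (auto simp: norm_mult)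
      qed (auto intro!: mult_pos_pos add_pos_nonneg)
      finally show "norm (g (of_real s * d) * exp (- a * of_real s)) \<le> \<bar>C\<bar> / (1 + s\<^sup>2)" .
    qed
    have a0: "0 < Re a" using Rea q by simp
    note P = power_exp_integral[OF a0, of k]
    have mi: "set_integrable lborel {0<..} (\<lambda>s. c * (of_real s * d) ^ k * exp (- a * of_real s))"
      using set_integrable_mult_right[OF P(1), of "c * d ^ k"] by (simp add: power_mult_distrib mult_ac)
    have dn: "d \<noteq> 0" using m1 by (auto simp: m_def)
    \<comment> \<open>Since a^(k+1) = (it)^(k+1) d^(k+1), all powers of d produced by the change of
      ray cancel, and the leading term is independent of \<tau>.\<close>
    have main: "c * fact k / (\<i> * of_real t) ^ (k + 1) = d * (LBINT s:{0<..}. c * (of_real s * d) ^ k * exp (- a * of_real s))"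
    proof -
      have "(LBINT s:{0<..}. c * (of_real s * d) ^ k * exp (- a * of_real s)) = (LBINT s:{0<..}. (c * d ^ k) * (of_real s ^ k * exp (- a * of_real s)))"
        by (simp add: power_mult_distrib mult_ac)
      also have "\<dots> = c * d ^ k * (fact k / a ^ (k + 1))" by (simp only: set_integral_mult_right P(2))
      finally have I: "(LBINT s:{0<..}. c * (of_real s * d) ^ k * exp (- a * of_real s)) = c * d ^ k * (fact k / a ^ (k + 1))" .
      have "a ^ (k + 1) = (\<i> * of_real t) ^ (k + 1) * d ^ (k + 1)" by (simp only: a_def power_mult_distrib)
      then show ?thesis unfolding I using dn by simp
    qed
    let ?h = "\<lambda>s. (g (of_real s * d) - c * (of_real s * d) ^ k) * exp (- a * of_real s)"
    let ?e = "\<lambda>j s. s ^ j * exp (- q * s)"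
    let ?B = "\<lambda>s. (1 + b * ln m + b * ln t) * ?e (k + 1) s + b * t * ?e (k + 2) s + b / t * ?e k s"
    have diff: "(LBINT s:{0<..}. g (of_real s) * A (of_real s)) - c * fact k / (\<i> * of_real t) ^ (k + 1) = d * (LBINT s:{0<..}. ?h s)"
      unfolding r main As right_diff_distrib[symmetric] set_integral_diff(2)[OF gi mi, symmetric]
      by (simp add: left_diff_distrib)
    have hi: "set_integrable lborel {0<..} ?h"
      using set_integral_diff(1)[OF gi mi] by (simp add: left_diff_distrib)
    note R = power_exp_integral_real[OF q]
    have ia: "set_integrable lborel {0<..} (\<lambda>s. c * ?e j s)" for c j
      by (intro set_integrable_mult_right R(1))
    have ib: "(LBINT s:{0<..}. c * ?e j s) = c * (fact j / q ^ (j + 1))" for c j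
      by (simp only: set_integral_mult_right R(2))
    have Bi: "set_integrable lborel {0<..} (\<lambda>s. D * m ^ (k + 1) * ?B s)"
      by (intro set_integrable_mult_right set_integral_add(1) ia)
    have hB: "norm (?h s) \<le> D * m ^ (k + 1) * ?B s" if s: "0 < s" for s
    proof -
      have ns: "norm (of_real s * d) = s * m" using s by (simp add: norm_mult m_def)
      have nz: "of_real s * d \<noteq> 0" using s dn by simp
      have "\<bar>ln (s * m)\<bar> = \<bar>ln s + ln m\<bar>" using s m1 by (simp add: ln_mult_pos)
      also have "\<dots> \<le> \<bar>ln s\<bar> + ln m" using abs_triangle_ineq[of "ln s" "ln m"] m1 by simp
      also have "\<bar>ln s\<bar> \<le> ln t + s * t + 1 / (s * t)" by (rule abs_ln_le[OF s t])
      finally have L: "1 + b * \<bar>ln (s * m)\<bar> \<le> 1 + b * (ln t + s * t + 1 / (s * t) + ln m)"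
        using b by (intro add_left_mono mult_left_mono) auto
      have "norm (?h s) = norm (g (of_real s * d) - c * (of_real s * d) ^ k) * exp (- q * s)"
        by (simp add: norm_mult norm_exp_eq_Re Rea)
      also have "\<dots> \<le> D * (s * m) ^ (k + 1) * (1 + b * \<bar>ln (s * m)\<bar>) * exp (- q * s)"
        using exp[OF W nz] s unfolding ns by (intro mult_right_mono) auto
      also have "\<dots> \<le> D * (s * m) ^ (k + 1) * (1 + b * (ln t + s * t + 1 / (s * t) + ln m)) * exp (- q * s)"
        using L D s m1 by (intro mult_right_mono mult_left_mono) auto
      also have "\<dots> = D * m ^ (k + 1) * ?B s"
        using s t by (simp add: power_mult_distrib divide_simps) (simp add: algebra_simps)
      finally show ?thesis .
    qed
    have "norm (LBINT s:{0<..}. ?h s) \<le> (LBINT s:{0<..}. D * m ^ (k + 1) * ?B s)"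
      unfolding set_lebesgue_integral_def
    proof (rule Bochner_Integration.integral_norm_bound_integral)
      show "integrable lborel (\<lambda>s. indicat_real {0<..} s *\<^sub>R ?h s)" using hi by (simp add: set_integrable_def)
      show "integrable lborel (\<lambda>s. indicat_real {0<..} s *\<^sub>R (D * m ^ (k + 1) * ?B s))" using Bi by (simp add: set_integrable_def)
      fix s :: real
      show "norm (indicat_real {0<..} s *\<^sub>R ?h s) \<le> indicat_real {0<..} s *\<^sub>R (D * m ^ (k + 1) * ?B s)"
        using hB[of s] by (cases "0 < s") (auto simp del: mult_minus_left)
    qed
    also have "\<dots> = D * m ^ (k + 1) * ((1 + b * ln m + b * ln t) * (fact (k + 1) / q ^ (k + 1 + 1)) + b * t * (fact (k + 2) / q ^ (k + 2 + 1)) + b / t * (fact k / q ^ (k + 1)))"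
      by (simp only: set_integral_mult_right[of _ _ "D * m ^ (k + 1)"] set_integral_add(2)[OF set_integral_add(1)[OF ia ia] ia] set_integral_add(2)[OF ia ia] ib)
    finally have "norm d * norm (LBINT s:{0<..}. ?h s) \<le> m * (D * m ^ (k + 1) * ((1 + b * ln m + b * ln t) * (fact (k + 1) / q ^ (k + 1 + 1)) + b * t * (fact (k + 2) / q ^ (k + 2 + 1)) + b / t * (fact k / q ^ (k + 1))))"
      unfolding m_def[symmetric] using m1 by (intro mult_left_mono) auto
    also have "\<dots> = m * (D * m ^ (k + 1)) * ((1 + b * ln m + b * ln t) * (fact (k + 1) / \<tau> ^ (k + 2)) + b * (fact (k + 2) / \<tau> ^ (k + 3)) + b * (fact k / \<tau> ^ (k + 1))) / t ^ (k + 2)"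
    proof -
      \<comment> \<open>A factor t is compensated by one more power of s and a factor 1/t by one
        power less, so all three integrals have the same order t^(-(k+2)).\<close>
      have e1: "fact (k + 1) / q ^ (k + 1 + 1) = fact (k + 1) / \<tau> ^ (k + 2) / t ^ (k + 2)"
        "t * (fact (k + 2) / q ^ (k + 2 + 1)) = fact (k + 2) / \<tau> ^ (k + 3) / t ^ (k + 2)"
        "1 / t * (fact k / q ^ (k + 1)) = fact k / \<tau> ^ (k + 1) / t ^ (k + 2)"
        using t by (simp_all add: q_def power_mult_distrib power3_eq_cube numeral_3_eq_3)
      have e2: "b * t * x = b * (t * x)" "b / t * x = b * (1 / t * x)" for x by simp_all
      show ?thesis unfolding e2 e1 by (simp add: algebra_simps add_divide_distrib)
    qed
    also have "\<dots> \<le> E * (1 + b * ln t) / t ^ (k + 2)"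
    proof (rule divide_right_mono)
      define F where "F = fact (k + 1) / \<tau> ^ (k + 2)"
      define H where "H = b * (fact (k + 2) / \<tau> ^ (k + 3)) + b * (fact k / \<tau> ^ (k + 1))"
      have F: "0 \<le> F" and H: "0 \<le> H" and l: "0 \<le> b * ln t" "0 \<le> b * ln m"
        using \<tau> b t m1 by (auto simp: F_def H_def)
      have "(1 + b * ln m + b * ln t) * F + H \<le> ((1 + b * ln m) * F + F + H) * (1 + b * ln t)"
      proof -
        have "((1 + b * ln m) * F + F + H) * (1 + b * ln t) - ((1 + b * ln m + b * ln t) * F + H)
          = F + b * ln t * ((1 + b * ln m) * F + H)" by (simp add: algebra_simps)
        moreover have "0 \<le> F + b * ln t * ((1 + b * ln m) * F + H)" using F H l by simp
        ultimately show ?thesis by linarith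
      qed
      then have "m * (D * m ^ (k + 1)) * ((1 + b * ln m + b * ln t) * F + H) \<le> m * (D * m ^ (k + 1)) * (((1 + b * ln m) * F + F + H) * (1 + b * ln t))"
        using m1 D by (intro mult_left_mono) auto
      then show "m * (D * m ^ (k + 1)) * ((1 + b * ln m + b * ln t) * (fact (k + 1) / \<tau> ^ (k + 2)) + b * (fact (k + 2) / \<tau> ^ (k + 3)) + b * (fact k / \<tau> ^ (k + 1))) \<le> E * (1 + b * ln t)"
        unfolding E_def F_def H_def by (simp add: mult.assoc add.assoc)
    qed (use t in simp)
    finally show "norm ((LBINT s:{0<..}. g (of_real s) * exp (- \<i> * of_real t * of_real s)) - c * fact k / (\<i> * of_real t) ^ (k + 1))
      \<le> E * (1 + b * ln t) / t ^ (k + 2)"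
      using diff by (simp add: A_def norm_mult)
  qed
qed

section \<open>Cauchy integrals of rational form factors\<close>

lemma poly_quotient_decay:
  fixes q R :: "complex poly"
  assumes R0: "R \<noteq> 0"
  obtains B r where "1 \<le> r" "\<And>x. r \<le> norm x \<Longrightarrow> norm (poly q x / poly R x) \<le> B * norm x ^ degree q / norm x ^ degree R"
proof -
  have lR: "lead_coeff R \<noteq> 0" using R0 by simp
  have "((\<lambda>x. (poly q x / x ^ degree q) / (poly R x / x ^ degree R)) \<longlongrightarrow> lead_coeff q / lead_coeff R) at_infinity"
    by (intro tendsto_divide poly_divide_tendsto_aux lR)
  from tendsto_norm[OF this]
  have "\<forall>\<^sub>F x in at_infinity. norm ((poly q x / x ^ degree q) / (poly R x / x ^ degree R)) < norm (lead_coeff q / lead_coeff R) + 1"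
    by (rule order_tendstoD) simp
  then obtain b where b: "\<And>x. b \<le> norm x \<Longrightarrow> norm ((poly q x / x ^ degree q) / (poly R x / x ^ degree R)) < norm (lead_coeff q / lead_coeff R) + 1"
    by (auto simp: eventually_at_infinity)
  define B where "B = norm (lead_coeff q / lead_coeff R) + 1"
  show ?thesis
  proof (rule that[of "max 1 b" B])
    fix x :: complex assume x: "max 1 b \<le> norm x"
    then have x0: "x \<noteq> 0" by auto
    have "poly q x / poly R x = ((poly q x / x ^ degree q) / (poly R x / x ^ degree R)) * (x ^ degree q / x ^ degree R)"
      using x0 by simp
    then have "norm (poly q x / poly R x) = norm ((poly q x / x ^ degree q) / (poly R x / x ^ degree R)) * (norm x ^ degree q / norm x ^ degree R)"
      by (simp only: norm_mult norm_divide norm_power)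
    also have "\<dots> \<le> B * (norm x ^ degree q / norm x ^ degree R)"
      using b[of x] x by (intro mult_right_mono) (auto simp: B_def)
    finally show "norm (poly q x / poly R x) \<le> B * norm x ^ degree q / norm x ^ degree R" by simp
  qed simp
qed

lemma poly_quotient_decay2:
  fixes q R :: "complex poly"
  assumes deg: "degree q + 2 \<le> degree R" and S: "closed S" and nz: "\<And>x. x \<in> S \<Longrightarrow> poly R x \<noteq> 0"
  obtains C where "\<And>x. x \<in> S \<Longrightarrow> norm (poly q x / poly R x) \<le> C / (1 + (norm x)\<^sup>2)"
proof -
  have R0: "R \<noteq> 0" using deg by auto
  obtain B r where B: "1 \<le> r" "\<And>x. r \<le> norm x \<Longrightarrow> norm (poly q x / poly R x) \<le> B * norm x ^ degree q / norm x ^ degree R"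
    using poly_quotient_decay[OF R0] by blast
  have far: "norm (poly q x / poly R x) \<le> \<bar>B\<bar> / (norm x)\<^sup>2" if "x \<in> S" "r \<le> norm x" for x
  proof -
    have x1: "1 \<le> norm x" using B(1) that by linarith
    have "norm (poly q x / poly R x) \<le> B * norm x ^ degree q / norm x ^ degree R" by (rule B(2)[OF that(2)])
    also have "\<dots> \<le> \<bar>B\<bar> * norm x ^ degree q / norm x ^ degree R"
      by (intro divide_right_mono mult_right_mono) auto
    also have "\<dots> \<le> \<bar>B\<bar> * norm x ^ degree q / norm x ^ (degree q + 2)"
      using x1 deg by (intro divide_left_mono power_increasing mult_pos_pos zero_less_power) auto
    also have "\<dots> = \<bar>B\<bar> / (norm x)\<^sup>2" using x1 by (auto simp: power_add power2_eq_square)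
    finally show ?thesis .
  qed
  have "continuous_on S (\<lambda>x. poly q x / poly R x)" using nz by (intro continuous_intros) auto
  from decay_from_far[OF this S far] that show ?thesis by blast
qed

lemma set_integrable_poly_quotient:
  fixes q R :: "complex poly"
  assumes deg: "degree q + 2 \<le> degree R" and nz: "\<And>x::real. 0 \<le> x \<Longrightarrow> poly R (of_real x) \<noteq> 0"
  shows "set_integrable lborel {0<..} (\<lambda>s. poly q (of_real s) / poly R (of_real s))"
    and "((\<lambda>b. integral {0..b} (\<lambda>s. poly q (of_real s) / poly R (of_real s))) \<longlongrightarrow>
      (LBINT s:{0<..}. poly q (of_real s) / poly R (of_real s))) at_top"
proof -
  have cl: "closed (complex_of_real ` {0..})"
  proof -
    have "complex_of_real ` {0..} = {z. Im z = 0} \<inter> {z. 0 \<le> Re z}"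
      by (auto simp: complex_eq_iff image_iff intro: exI[of _ "Re _"])
    moreover have "closed {z. Im z = 0}" by (intro closed_Collect_eq continuous_intros)
    ultimately show ?thesis by (simp add: closed_Int closed_halfspace_Re_ge)
  qed
  obtain C where "\<And>x. x \<in> complex_of_real ` {0..} \<Longrightarrow> norm (poly q x / poly R x) \<le> C / (1 + (norm x)\<^sup>2)"
    using poly_quotient_decay2[OF deg cl, of thesis] nz by auto
  then have "norm (poly q (of_real s) / poly R (of_real s)) \<le> C / (1 + s\<^sup>2)" if "0 \<le> s" for s
    using that by force
  moreover have "continuous_on {0..} (\<lambda>s. poly q (complex_of_real s) / poly R (complex_of_real s))"
    using nz by (intro continuous_intros) auto
  ultimately show "set_integrable lborel {0<..} (\<lambda>s. poly q (of_real s) / poly R (of_real s))"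
    "((\<lambda>b. integral {0..b} (\<lambda>s. poly q (of_real s) / poly R (of_real s))) \<longlongrightarrow>
      (LBINT s:{0<..}. poly q (of_real s) / poly R (of_real s))) at_top"
    using tendsto_integral_decay by blast+
qed

section \<open>Polynomial shifts, the Bezoutian and the logarithmic kernel\<close>

lemma poly_shift_Suc: "poly p z = coeff p 0 + z * poly (poly_shift (Suc 0) p) z"
proof -
  have "p = pCons (coeff p 0) (poly_shift (Suc 0) p)"
    by (rule poly_eqI) (simp add: coeff_poly_shift coeff_pCons split: nat.split)
  then have "poly p z = poly (pCons (coeff p 0) (poly_shift (Suc 0) p)) z" by simp
  then show ?thesis by simp
qed

lemma poly_shift_step: "poly (poly_shift k p) z = coeff p k + z * poly (poly_shift (Suc k) p) z"
proof -
  have "poly_shift (Suc 0) (poly_shift k p) = poly_shift (Suc k) p"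
    by (rule poly_eqI) (simp add: coeff_poly_shift)
  then show ?thesis using poly_shift_Suc[of "poly_shift k p" z] by (simp add: coeff_poly_shift)
qed

text \<open>Horner's scheme: the shifts satisfy P_k(z) = c_k + z P_(k+1)(z), and the sum telescopes.
  Any upper bound n of the degree is allowed so that two polynomials can share one summation
  range.\<close>

lemma poly_diff_eq_sum_shift:
  fixes p :: "complex poly"
  assumes "degree p \<le> n"
  shows "poly p y - poly p z = (y - z) * (\<Sum>k<n. y ^ k * poly (poly_shift (Suc k) p) z)"
proof -
  have "(y - z) * (\<Sum>k<n. y ^ k * poly (poly_shift (Suc k) p) z) = y ^ n * poly (poly_shift n p) z - poly p z + (\<Sum>k<n. coeff p k * y ^ k)" for n
  proof (induction n)
    case (Suc n)
    then show ?case using poly_shift_step[of n p z] by (simp add: algebra_simps)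
  qed simp
  moreover have "poly_shift n p = [:coeff p n:]"
    by (rule poly_eqI) (use assms in \<open>auto simp: coeff_poly_shift coeff_pCons coeff_eq_0 split: nat.split\<close>)
  moreover have "poly p y = (\<Sum>k\<le>n. coeff p k * y ^ k)"
    unfolding poly_altdef by (rule sum.mono_neutral_left) (use assms in \<open>auto simp: coeff_eq_0\<close>)
  moreover have "(\<Sum>k\<le>n. coeff p k * y ^ k) = (\<Sum>k<n. coeff p k * y ^ k) + coeff p n * y ^ n"
    by (simp add: lessThan_Suc_atMost[symmetric])
  ultimately show ?thesis by (simp add: algebra_simps)
qed

text \<open>Coefficients in \<open>y\<close> of the Bezoutian \<open>(p(y) r(z) - p(z) r(y)) / (y - z)\<close>.\<close>

definition bezout_coeff :: "complex poly \<Rightarrow> complex poly \<Rightarrow> nat \<Rightarrow> complex poly" where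
  "bezout_coeff p r k = poly_shift (Suc k) p * r - p * poly_shift (Suc k) r"

lemma bezoutian:
  assumes "degree p \<le> n" "degree r \<le> n"
  shows "poly p y * poly r z - poly p z * poly r y = (y - z) * (\<Sum>k<n. y ^ k * poly (bezout_coeff p r k) z)"
proof -
  have "poly p y * poly r z - poly p z * poly r y = (poly p y - poly p z) * poly r z - poly p z * (poly r y - poly r z)"
    by (simp add: algebra_simps)
  also have "\<dots> = (y - z) * (\<Sum>k<n. y ^ k * poly (poly_shift (Suc k) p) z) * poly r z
       - poly p z * ((y - z) * (\<Sum>k<n. y ^ k * poly (poly_shift (Suc k) r) z))"
    using assms by (simp only: poly_diff_eq_sum_shift)
  also have "\<dots> = (y - z) * (\<Sum>k<n. y ^ k * poly (bezout_coeff p r k) z)"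
    by (simp add: bezout_coeff_def algebra_simps sum_distrib_left sum_distrib_right sum_subtractf)
  finally show ?thesis .
qed

text \<open>Each product in the definition may have degree up to 2n - k - 1. Multiplication by
  z^(k+1) turns shifts into cutoffs, the two terms p r cancel, and the rest has degree at most n +
  k. The bound is what keeps \<open>cauchy_reg\<close> bounded at infinity.\<close>

lemma degree_bezout_coeff:
  assumes p: "degree p \<le> n" and r: "degree r \<le> n" and n: "0 < n"
  shows "degree (bezout_coeff p r k) < n"
proof (cases "bezout_coeff p r k = 0")
  case False
  have cut: "monom 1 (Suc k) * poly_shift (Suc k) q = q - poly_cutoff (Suc k) q" for q :: "complex poly"
    by (rule poly_eqI) (auto simp: coeff_monom_mult coeff_poly_shift coeff_poly_cutoff)
  have "monom 1 (Suc k) * bezout_coeff p r k = (monom 1 (Suc k) * poly_shift (Suc k) p) * r - p * (monom 1 (Suc k) * poly_shift (Suc k) r)"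
    by (simp add: bezout_coeff_def algebra_simps)
  also have "\<dots> = p * poly_cutoff (Suc k) r - poly_cutoff (Suc k) p * r"
    unfolding cut by (simp add: algebra_simps)
  finally have eq: "monom 1 (Suc k) * bezout_coeff p r k = p * poly_cutoff (Suc k) r - poly_cutoff (Suc k) p * r" .
  have dc: "degree (poly_cutoff (Suc k) q) \<le> k" for q :: "complex poly"
    by (rule degree_le) (simp add: coeff_poly_cutoff)
  have "degree (p * poly_cutoff (Suc k) r - poly_cutoff (Suc k) p * r) \<le> n + k"
    using degree_mult_le[of p "poly_cutoff (Suc k) r"] degree_mult_le[of "poly_cutoff (Suc k) p" r] dc[of r] dc[of p] p r
    by (intro degree_diff_le) linarith+
  then have "degree (monom 1 (Suc k) * bezout_coeff p r k) \<le> n + k" by (simp only: eq)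
  moreover have "degree (monom 1 (Suc k) * bezout_coeff p r k) = Suc k + degree (bezout_coeff p r k)"
    using False by (subst degree_mult_eq) (auto simp: degree_monom_eq monom_eq_0_iff)
  ultimately show ?thesis by simp
qed (use n in simp)

definition ratio :: "complex poly \<Rightarrow> complex poly \<Rightarrow> complex \<Rightarrow> complex" where
  "ratio p r z = poly p z / poly r z"

text \<open>\<open>cauchy_reg\<close> is the rational function \<open>B\<close> of the header, the integral over \<open>s > 0\<close> of
  \<open>\<Gamma>(s) / (s - z) - \<Gamma>(z) (1 / (s - z) - 1 / (s + 1))\<close> for \<open>\<Gamma> = p / r\<close>. Expanding the
  Bezoutian of \<open>(1 + s) p\<close> and \<open>r\<close> in powers of \<open>s\<close> removes the apparent singularity at
  \<open>s = z\<close> and leaves finitely many moments.\<close>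

definition moment :: "complex poly \<Rightarrow> nat \<Rightarrow> complex" where
  "moment r k = (LBINT s:{0<..}. of_real s ^ k / (poly r (of_real s) * (1 + of_real s)))"

definition cauchy_reg :: "complex poly \<Rightarrow> complex poly \<Rightarrow> complex \<Rightarrow> complex" where
  "cauchy_reg p r z = (\<Sum>k<degree r. moment r k * poly (bezout_coeff (p * [:1, 1:]) r k) z) / poly r z"

definition reg_kernel :: "complex poly \<Rightarrow> complex poly \<Rightarrow> complex \<Rightarrow> real \<Rightarrow> complex" where
  "reg_kernel p r z s = (\<Sum>k<degree r. of_real s ^ k / (poly r (of_real s) * (1 + of_real s)) * poly (bezout_coeff (p * [:1, 1:]) r k) z) / poly r z"

text \<open>Subtracting 1/(s+1) creates quadratic decay. The path s - z avoids the cut of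
  \<open>Ln\<close> as z is off the nonnegative axis, so Ln(s - z) - Ln(s + 1) is a primitive. It
  tends to 0: division by the positive number s + 1 leaves the argument unchanged, so the difference
  is the logarithm of a quotient tending to 1.\<close>

lemma log_kernel_integral:
  assumes z: "z \<notin> complex_of_real ` {0..}"
  shows "set_integrable lborel {0<..} (\<lambda>s. 1 / (of_real s - z) - 1 / (of_real s + 1))"
    and "(LBINT s:{0<..}. 1 / (of_real s - z) - 1 / (of_real s + 1)) = - Ln (- z)"
proof -
  define R where "R = [:-z, 1:] * [:1, 1:]"
  have R: "poly R (of_real s) = (of_real s - z) * (of_real s + 1)" for s
    by (simp add: R_def algebra_simps)
  have s1: "complex_of_real s + 1 \<noteq> 0" if "0 \<le> s" for s
  proof
    assume "complex_of_real s + 1 = 0"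
    then have "Re (complex_of_real s + 1) = 0" by (simp only: zero_complex.sel)
    then show False using that by simp
  qed
  have sz: "of_real s - z \<noteq> 0" if "0 \<le> s" for s using z that by auto
  have eq: "1 / (of_real s - z) - 1 / (of_real s + 1) = poly [:z + 1:] (of_real s) / poly R (of_real s)" if "0 \<le> s" for s
    using sz[OF that] s1[OF that] unfolding R by (simp add: divide_simps)
  have dR: "degree R = 2" by (simp add: R_def degree_mult_eq)
  note Q = set_integrable_poly_quotient[of "[:z + 1:]" R]
  have nz: "poly R (of_real s) \<noteq> 0" if "0 \<le> s" for s unfolding R using sz[OF that] s1[OF that] by simp
  have Q1: "set_integrable lborel {0<..} (\<lambda>s. poly [:z + 1:] (of_real s) / poly R (of_real s))"
    and Q2: "((\<lambda>b. integral {0..b} (\<lambda>s. poly [:z + 1:] (of_real s) / poly R (of_real s))) \<longlongrightarrow>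
      (LBINT s:{0<..}. poly [:z + 1:] (of_real s) / poly R (of_real s))) at_top"
    using Q nz dR by auto
  show "set_integrable lborel {0<..} (\<lambda>s. 1 / (of_real s - z) - 1 / (of_real s + 1))"
    using Q1 by (rule set_integrable_cong[THEN iffD2, rotated -1]) (auto simp: eq[OF less_imp_le] simp del: poly_pCons)
  have Le: "(LBINT s:{0<..}. 1 / (of_real s - z) - 1 / (of_real s + 1)) = (LBINT s:{0<..}. poly [:z + 1:] (of_real s) / poly R (of_real s))"
    by (rule set_lebesgue_integral_cong) (auto simp: eq[OF less_imp_le] simp del: poly_pCons)
  have cut: "of_real s - z \<notin> \<real>\<^sub>\<le>\<^sub>0" if "0 \<le> s" for s
  proof
    assume "of_real s - z \<in> \<real>\<^sub>\<le>\<^sub>0"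
    then obtain u where u: "of_real s - z = of_real u" "u \<le> 0" by (auto simp: nonpos_Reals_def)
    then have "z = of_real (s - u)" by (simp add: algebra_simps)
    moreover have "s - u \<in> {0..}" using u that by simp
    ultimately show False using z by blast
  qed
  have cut1: "complex_of_real s + 1 \<notin> \<real>\<^sub>\<le>\<^sub>0" if "0 \<le> s" for s
    using that by (auto simp: complex_nonpos_Reals_iff)
  let ?F = "\<lambda>s. Ln (of_real s - z) - Ln (of_real s + 1)"
  have int: "integral {0..b} (\<lambda>s. poly [:z + 1:] (of_real s) / poly R (of_real s)) = ?F b - ?F 0" if b: "0 \<le> b" for b
  proof -
    have d: "(?F has_vector_derivative (1 / (of_real s - z) - 1 / (of_real s + 1))) (at s within {0..b})" if s: "0 \<le> s" for s
    proof -
      have "((\<lambda>w. Ln (w - z) - Ln (w + 1)) has_field_derivative (1 / (of_real s - z) - 1 / (of_real s + 1))) (at (of_real s))"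
        by (rule derivative_eq_intros refl cut cut1 s)+ (simp add: divide_inverse)
      then show ?thesis by (rule has_vector_derivative_real_field)
    qed
    have "((\<lambda>s. 1 / (of_real s - z) - 1 / (of_real s + 1)) has_integral ?F b - ?F 0) {0..b}"
      by (rule fundamental_theorem_of_calculus[OF b d]) auto
    then have "((\<lambda>s. poly [:z + 1:] (of_real s) / poly R (of_real s)) has_integral ?F b - ?F 0) {0..b}"
      by (rule has_integral_eq[rotated]) (simp add: eq del: poly_pCons)
    then show ?thesis by (rule integral_unique)
  qed
  have lim: "(?F \<longlongrightarrow> 0) at_top"
  proof -
    let ?w = "\<lambda>s. (complex_of_real s - z) / (of_real s + 1)"
    have "?F s = Ln (?w s)" if s: "0 \<le> s" for s
    proof -
      have "Ln (of_real (s + 1) * ?w s) = Ln (of_real (s + 1)) + Ln (?w s)"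
        by (rule Ln_times_of_real) (use s sz[OF s] s1[OF s] in auto)
      moreover have "of_real (s + 1) * ?w s = of_real s - z" using s1[OF s] by simp
      ultimately show ?thesis by simp
    qed
    then have ev: "\<forall>\<^sub>F s in at_top. ?F s = Ln (?w s)"
      by (intro eventually_mono[OF eventually_ge_at_top[of 0]])
    have "(?w \<longlongrightarrow> 1) at_top"
    proof -
      have "((\<lambda>s. 1 - (z + 1) * of_real (1 / (s + 1))) \<longlongrightarrow> 1 - (z + 1) * of_real 0) at_top"
        by (intro tendsto_intros) real_asymp
      moreover have "?w s = 1 - (z + 1) * of_real (1 / (s + 1))" if "0 \<le> s" for s
        using s1[OF that] by (simp add: divide_simps)
      then have "\<forall>\<^sub>F s in at_top. ?w s = 1 - (z + 1) * of_real (1 / (s + 1))"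
        by (intro eventually_mono[OF eventually_ge_at_top[of 0]])
      ultimately show ?thesis by (simp add: tendsto_cong)
    qed
    then have "((\<lambda>s. Ln (?w s)) \<longlongrightarrow> Ln 1) at_top"
      by (rule isCont_tendsto_compose[rotated]) (simp add: continuous_at_Ln)
    then show ?thesis using tendsto_cong[OF ev] by simp
  qed
  have "\<forall>\<^sub>F b in at_top. integral {0..b} (\<lambda>s. poly [:z + 1:] (of_real s) / poly R (of_real s)) = ?F b - ?F 0"
    by (rule eventually_mono[OF eventually_ge_at_top[of 0] int])
  moreover have "((\<lambda>b. ?F b - ?F 0) \<longlongrightarrow> 0 - ?F 0) at_top" by (intro tendsto_diff lim tendsto_const)
  ultimately have "((\<lambda>b. integral {0..b} (\<lambda>s. poly [:z + 1:] (of_real s) / poly R (of_real s))) \<longlongrightarrow> 0 - ?F 0) at_top"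
    by (simp only: tendsto_cong)
  from tendsto_unique[OF trivial_limit_at_top_linorder Q2 this]
  show "(LBINT s:{0<..}. 1 / (of_real s - z) - 1 / (of_real s + 1)) = - Ln (- z)"
    unfolding Le by simp
qed

section \<open>Self energy and principal value of a single rational form factor\<close>

locale form_factor =
  fixes p r :: "complex poly"
  assumes deg: "degree p + 2 \<le> degree r"
    and nz: "\<And>x::real. 0 \<le> x \<Longrightarrow> poly r (of_real x) \<noteq> 0"
    and p0: "poly p 0 = 0"
begin

lemma ratio_0 [simp]: "ratio p r 0 = 0" by (simp add: ratio_def p0)

lemma one_plus_nz: "0 \<le> s \<Longrightarrow> 1 + complex_of_real s \<noteq> 0"
  by (auto simp: complex_eq_iff)

lemma r_neq_0: "r \<noteq> 0" using nz[of 0] by auto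

text \<open>The factor 1 + s supplies the missing degree: k is at most deg r - 1, while the
  denominator has degree deg r + 1.\<close>

lemma moment_integrable:
  assumes "k < degree r"
  shows "set_integrable lborel {0<..} (\<lambda>s. of_real s ^ k / (poly r (of_real s) * (1 + of_real s)))"
proof -
  have "set_integrable lborel {0<..} (\<lambda>s. poly (monom 1 k) (of_real s) / poly (r * [:1, 1:]) (of_real s))"
  proof (rule set_integrable_poly_quotient(1))
    have "degree (r * [:1, 1:]) = degree r + 1" using r_neq_0 by (subst degree_mult_eq) auto
    then show "degree (monom (1::complex) k) + 2 \<le> degree (r * [:1, 1:])" using assms by (simp add: degree_monom_eq)
    fix s :: real assume "0 \<le> s"
    then show "poly (r * [:1, 1:]) (of_real s) \<noteq> 0"
      using nz one_plus_nz by (simp only: poly_mult mult_eq_0_iff) simp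
  qed
  then show ?thesis
    by (simp only: poly_monom poly_mult poly_pCons poly_0 mult_zero_right add_0_right mult_1_right mult_1_left)
qed

lemma reg_kernel_integral:
  shows "set_integrable lborel {0<..} (reg_kernel p r z)"
    and "(LBINT s:{0<..}. reg_kernel p r z s) = cauchy_reg p r z"
proof -
  have i: "integrable lborel (\<lambda>s. indicat_real {0<..} s *\<^sub>R (of_real s ^ k / (poly r (of_real s) * (1 + of_real s)))
      * poly (bezout_coeff (p * [:1, 1:]) r k) z)" if "k < degree r" for k
    using moment_integrable[OF that] unfolding set_integrable_def by (rule integrable_mult_left)
  have e: "(\<lambda>s. indicat_real {0<..} s *\<^sub>R reg_kernel p r z s) =
     (\<lambda>s. (\<Sum>k<degree r. indicat_real {0<..} s *\<^sub>R (of_real s ^ k / (poly r (of_real s) * (1 + of_real s)))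
      * poly (bezout_coeff (p * [:1, 1:]) r k) z) / poly r z)"
    by (auto simp: reg_kernel_def indicator_def)
  show "set_integrable lborel {0<..} (reg_kernel p r z)"
    unfolding set_integrable_def e by (intro integrable_divide_zero Bochner_Integration.integrable_sum i) auto
  have "(LBINT s:{0<..}. reg_kernel p r z s) = (\<Sum>k<degree r. (LBINT s. indicat_real {0<..} s *\<^sub>R (of_real s ^ k / (poly r (of_real s) * (1 + of_real s)))
      * poly (bezout_coeff (p * [:1, 1:]) r k) z)) / poly r z"
    unfolding set_lebesgue_integral_def e integral_divide_zero
    by (subst Bochner_Integration.integral_sum) (use i in auto)
  then show "(LBINT s:{0<..}. reg_kernel p r z s) = cauchy_reg p r z"
    by (simp only: cauchy_reg_def moment_def set_lebesgue_integral_def integral_mult_left_zero)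
qed

lemma reg_kernel_eq:
  assumes "poly r z \<noteq> 0" "0 \<le> s" "of_real s \<noteq> z"
  shows "ratio p r (of_real s) / (of_real s - z) = reg_kernel p r z s + ratio p r z * (1 / (of_real s - z) - 1 / (of_real s + 1))"
proof -
  let ?P = "p * [:1, 1:]"
  let ?y = "complex_of_real s"
  have rs: "poly r ?y \<noteq> 0" "1 + ?y \<noteq> 0" using nz one_plus_nz assms by auto
  have ys: "?y - z \<noteq> 0" using assms by simp
  have dp: "degree ?P \<le> degree r"
    using degree_mult_le[of p "[:1, 1:]"] deg by simp
  have bz: "poly ?P ?y * poly r z - poly ?P z * poly r ?y = (?y - z) * (\<Sum>k<degree r. ?y ^ k * poly (bezout_coeff ?P r k) z)"
    by (rule bezoutian[OF dp]) simp
  have "reg_kernel p r z s = (\<Sum>k<degree r. ?y ^ k * poly (bezout_coeff ?P r k) z) / (poly r ?y * (1 + ?y) * poly r z)"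
    by (simp add: reg_kernel_def sum_divide_distrib)
  also have "\<dots> = ((?y - z) * (\<Sum>k<degree r. ?y ^ k * poly (bezout_coeff ?P r k) z)) / ((?y - z) * (poly r ?y * (1 + ?y) * poly r z))"
    using ys by simp
  also have "\<dots> = (poly p ?y * (1 + ?y) * poly r z - poly p z * (1 + z) * poly r ?y) / ((?y - z) * (poly r ?y * (1 + ?y) * poly r z))"
    unfolding bz[symmetric] by (simp add: algebra_simps)
  also have "\<dots> = poly p ?y / poly r ?y / (?y - z) - poly p z / poly r z * ((1 + z) / ((?y - z) * (1 + ?y)))"
    using rs ys assms(1) by (simp add: diff_divide_distrib mult_ac)
  also have "(1 + z) / ((?y - z) * (1 + ?y)) = 1 / (?y - z) - 1 / (?y + 1)"
    using rs ys by (simp add: divide_simps add.commute)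
  finally show ?thesis by (simp add: ratio_def)
qed

lemma cauchy_integral:
  assumes r: "poly r z \<noteq> 0" and z: "z \<notin> complex_of_real ` {0..}"
  shows "(LBINT s:{0<..}. ratio p r (of_real s) / (of_real s - z)) = cauchy_reg p r z - Ln (- z) * ratio p r z"
proof -
  have "(LBINT s:{0<..}. ratio p r (of_real s) / (of_real s - z)) =
     (LBINT s:{0<..}. reg_kernel p r z s + ratio p r z * (1 / (of_real s - z) - 1 / (of_real s + 1)))"
    by (rule set_lebesgue_integral_cong) (use z in \<open>auto intro!: reg_kernel_eq r\<close>)
  also have "\<dots> = cauchy_reg p r z + ratio p r z * (- Ln (- z))"
    using reg_kernel_integral[of z] log_kernel_integral[OF z]
    by (subst set_integral_add(2)) (auto simp: set_integral_mult_right)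
  finally show ?thesis by simp
qed

text \<open>At z = 0 the logarithmic kernel carries the factor \<Gamma>(0) = 0, so only the regular
  kernel is left.\<close>

lemma cauchy_integral_0: "(LBINT s:{0<..}. ratio p r (of_real s) / (of_real s - 0)) = cauchy_reg p r 0"
proof -
  have "(LBINT s:{0<..}. ratio p r (of_real s) / (of_real s - 0)) = (LBINT s:{0<..}. reg_kernel p r 0 s)"
    by (rule set_lebesgue_integral_cong) (use nz[of 0] reg_kernel_eq[of 0] in auto)
  then show ?thesis by (simp add: reg_kernel_integral)
qed

lemma cauchy_reg_holomorphic: "cauchy_reg p r holomorphic_on {z. poly r z \<noteq> 0}"
  unfolding cauchy_reg_def[abs_def] by (intro holomorphic_intros) auto

lemma ratio_holomorphic: "ratio p r holomorphic_on {z. poly r z \<noteq> 0}"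
  unfolding ratio_def[abs_def] by (intro holomorphic_intros) auto

text \<open>The coefficient polynomials have degree below that of r, so every quotient in the finite
  sum stays bounded.\<close>

lemma cauchy_reg_bounded_far:
  obtains B R where "1 \<le> R" "\<And>z. R \<le> norm z \<Longrightarrow> norm (cauchy_reg p r z) \<le> B"
proof -
  define c where "c k = bezout_coeff (p * [:1, 1:]) r k" for k
  have dp: "degree (p * [:1, 1:]) \<le> degree r"
    using degree_mult_le[of p "[:1, 1:]"] deg by simp
  have "\<exists>B R. \<forall>z. R \<le> norm z \<longrightarrow> norm (poly (c k) z / poly r z) \<le> B" for k
  proof -
    have dk: "degree (c k) \<le> degree r"
      using degree_bezout_coeff[OF dp order_refl, of k] deg by (simp add: c_def)
    obtain B R where B: "1 \<le> R" "\<And>x. R \<le> norm x \<Longrightarrow> norm (poly (c k) x / poly r x) \<le> B * norm x ^ degree (c k) / norm x ^ degree r"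
      using poly_quotient_decay[OF r_neq_0] by blast
    have "norm (poly (c k) x / poly r x) \<le> \<bar>B\<bar>" if x: "R \<le> norm x" for x
    proof -
      have x1: "1 \<le> norm x" using x B(1) by linarith
      have q: "norm x ^ degree (c k) / norm x ^ degree r \<le> 1"
        using x1 dk by (subst divide_le_eq_1_pos) (auto intro!: power_increasing zero_less_power)
      have "norm (poly (c k) x / poly r x) \<le> B * (norm x ^ degree (c k) / norm x ^ degree r)"
        using B(2)[OF x] by simp
      also have "\<dots> \<le> \<bar>B\<bar> * (norm x ^ degree (c k) / norm x ^ degree r)" by (intro mult_right_mono) auto
      also have "\<dots> \<le> \<bar>B\<bar> * 1" by (rule mult_left_mono[OF q]) simp
      finally show ?thesis by simp
    qed
    then show ?thesis by blast
  qed
  then obtain B R where BR: "\<And>k z. R k \<le> norm z \<Longrightarrow> norm (poly (c k) z / poly r z) \<le> B k"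
    by metis
  define R1 where "R1 = Max (insert 1 (R ` {..<degree r}))"
  have "norm (cauchy_reg p r z) \<le> (\<Sum>k<degree r. norm (moment r k) * B k)" if z: "R1 \<le> norm z" for z
  proof -
    have "cauchy_reg p r z = (\<Sum>k<degree r. moment r k * (poly (c k) z / poly r z))"
      by (simp add: cauchy_reg_def c_def sum_divide_distrib)
    then have "norm (cauchy_reg p r z) \<le> (\<Sum>k<degree r. norm (moment r k * (poly (c k) z / poly r z)))"
      by (simp only: norm_sum)
    also have "\<dots> \<le> (\<Sum>k<degree r. norm (moment r k) * B k)"
    proof (rule sum_mono)
      fix k assume "k \<in> {..<degree r}"
      then have "R k \<le> R1" by (auto simp: R1_def)
      then have "norm (poly (c k) z / poly r z) \<le> B k" using z by (intro BR) simp
      then show "norm (moment r k * (poly (c k) z / poly r z)) \<le> norm (moment r k) * B k"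
        unfolding norm_mult by (rule mult_left_mono) simp
    qed
    finally show ?thesis .
  qed
  moreover have "1 \<le> R1" by (simp add: R1_def)
  ultimately show ?thesis using that by blast
qed

lemma ratio_decay:
  assumes "closed S" "\<And>z. z \<in> S \<Longrightarrow> poly r z \<noteq> 0"
  obtains C where "\<And>z. z \<in> S \<Longrightarrow> norm (ratio p r z) \<le> C / (1 + (norm z)\<^sup>2)"
  using poly_quotient_decay2[OF deg assms] that unfolding ratio_def by blast

text \<open>With [x - e, x + e] removed, ln|s - x| - ln(s + 1) is a primitive of the logarithmic
  kernel. The two contributions ln e cancel, which is the effect of the symmetric cut, and -ln x
  stays as e tends to 0. The regular kernel is integrable across x, so its cut disappears by
  dominated convergence.\<close>

lemma principal_value:
  assumes x: "0 < x"
  shows "((\<lambda>e. LBINT s:{0<..} - {x - e..x + e}. ratio p r (of_real s) / of_real (s - x)) \<longlongrightarrow>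
    cauchy_reg p r (of_real x) - of_real (ln x) * ratio p r (of_real x)) (at_right 0)"
proof -
  have rx: "poly r (of_real x) \<noteq> 0" using nz x by simp
  let ?S = "\<lambda>e. {0<..} - {x - e..x + e}"
  let ?k = "\<lambda>s. 1 / (s - x) - 1 / (s + 1)"
  let ?L = "\<lambda>e. ln (x + e + 1) - ln (x - e + 1) - ln x"
  have main: "(LBINT s:?S e. ratio p r (of_real s) / of_real (s - x)) =
     (LBINT s:?S e. reg_kernel p r (of_real x) s) + ratio p r (of_real x) * of_real (?L e)"
    if e: "0 < e" "e < x" for e
  proof -
    have right: "set_integrable lborel {x + e<..} ?k" "(LBINT s:{x + e<..}. ?k s) = 0 - (ln e - ln (x + e + 1))"
    proof -
      have d: "((\<lambda>s. ln (s - x) - ln (s + 1)) has_real_derivative ?k s) (at s)" if "x + e < s" for s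
        using that e x by (auto intro!: derivative_eq_intros)
      have c: "isCont ?k s" if "x + e < s" for s using that e x by (intro continuous_intros) auto
      have nn: "0 \<le> ?k s" if "x + e < s" for s
        using that e x by (auto simp: divide_simps)
      have A: "((\<lambda>s. ln (s - x) - ln (s + 1)) \<longlongrightarrow> ln e - ln (x + e + 1)) (at_right (x + e))"
      proof -
        have "isCont (\<lambda>s. ln (s - x) - ln (s + 1)) (x + e)" using e x by (intro continuous_intros) auto
        then have "((\<lambda>s. ln (s - x) - ln (s + 1)) \<longlongrightarrow> ln (x + e - x) - ln (x + e + 1)) (at_right (x + e))"
          unfolding isCont_def by (rule tendsto_within_subset) simp
        then show ?thesis by simp
      qed
      have B: "((\<lambda>s. ln (s - x) - ln (s + 1)) \<longlongrightarrow> 0) at_top" by real_asymp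
      note F = interval_integral_FTC_nonneg[of "ereal (x + e)" "\<infinity>" "\<lambda>s. ln (s - x) - ln (s + 1)" ?k "ln e - ln (x + e + 1)" 0]
      have "set_integrable lborel (einterval (ereal (x + e)) \<infinity>) ?k \<and> (LBINT s=ereal (x + e)..\<infinity>. ?k s) = 0 - (ln e - ln (x + e + 1))"
        using F d c nn A B by (auto simp: ereal_tendsto_simps)
      moreover have "einterval (ereal (x + e)) \<infinity> = {x + e<..}" by (auto simp: einterval_def)
      ultimately show "set_integrable lborel {x + e<..} ?k" "(LBINT s:{x + e<..}. ?k s) = 0 - (ln e - ln (x + e + 1))"
        by (auto simp: interval_lebesgue_integral_def)
    qed
    have left: "set_integrable lborel {0<..<x - e} ?k" "(LBINT s:{0<..<x - e}. ?k s) = (ln e - ln (x - e + 1)) - ln x"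
    proof -
      have c: "continuous_on {0..x - e} ?k" using e x by (intro continuous_intros) auto
      have d: "((\<lambda>s. ln (x - s) - ln (s + 1)) has_vector_derivative ?k s) (at s within {0..x - e})" if "0 \<le> s" "s \<le> x - e" for s
      proof -
        have "((\<lambda>s. ln (x - s) - ln (s + 1)) has_real_derivative ?k s) (at s)"
          using that e x by (auto intro!: derivative_eq_intros simp: divide_simps) (simp_all add: algebra_simps)
        then show ?thesis by (simp add: has_real_derivative_iff_has_vector_derivative has_vector_derivative_at_within)
      qed
      have "set_integrable lborel {0..x - e} ?k" by (rule borel_integrable_atLeastAtMost'[OF c])
      then show "set_integrable lborel {0<..<x - e} ?k" by (rule set_integrable_subset) auto
      have "(LBINT s=ereal 0..ereal (x - e). ?k s) = (ln (x - (x - e)) - ln (x - e + 1)) - (ln (x - 0) - ln (0 + 1))"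
        by (rule interval_integral_FTC_finite) (use c d e in \<open>auto simp: min_def max_def\<close>)
      then show "(LBINT s:{0<..<x - e}. ?k s) = (ln e - ln (x - e + 1)) - ln x"
        using e by (simp add: interval_integral_Ioo zero_ereal_def)
    qed
    have Se: "?S e = {0<..<x - e} \<union> {x + e<..}" using e by auto
    have k: "set_integrable lborel (?S e) ?k" "(LBINT s:?S e. ?k s) = ?L e"
    proof -
      show "set_integrable lborel (?S e) ?k" unfolding Se by (intro set_integrable_Un left right) auto
      have "(LBINT s:?S e. ?k s) = (LBINT s:{0<..<x - e}. ?k s) + (LBINT s:{x + e<..}. ?k s)"
        unfolding Se by (intro set_integral_Un left right) (use e in auto)
      then show "(LBINT s:?S e. ?k s) = ?L e" unfolding left right by simp
    qed
    have kc: "set_integrable lborel (?S e) (\<lambda>s. complex_of_real (?k s))"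
    proof -
      have "integrable lborel (\<lambda>s. complex_of_real (indicat_real (?S e) s *\<^sub>R ?k s))"
        using k(1) unfolding set_integrable_def complex_of_real_integrable_eq .
      then show ?thesis unfolding set_integrable_def by (simp only: scaleR_conv_of_real[where 'a = complex] real_scaleR_def of_real_mult)
    qed
    have hi: "set_integrable lborel (?S e) (reg_kernel p r (of_real x))"
      by (rule set_integrable_subset[OF reg_kernel_integral(1)]) auto
    have "(LBINT s:?S e. ratio p r (of_real s) / of_real (s - x)) =
       (LBINT s:?S e. reg_kernel p r (of_real x) s + ratio p r (of_real x) * of_real (?k s))"
    proof (rule set_lebesgue_integral_cong)
      show "\<forall>s. s \<in> ?S e \<longrightarrow> ratio p r (of_real s) / of_real (s - x) = reg_kernel p r (of_real x) s + ratio p r (of_real x) * of_real (?k s)"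
      proof (intro allI impI)
        fix s assume s: "s \<in> ?S e"
        then have "s \<noteq> x" using e by auto
        then show "ratio p r (of_real s) / of_real (s - x) = reg_kernel p r (of_real x) s + ratio p r (of_real x) * of_real (?k s)"
          using reg_kernel_eq[OF rx, of s] s by simp
      qed
    qed auto
    also have "\<dots> = (LBINT s:?S e. reg_kernel p r (of_real x) s) + ratio p r (of_real x) * (LBINT s:?S e. complex_of_real (?k s))"
      by (subst set_integral_add(2)[OF hi set_integrable_mult_right[OF kc]]) (simp only: set_integral_mult_right)
    also have "(LBINT s:?S e. complex_of_real (?k s)) = of_real (?L e)"
      by (simp only: set_integral_complex_of_real k(2))
    finally show ?thesis .
  qed
  have l1: "((\<lambda>e. LBINT s:?S e. reg_kernel p r (of_real x) s) \<longlongrightarrow> cauchy_reg p r (of_real x)) (at_right 0)"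
    unfolding tendsto_at_iff_sequentially o_def
  proof (intro allI impI)
    fix X :: "nat \<Rightarrow> real" assume X: "\<forall>i. X i \<in> {0<..} - {0}" "X \<longlonglongrightarrow> 0"
    have m: "(\<lambda>s. indicat_real {0<..} s *\<^sub>R reg_kernel p r (of_real x) s) \<in> borel_measurable lborel"
      using reg_kernel_integral(1)[of "of_real x"] by (simp add: set_integrable_def)
    have "(\<lambda>n. LBINT s:?S (X n). reg_kernel p r (of_real x) s) \<longlonglongrightarrow> (LBINT s:{0<..}. reg_kernel p r (of_real x) s)"
      unfolding set_lebesgue_integral_def
    proof (rule integral_dominated_convergence[where w = "\<lambda>s. norm (indicat_real {0<..} s *\<^sub>R reg_kernel p r (of_real x) s)"])
      show "(\<lambda>s. indicat_real {0<..} s *\<^sub>R reg_kernel p r (of_real x) s) \<in> borel_measurable lborel" by (rule m)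
      show "(\<lambda>s. indicat_real (?S (X n)) s *\<^sub>R reg_kernel p r (of_real x) s) \<in> borel_measurable lborel" for n
      proof -
        have "(\<lambda>s. indicat_real (?S (X n)) s *\<^sub>R reg_kernel p r (of_real x) s) =
          (\<lambda>s. indicat_real (?S (X n)) s *\<^sub>R (indicat_real {0<..} s *\<^sub>R reg_kernel p r (of_real x) s))"
          by (auto simp: indicator_def)
        also have "\<dots> \<in> borel_measurable lborel" by (intro borel_measurable_scaleR m) simp
        finally show ?thesis .
      qed
      show "integrable lborel (\<lambda>s. norm (indicat_real {0<..} s *\<^sub>R reg_kernel p r (of_real x) s))"
        using reg_kernel_integral(1)[of "of_real x"] unfolding set_integrable_def by (rule integrable_norm)
      show "AE s in lborel. norm (indicat_real (?S (X n)) s *\<^sub>R reg_kernel p r (of_real x) s) \<le> norm (indicat_real {0<..} s *\<^sub>R reg_kernel p r (of_real x) s)" for n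
        by (rule AE_I2) (auto simp: indicator_def)
      show "AE s in lborel. (\<lambda>n. indicat_real (?S (X n)) s *\<^sub>R reg_kernel p r (of_real x) s) \<longlonglongrightarrow> indicat_real {0<..} s *\<^sub>R reg_kernel p r (of_real x) s"
        using AE_lborel_singleton[of x]
      proof eventually_elim
        case (elim s)
        then have "\<forall>\<^sub>F n in sequentially. X n < \<bar>s - x\<bar>"
          using X(2) by (intro order_tendstoD(2)) auto
        then have "\<forall>\<^sub>F n in sequentially. indicat_real (?S (X n)) s *\<^sub>R reg_kernel p r (of_real x) s = indicat_real {0<..} s *\<^sub>R reg_kernel p r (of_real x) s"
          by eventually_elim (auto simp: indicator_def)
        then show ?case by (rule tendsto_eventually)
      qed
    qed
    then show "(\<lambda>n. LBINT s:?S (X n). reg_kernel p r (of_real x) s) \<longlonglongrightarrow> cauchy_reg p r (of_real x)"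
      by (simp only: reg_kernel_integral(2))
  qed
  have l2: "(?L \<longlongrightarrow> - ln x) (at_right 0)"
  proof -
    have "isCont ?L 0" using x by (intro continuous_intros) auto
    then have "(?L \<longlongrightarrow> ?L 0) (at_right 0)" unfolding isCont_def by (rule tendsto_within_subset) simp
    then show ?thesis by simp
  qed
  have ev: "\<forall>\<^sub>F e in at_right 0. (LBINT s:?S e. reg_kernel p r (of_real x) s) + ratio p r (of_real x) * of_real (?L e)
     = (LBINT s:?S e. ratio p r (of_real s) / of_real (s - x))"
    by (rule eventually_at_rightI[of 0 x]) (use main x in auto)
  have "((\<lambda>e. LBINT s:?S e. ratio p r (of_real s) / of_real (s - x)) \<longlongrightarrow>
     cauchy_reg p r (of_real x) + ratio p r (of_real x) * of_real (- ln x)) (at_right 0)"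
    by (rule tendsto_cong[THEN iffD1, OF ev]) (intro tendsto_intros l1 l2)
  then show ?thesis by (simp add: mult.commute)
qed

end

section \<open>Matrix functions on a sector\<close>

lemma matrix_inv_mult:
  fixes A :: "'a::field^'n^'n"
  assumes "det A \<noteq> 0"
  shows "A ** matrix_inv A = mat 1" "matrix_inv A ** A = mat 1"
proof -
  have "\<exists>A'. A ** A' = mat 1 \<and> A' ** A = mat 1"
    using assms invertible_det_nz[of A] by (simp add: invertible_def)
  from someI_ex[OF this] show "A ** matrix_inv A = mat 1" "matrix_inv A ** A = mat 1"
    by (simp_all add: matrix_inv_def)
qed

lemma matrix_inv_solve:
  fixes A :: "'a::field^'n^'n"
  assumes "det A \<noteq> 0"
  shows "A *v x = y \<longleftrightarrow> x = matrix_inv A *v y"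
proof
  assume h: "A *v x = y"
  have "matrix_inv A *v y = (matrix_inv A ** A) *v x" by (simp only: matrix_vector_mul_assoc[symmetric] h)
  then show "x = matrix_inv A *v y" by (simp add: matrix_inv_mult[OF assms])
next
  assume h: "x = matrix_inv A *v y"
  have "A *v x = (A ** matrix_inv A) *v y" by (simp only: matrix_vector_mul_assoc[symmetric] h)
  then show "A *v x = y" by (simp add: matrix_inv_mult[OF assms])
qed

text \<open>Cramer's rule for a unit vector. Entries of the inverse become quotients of
  determinants, so limits, continuity and holomorphy of inverses reduce to finite sums and
  products.\<close>

lemma matrix_inv_entry:
  fixes A :: "'a::field^'n^'n"
  assumes "det A \<noteq> 0"
  shows "matrix_inv A $ i $ j = det (\<chi> a b. if b = i then (if a = j then 1 else 0) else A $ a $ b) / det A"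
proof -
  define e :: "'a^'n" where "e = (\<chi> a. if a = j then 1 else 0)"
  have "(matrix_inv A *v e) $ i = matrix_inv A $ i $ j"
    by (simp add: e_def matrix_vector_mult_def if_distrib[of "(*) _"] cong: if_cong)
  moreover have "matrix_inv A *v e = (\<chi> k. det (\<chi> a b. if b = k then e $ a else A $ a $ b) / det A)"
    using cramer[OF assms, of "matrix_inv A *v e" e] matrix_inv_solve[OF assms] by blast
  ultimately have "matrix_inv A $ i $ j = det (\<chi> a b. if b = i then e $ a else A $ a $ b) / det A"
    by simp
  then show ?thesis by (simp add: e_def cong: if_cong)
qed

lemma det_nonzeroI:
  fixes A :: "'a::field^'n^'n"
  assumes "\<And>x. A *v x = 0 \<Longrightarrow> x = 0"
  shows "det A \<noteq> 0"
proof -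
  obtain B where "B ** A = mat 1" using matrix_left_invertible_ker[of A] assms by auto
  then have "invertible A" using matrix_left_right_inverse[of B A] by (auto simp: invertible_def)
  then show ?thesis by (simp add: invertible_det_nz)
qed

lemma tendsto_det:
  fixes A :: "'b \<Rightarrow> complex^'n^'n"
  assumes "\<And>i j. ((\<lambda>z. A z $ i $ j) \<longlongrightarrow> B $ i $ j) F"
  shows "((\<lambda>z. det (A z)) \<longlongrightarrow> det B) F"
  unfolding det_def by (intro tendsto_sum tendsto_mult tendsto_const tendsto_prod assms)

lemma holomorphic_on_det:
  fixes A :: "complex \<Rightarrow> complex^'n^'n"
  assumes "\<And>i j. (\<lambda>z. A z $ i $ j) holomorphic_on S"
  shows "(\<lambda>z. det (A z)) holomorphic_on S"
  unfolding det_def by (intro holomorphic_intros assms)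

lemma tendsto_matrix_inv:
  fixes A :: "'b \<Rightarrow> complex^'n^'n"
  assumes A: "\<And>i j. ((\<lambda>z. A z $ i $ j) \<longlongrightarrow> B $ i $ j) F" and B: "det B \<noteq> 0"
  shows "((\<lambda>z. matrix_inv (A z) $ i $ j) \<longlongrightarrow> matrix_inv B $ i $ j) F"
proof -
  have "((\<lambda>z. det (\<chi> a b. if b = i then (if a = j then 1 else 0) else A z $ a $ b) / det (A z)) \<longlongrightarrow>
    det (\<chi> a b. if b = i then (if a = j then 1 else 0) else B $ a $ b) / det B) F"
    by (intro tendsto_divide tendsto_det B) (auto intro: A)
  moreover have "\<forall>\<^sub>F z in F. det (A z) \<noteq> 0"
    using tendsto_imp_eventually_ne[OF tendsto_det[OF A] B] .
  then have "\<forall>\<^sub>F z in F. det (\<chi> a b. if b = i then (if a = j then 1 else 0) else A z $ a $ b) / det (A z) = matrix_inv (A z) $ i $ j"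
    by eventually_elim (simp add: matrix_inv_entry)
  ultimately show ?thesis using B by (simp add: matrix_inv_entry tendsto_cong)
qed

lemma continuous_on_matrix_inv:
  fixes A :: "'b::topological_space \<Rightarrow> complex^'n^'n"
  assumes "\<And>i j. continuous_on S (\<lambda>z. A z $ i $ j)" "\<And>z. z \<in> S \<Longrightarrow> det (A z) \<noteq> 0"
  shows "continuous_on S (\<lambda>z. matrix_inv (A z) $ i $ j)"
  using assms unfolding continuous_on_def by (blast intro: tendsto_matrix_inv)

lemma holomorphic_on_matrix_inv:
  fixes A :: "complex \<Rightarrow> complex^'n^'n"
  assumes A: "\<And>i j. (\<lambda>z. A z $ i $ j) holomorphic_on S" and nz: "\<And>z. z \<in> S \<Longrightarrow> det (A z) \<noteq> 0"
  shows "(\<lambda>z. matrix_inv (A z) $ i $ j) holomorphic_on S"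
proof (rule holomorphic_transform)
  show "(\<lambda>z. det (\<chi> a b. if b = i then (if a = j then 1 else 0) else A z $ a $ b) / det (A z)) holomorphic_on S"
  proof (intro holomorphic_on_divide holomorphic_on_det nz A)
    fix a b
    show "(\<lambda>z. (\<chi> a b. if b = i then (if a = j then 1 else 0) else A z $ a $ b) $ a $ b) holomorphic_on S"
      using A by (cases "b = i") auto
  qed
qed (simp add: matrix_inv_entry nz)

text \<open>The resolvent identity. It serves both the jump of the resolvent across the axis and its
  distance from the inverse of K(0).\<close>

lemma matrix_inv_diff:
  fixes A B :: "'a::field^'n^'n"
  assumes "det A \<noteq> 0" "det B \<noteq> 0"
  shows "matrix_inv A - matrix_inv B = matrix_inv A ** (B - A) ** matrix_inv B"
proof -
  have "matrix_inv A ** (B - A) = matrix_inv A ** B - mat 1"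
    using matrix_inv_mult[OF assms(1)]
    by (simp add: vec_eq_iff matrix_matrix_mult_def right_diff_distrib sum_subtractf)
  then have "matrix_inv A ** (B - A) ** matrix_inv B = matrix_inv A ** B ** matrix_inv B - matrix_inv B"
    by (simp add: vec_eq_iff matrix_matrix_mult_def left_diff_distrib sum_subtractf mat_def if_distrib[of "\<lambda>u. u * _"] cong: if_cong)
  then show ?thesis using matrix_inv_mult[OF assms(2)] by (simp add: matrix_mul_assoc[symmetric])
qed

lemma triple_product_entry:
  fixes A B C :: "'a::comm_semiring_1^'n^'n"
  shows "(A ** B ** C) $ i $ j = (\<Sum>a\<in>UNIV. \<Sum>b\<in>UNIV. A $ i $ a * B $ a $ b * C $ b $ j)"
proof -
  have "(A ** B ** C) $ i $ j = (\<Sum>b\<in>UNIV. \<Sum>a\<in>UNIV. A $ i $ a * B $ a $ b * C $ b $ j)"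
    by (simp add: matrix_matrix_mult_def sum_distrib_right)
  then show ?thesis using sum.swap by (simp only:)
qed

text \<open>A differs from -z times the identity by entries of size at most \<kappa>; in the l1 norm
  this perturbation costs at most N\<kappa>, that is half of |z|. The result is invertibility and a
  bound on the inverse far from the origin.\<close>

lemma shifted_matrix_lower_bound:
  fixes A :: "complex^'n^'n"
  assumes K: "\<And>i j. norm (A $ i $ j + (if i = j then z else 0)) \<le> \<kappa>" and z: "real CARD('n) * \<kappa> \<le> norm z / 2"
  shows "norm z / 2 * (\<Sum>i\<in>UNIV. norm (x $ i)) \<le> (\<Sum>i\<in>UNIV. norm ((A *v x) $ i))"
proof -
  let ?s = "\<Sum>j\<in>UNIV. norm (x $ j)"
  have "norm z * norm (x $ i) \<le> norm ((A *v x) $ i) + \<kappa> * ?s" for i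
  proof -
    have "z * x $ i = (\<Sum>j\<in>UNIV. (A $ i $ j + (if i = j then z else 0)) * x $ j) - (A *v x) $ i"
      by (simp add: matrix_vector_mult_def distrib_right sum.distrib if_distrib[of "\<lambda>u. u * _"] cong: if_cong)
    then have "norm (z * x $ i) \<le> norm (\<Sum>j\<in>UNIV. (A $ i $ j + (if i = j then z else 0)) * x $ j) + norm ((A *v x) $ i)"
      by (simp only: norm_triangle_ineq4)
    also have "norm (\<Sum>j\<in>UNIV. (A $ i $ j + (if i = j then z else 0)) * x $ j) \<le> (\<Sum>j\<in>UNIV. \<kappa> * norm (x $ j))"
      by (rule order_trans[OF norm_sum], rule sum_mono, unfold norm_mult, rule mult_right_mono[OF K norm_ge_zero])
    finally show ?thesis by (simp add: norm_mult sum_distrib_left)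
  qed
  then have "(\<Sum>i\<in>UNIV. norm z * norm (x $ i)) \<le> (\<Sum>i\<in>UNIV. norm ((A *v x) $ i) + \<kappa> * ?s)"
    by (intro sum_mono)
  then have "norm z * ?s \<le> (\<Sum>i\<in>UNIV. norm ((A *v x) $ i)) + real CARD('n) * \<kappa> * ?s"
    by (simp add: sum.distrib sum_distrib_left[symmetric])
  moreover have "real CARD('n) * \<kappa> * ?s \<le> norm z / 2 * ?s"
    by (intro mult_right_mono z sum_nonneg) auto
  ultimately show ?thesis by simp
qed

section \<open>Sectors around the positive half line and holomorphy of Cauchy transforms\<close>

definition sector :: "real \<Rightarrow> complex set" where
  "sector \<tau> = {z. \<bar>Im z\<bar> \<le> \<tau> * Re z}"

lemma closed_sector: "closed (sector \<tau>)"
  unfolding sector_def by (intro closed_Collect_le continuous_intros)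

lemma sector_Re_pos:
  assumes "0 < \<tau>" "z \<in> sector \<tau>" "z \<noteq> 0"
  shows "0 < Re z"
proof -
  have "0 \<le> \<tau> * Re z" using assms(2) by (auto simp: sector_def)
  then have "0 \<le> Re z" using assms(1) by (simp add: zero_le_mult_iff)
  moreover have "Re z \<noteq> 0" using assms by (auto simp: sector_def complex_eq_iff)
  ultimately show ?thesis by simp
qed

lemma sector_mono:
  assumes "0 < \<sigma>" "\<sigma> \<le> \<tau>" shows "sector \<sigma> \<subseteq> sector \<tau>"
proof
  fix z assume z: "z \<in> sector \<sigma>"
  have "0 \<le> Re z" using sector_Re_pos[OF assms(1) z] by (cases "z = 0") auto
  then have "\<sigma> * Re z \<le> \<tau> * Re z" using assms by (intro mult_right_mono)
  then show "z \<in> sector \<tau>" using z by (auto simp: sector_def)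
qed

lemma zero_in_sector [simp]: "0 \<in> sector \<tau>" by (simp add: sector_def)

lemma of_real_in_sector: "0 \<le> \<tau> \<Longrightarrow> 0 \<le> x \<Longrightarrow> of_real x \<in> sector \<tau>" by (simp add: sector_def)

lemma lower_wedge_subset_sector: "0 < \<tau> \<Longrightarrow> lower_wedge \<tau> \<subseteq> sector \<tau>"
  by (auto simp: lower_wedge_def sector_def)

text \<open>Moduli between \<delta> and R are handled by compactness: a segment of the axis has a
  uniform neighbourhood inside the good set, and a flat enough sector stays in it there. The two
  ends of the axis offer no compactness, hence the hypotheses \<open>near\<close> and
  \<open>far\<close>.\<close>

lemma sector_nonvanishing:
  fixes \<phi> :: "complex \<Rightarrow> complex"
  assumes U: "open U" and cont: "continuous_on U \<phi>"
    and pos: "\<And>x. 0 < x \<Longrightarrow> of_real x \<in> U \<and> \<phi> (of_real x) \<noteq> 0"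
    and near: "\<And>z. z \<in> sector 1 \<Longrightarrow> z \<noteq> 0 \<Longrightarrow> norm z < \<delta> \<Longrightarrow> z \<in> U \<and> \<phi> z \<noteq> 0" and \<delta>: "0 < \<delta>"
    and far: "\<And>z. z \<in> sector 1 \<Longrightarrow> R \<le> norm z \<Longrightarrow> z \<in> U \<and> \<phi> z \<noteq> 0"
  obtains \<tau> where "0 < \<tau>" "\<tau> \<le> 1" "\<And>z. z \<in> sector \<tau> \<Longrightarrow> z \<noteq> 0 \<Longrightarrow> z \<in> U \<and> \<phi> z \<noteq> 0"
proof -
  define V where "V = U \<inter> \<phi> -` (- {0})"
  have "open V" unfolding V_def by (rule continuous_open_preimage[OF cont U]) (simp add: open_Compl)
  define Q where "Q = max R \<delta>"
  have Q: "0 < Q" using \<delta> by (simp add: Q_def)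
  have "compact (complex_of_real ` {\<delta> / 2..Q})" by (intro compact_continuous_image continuous_intros) simp
  moreover have "complex_of_real ` {\<delta> / 2..Q} \<subseteq> V" using pos \<delta> by (auto simp: V_def)
  ultimately obtain e where e: "0 < e" "(\<Union>x\<in>complex_of_real ` {\<delta> / 2..Q}. ball x e) \<subseteq> V"
    using compact_subset_open_imp_ball_epsilon_subset[OF _ \<open>open V\<close>] by metis
  \<comment> \<open>A point of this sector with Re z \<le> Q has distance |Im z| \<le> \<tau>Q < e
    from its real part. The segment begins at \<delta>/2 because |z| \<le> 2 Re z in the unit
    sector.\<close>
  define \<tau> where "\<tau> = min 1 (e / (2 * Q))"
  have \<tau>: "0 < \<tau>" "\<tau> \<le> 1" using e Q by (auto simp: \<tau>_def)
  show ?thesis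
  proof (rule that[OF \<tau>])
    fix z assume z: "z \<in> sector \<tau>" "z \<noteq> 0"
    have z1: "z \<in> sector 1" using sector_mono[OF \<tau>] z by auto
    have Re: "0 < Re z" by (rule sector_Re_pos[OF \<tau>(1) z])
    consider "norm z < \<delta>" | "R \<le> norm z" | "\<delta> \<le> norm z" "norm z < R" by linarith
    then show "z \<in> U \<and> \<phi> z \<noteq> 0"
    proof cases
      case 3
      have im: "\<bar>Im z\<bar> \<le> \<tau> * Re z" using z by (simp add: sector_def)
      have "\<tau> * Re z \<le> 1 * Re z" using \<tau> Re by (intro mult_right_mono) auto
      then have "norm z \<le> 2 * Re z" using cmod_le[of z] im Re by linarith
      then have lo: "\<delta> / 2 \<le> Re z" using 3 by linarith
      have hi: "Re z \<le> Q" using complex_Re_le_cmod[of z] 3 by (simp add: Q_def)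
      have "dist (of_real (Re z)) z = \<bar>Im z\<bar>"
        by (simp add: dist_norm cmod_def)
      also have "\<dots> \<le> \<tau> * Re z" by (rule im)
      also have "\<dots> \<le> (e / (2 * Q)) * Q" using hi Re \<tau> by (intro mult_mono) (auto simp: \<tau>_def)
      also have "\<dots> < e" using Q e by simp
      finally have "z \<in> ball (of_real (Re z)) e" by simp
      moreover have "of_real (Re z) \<in> complex_of_real ` {\<delta> / 2..Q}" using lo hi by simp
      ultimately have "z \<in> V" using e(2) by blast
      then show ?thesis by (auto simp: V_def)
    qed (use near far z1 z in auto)
  qed
qed

text \<open>Differentiation under the integral with the explicit remainder (y - z) times the
  integral of h/((s - y)(s - z)^2), bounded through the distance d = Im z/2. It gives holomorphy of
  the self energy at every point of the upper half plane, whereas the closed form is available only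
  where the denominator does not vanish.\<close>

lemma cauchy_transform_holomorphic:
  fixes h :: "real \<Rightarrow> complex"
  assumes h: "set_integrable lborel {0<..} h"
  shows "(\<lambda>z. LBINT s:{0<..}. h s / (of_real s - z)) holomorphic_on {z. 0 < Im z}"
proof -
  define H where "H s = indicat_real {0<..} s *\<^sub>R h s" for s
  have Hi: "integrable lborel H" using h by (simp add: H_def[abs_def] set_integrable_def)
  then have Hm: "H \<in> borel_measurable borel" by auto
  have eq: "(LBINT s:{0<..}. h s / (of_real s - z)) = (LBINT s. H s / (of_real s - z))" for z
    by (simp add: set_lebesgue_integral_def H_def scaleR_conv_of_real)
  have lower: "Im z \<le> norm (complex_of_real s - z)" for s z
    using abs_Im_le_cmod[of "complex_of_real s - z"] by simp
  have i1: "integrable lborel (\<lambda>s. H s * k s)" if k: "k \<in> borel_measurable borel" "\<And>s. norm (k s) \<le> B" for k B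
  proof (rule Bochner_Integration.integrable_bound)
    show "integrable lborel (\<lambda>s. B * norm (H s))" using Hi by simp
    show "(\<lambda>s. H s * k s) \<in> borel_measurable lborel" using Hm k by simp
    have "0 \<le> B" using norm_ge_zero k(2) order_trans by blast
    then show "AE s in lborel. norm (H s * k s) \<le> norm (B * norm (H s))"
      using k(2) by (intro AE_I2) (simp add: norm_mult mult.commute[of B] mult_left_mono)
  qed
  have "((\<lambda>z. LBINT s. H s / (of_real s - z)) has_field_derivative (LBINT s. H s / (of_real s - z)\<^sup>2)) (at z)" if z: "0 < Im z" for z
    unfolding has_field_derivative_iff
  proof (rule LIM_zero_cancel, rule Lim_null_comparison)
    define d where "d = Im z / 2"
    have d: "0 < d" using z by (simp add: d_def)
    define N where "N = (LBINT s. norm (H s))"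
    have "\<forall>\<^sub>F y in at z. dist y z < d" using d by (simp add: eventually_at) (auto intro: exI[of _ d])
    moreover have "\<forall>\<^sub>F y in at z. y \<noteq> z" by (simp add: eventually_at_filter)
    ultimately show "\<forall>\<^sub>F y in at z. norm (((LBINT s. H s / (of_real s - y)) - (LBINT s. H s / (of_real s - z))) / (y - z) - (LBINT s. H s / (of_real s - z)\<^sup>2)) \<le> norm (y - z) * (N / d ^ 3)"
    proof eventually_elim
      case (elim y)
      have imy: "d \<le> Im y"
        using elim(1) abs_Im_le_cmod[of "y - z"] by (simp add: d_def dist_norm abs_if split: if_splits)
      have ny: "d \<le> norm (complex_of_real s - y)" and nz: "d \<le> norm (complex_of_real s - z)" for s
        using lower[of y s] lower[of z s] imy d by (auto simp: d_def)
      have zy: "complex_of_real s - y \<noteq> 0" "complex_of_real s - z \<noteq> 0" for s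
        using ny[of s] nz[of s] d by auto
      have k1: "norm (1 / (complex_of_real s - y)) \<le> 1 / d" "norm (1 / (complex_of_real s - z)) \<le> 1 / d" for s
        unfolding norm_divide using ny[of s] nz[of s] d by (auto intro!: divide_left_mono mult_pos_pos)
      have k2: "norm (1 / (complex_of_real s - z)\<^sup>2) \<le> 1 / d\<^sup>2" for s
        unfolding norm_divide norm_power using nz[of s] d by (auto intro!: divide_left_mono mult_pos_pos power_mono)
      have k3: "norm (1 / ((complex_of_real s - y) * (complex_of_real s - z)\<^sup>2)) \<le> 1 / d ^ 3" for s
      proof -
        have "d * d\<^sup>2 \<le> norm (complex_of_real s - y) * (norm (complex_of_real s - z))\<^sup>2"
          using ny[of s] nz[of s] d by (intro mult_mono power_mono) auto
        then have "1 / (norm (complex_of_real s - y) * (norm (complex_of_real s - z))\<^sup>2) \<le> 1 / (d * d\<^sup>2)"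
          using d ny[of s] nz[of s] by (intro divide_left_mono mult_pos_pos zero_less_power) auto
        then show ?thesis by (simp add: norm_divide norm_mult norm_power power2_eq_square power3_eq_cube mult.assoc)
      qed
      have I: "integrable lborel (\<lambda>s. H s / (of_real s - y))" "integrable lborel (\<lambda>s. H s / (of_real s - z))"
        "integrable lborel (\<lambda>s. H s / (of_real s - z)\<^sup>2)"
        "integrable lborel (\<lambda>s. H s / ((of_real s - y) * (of_real s - z)\<^sup>2))"
        using i1[OF _ k1(1)] i1[OF _ k1(2)] i1[OF _ k2] i1[OF _ k3] by auto
      have "((LBINT s. H s / (of_real s - y)) - (LBINT s. H s / (of_real s - z))) / (y - z) - (LBINT s. H s / (of_real s - z)\<^sup>2)
        = (LBINT s. (H s / (of_real s - y) - H s / (of_real s - z)) / (y - z) - H s / (of_real s - z)\<^sup>2)"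
        using I by simp
      also have "\<dots> = (LBINT s. (y - z) * (H s / ((of_real s - y) * (of_real s - z)\<^sup>2)))"
      proof (rule Bochner_Integration.integral_cong[OF refl])
        fix s
        have yz: "y - z \<noteq> 0" using elim by simp
        have *: "(b / p - b / q) / (q - p) - b / q\<^sup>2 = (q - p) * (b / (p * q\<^sup>2))" if "p \<noteq> 0" "q \<noteq> 0" "q - p \<noteq> 0" for b p q :: complex
          using that by (simp add: divide_simps) (simp add: algebra_simps power2_eq_square)
        show "(H s / (of_real s - y) - H s / (of_real s - z)) / (y - z) - H s / (of_real s - z)\<^sup>2 = (y - z) * (H s / ((of_real s - y) * (of_real s - z)\<^sup>2))"
          using *[OF zy[of s], of "H s"] yz by simp
      qed
      also have "norm \<dots> \<le> norm (y - z) * (N / d ^ 3)"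
      proof -
        have "norm (LBINT s. H s / ((of_real s - y) * (of_real s - z)\<^sup>2)) \<le> (LBINT s. norm (H s) / d ^ 3)"
        proof (rule Bochner_Integration.integral_norm_bound_integral)
          show "integrable lborel (\<lambda>s. norm (H s) / d ^ 3)" using Hi by simp
          fix s show "norm (H s / ((of_real s - y) * (of_real s - z)\<^sup>2)) \<le> norm (H s) / d ^ 3"
            using mult_left_mono[OF k3[of s] norm_ge_zero[of "H s"]] by (simp add: norm_divide)
        qed (rule I(4))
        then have "norm (LBINT s. H s / ((of_real s - y) * (of_real s - z)\<^sup>2)) \<le> N / d ^ 3" by (simp add: N_def)
        then show ?thesis unfolding integral_mult_right_zero norm_mult by (rule mult_left_mono) simp
      qed
      finally show ?case .
    qed
    show "((\<lambda>y. norm (y - z) * (N / d ^ 3)) \<longlongrightarrow> 0) (at z)"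
      by (rule tendsto_eq_intros refl)+ simp
  qed
  then show ?thesis
    unfolding eq by (intro holomorphic_onI) (auto simp: field_differentiable_def intro: has_field_derivative_at_within)
qed

section \<open>The resolvent of the model\<close>

lemma Im_set_integral:
  fixes f :: "real \<Rightarrow> complex"
  assumes "set_integrable M A f"
  shows "set_integrable M A (\<lambda>s. Im (f s))" "Im (LINT s:A|M. f s) = (LINT s:A|M. Im (f s))"
proof -
  have i: "integrable M (\<lambda>s. indicat_real A s *\<^sub>R f s)" using assms by (simp add: set_integrable_def)
  have e: "Im (indicat_real A s *\<^sub>R f s) = indicat_real A s *\<^sub>R Im (f s)" for s by simp
  show "set_integrable M A (\<lambda>s. Im (f s))"
    using integrable_bounded_linear[OF bounded_linear_Im i] by (simp only: e set_integrable_def)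
  show "Im (LINT s:A|M. f s) = (LINT s:A|M. Im (f s))"
    using integral_bounded_linear[OF bounded_linear_Im i] by (simp only: e set_lebesgue_integral_def)
qed

lemma set_integrable_sum:
  fixes f :: "'i \<Rightarrow> 'a \<Rightarrow> 'b::{banach, second_countable_topology}"
  assumes "\<And>i. i \<in> I \<Longrightarrow> set_integrable M A (f i)"
  shows "set_integrable M A (\<lambda>x. \<Sum>i\<in>I. f i x)" "(LINT x:A|M. (\<Sum>i\<in>I. f i x)) = (\<Sum>i\<in>I. LINT x:A|M. f i x)"
proof -
  have e: "indicat_real A x *\<^sub>R (\<Sum>i\<in>I. f i x) = (\<Sum>i\<in>I. indicat_real A x *\<^sub>R f i x)" for x
    by (rule scaleR_right.sum)
  show "set_integrable M A (\<lambda>x. \<Sum>i\<in>I. f i x)"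
    using assms unfolding set_integrable_def e by (intro Bochner_Integration.integrable_sum) auto
  show "(LINT x:A|M. (\<Sum>i\<in>I. f i x)) = (\<Sum>i\<in>I. LINT x:A|M. f i x)"
    using assms unfolding set_lebesgue_integral_def set_integrable_def e by (intro Bochner_Integration.integral_sum) auto
qed

lemma set_integrable_bound_borel:
  fixes f :: "real \<Rightarrow> complex" and g :: "real \<Rightarrow> real"
  assumes "set_integrable lborel A g" "f \<in> borel_measurable borel" "A \<in> sets borel"
    and "\<And>s. s \<in> A \<Longrightarrow> norm (f s) \<le> g s"
  shows "set_integrable lborel A f"
  unfolding set_integrable_def
proof (rule Bochner_Integration.integrable_bound)
  show "integrable lborel (\<lambda>s. indicat_real A s *\<^sub>R g s)" using assms(1) by (simp add: set_integrable_def)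
  show "(\<lambda>s. indicat_real A s *\<^sub>R f s) \<in> borel_measurable lborel" using assms by simp
  show "AE s in lborel. norm (indicat_real A s *\<^sub>R f s) \<le> norm (indicat_real A s *\<^sub>R g s)"
    using assms(4) by (intro AE_I2) (auto simp: indicator_def intro: order_trans[OF _ abs_ge_self])
qed

locale friedrichs =
  fixes w :: "'n::finite \<Rightarrow> real" and lam :: real
    and v :: "'n \<Rightarrow> real \<Rightarrow> complex"
    and pp rr :: "'n \<Rightarrow> 'n \<Rightarrow> complex poly"
  assumes lam_nz: "lam \<noteq> 0"
    and v_meas: "\<forall>n. v n \<in> borel_measurable lborel"
    and v_L2: "\<forall>n. set_integrable lborel {0<..} (\<lambda>x. (cmod (v n x))\<^sup>2)"
    and ff: "\<forall>m n. AE x in lborel. 0 < x \<longrightarrow>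
               cnj (v m x) * v n x = poly (pp m n) (complex_of_real x) / poly (rr m n) (complex_of_real x)"
    and ff_deg: "\<forall>m n. degree (pp m n) + 2 \<le> degree (rr m n)"
    and ff_nz: "\<forall>m n. \<forall>x::real. 0 \<le> x \<longrightarrow> poly (rr m n) (complex_of_real x) \<noteq> 0"
    and ff_0: "\<forall>m n. poly (pp m n) 0 = 0"
begin

sublocale ff: form_factor "pp m n" "rr m n" for m n
  using ff_deg ff_nz ff_0 by unfold_locales auto

lemma v_borel [measurable]: "v n \<in> borel_measurable borel"
  using v_meas by simp

lemma cnj_v_borel [measurable]: "(\<lambda>x. cnj (v n x)) \<in> borel_measurable borel"
  by (rule measurable_compose[OF v_borel]) (intro borel_measurable_continuous_onI continuous_intros)

lemma Gam_eq_ratio: "Gam pp rr z m n = ratio (pp m n) (rr m n) z"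
  by (simp add: Gam_def ratio_def)

lemma norm_vv_le: "norm (cnj (v m s) * v n s) \<le> (norm (v m s))\<^sup>2 + (norm (v n s))\<^sup>2"
proof -
  have "2 * (norm (v m s) * norm (v n s)) \<le> (norm (v m s))\<^sup>2 + (norm (v n s))\<^sup>2"
    using sum_squares_bound[of "norm (v m s)" "norm (v n s)"] by (simp add: mult.assoc)
  moreover have "0 \<le> norm (v m s) * norm (v n s)" by simp
  moreover have "norm (cnj (v m s) * v n s) = norm (v m s) * norm (v n s)" by (simp add: norm_mult)
  ultimately show ?thesis by linarith
qed

lemma vv_div_integrable:
  assumes "k \<in> borel_measurable borel" "\<And>s. s \<in> {0<..} \<Longrightarrow> norm (k s) \<le> B"
  shows "set_integrable lborel {0<..} (\<lambda>s. cnj (v m s) * v n s * k s)"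
proof (rule set_integrable_bound_borel)
  show "set_integrable lborel {0<..} (\<lambda>s. B * ((norm (v m s))\<^sup>2 + (norm (v n s))\<^sup>2))"
    using v_L2 by (intro set_integrable_mult_right set_integral_add) auto
  show "(\<lambda>s. cnj (v m s) * v n s * k s) \<in> borel_measurable borel" using assms(1) by measurable
  fix s :: real assume s: "s \<in> {0<..}"
  have "norm (cnj (v m s) * v n s) * norm (k s) \<le> ((norm (v m s))\<^sup>2 + (norm (v n s))\<^sup>2) * B"
    by (intro mult_mono norm_vv_le assms s) (auto intro: add_nonneg_nonneg)
  then show "norm (cnj (v m s) * v n s * k s) \<le> B * ((norm (v m s))\<^sup>2 + (norm (v n s))\<^sup>2)"
    by (simp add: norm_mult mult.commute)
qed simp

lemma vv_cauchy_integrable: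
  assumes "Im z \<noteq> 0"
  shows "set_integrable lborel {0<..} (\<lambda>s. cnj (v m s) * v n s / (of_real s - z))"
  using vv_div_integrable[of "\<lambda>s. 1 / (of_real s - z)", OF _ norm_stieltjes_kernel_le[OF assms]] by simp

text \<open>The rational form of the products holds almost everywhere only, which suffices under an
  integral.\<close>

lemma vv_ratio_cong:
  assumes "A \<subseteq> {0<..}" "A \<in> sets borel" "k \<in> borel_measurable borel"
  shows "(LBINT s:A. cnj (v m s) * v n s / k s) = (LBINT s:A. ratio (pp m n) (rr m n) (of_real s) / k s)"
  unfolding set_lebesgue_integral_def
proof (rule integral_cong_AE)
  have pm: "(\<lambda>s. poly q (complex_of_real s)) \<in> borel_measurable borel" for q
    by (intro borel_measurable_continuous_onI continuous_intros)
  show "(\<lambda>s. indicat_real A s *\<^sub>R (cnj (v m s) * v n s / k s)) \<in> borel_measurable lborel"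
    using assms by simp
  show "(\<lambda>s. indicat_real A s *\<^sub>R (ratio (pp m n) (rr m n) (of_real s) / k s)) \<in> borel_measurable lborel"
    using assms pm by (simp add: ratio_def)
  show "AE s in lborel. indicat_real A s *\<^sub>R (cnj (v m s) * v n s / k s) =
      indicat_real A s *\<^sub>R (ratio (pp m n) (rr m n) (of_real s) / k s)"
    using ff[rule_format, of m n]
  proof eventually_elim
    case (elim s)
    then show ?case using assms(1) by (cases "s \<in> A") (auto simp: ratio_def)
  qed
qed

lemma self_energy_eq:
  "self_energy v z m n = (LBINT s:{0<..}. ratio (pp m n) (rr m n) (of_real s) / (of_real s - z))"
  unfolding self_energy_def by (rule vv_ratio_cong) auto

definition Mmat :: "complex \<Rightarrow> complex^'n^'n" where
  "Mmat z = (\<chi> i j. Kmat w lam v z $ i $ j - (if i = j then z else 0))"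

lemma Mmat_entry: "Mmat z $ i $ j = (if i = j then of_real (w i) - z else 0) - of_real (lam\<^sup>2) * self_energy v z i j"
  by (simp add: Mmat_def Kmat_def)

text \<open>For each s the matrix with entries cnj(v_i) v_j has rank at most one, so the quadratic
  form of S is the transform of a nonnegative density.\<close>

lemma quadratic_form_self_energy:
  assumes z: "Im z \<noteq> 0"
  shows "set_integrable lborel {0<..} (\<lambda>s. of_real ((cmod (\<Sum>k\<in>UNIV. c$k * v k s))\<^sup>2) / (of_real s - z))"
    and "(\<Sum>i\<in>UNIV. \<Sum>j\<in>UNIV. cnj (c$i) * c$j * self_energy v z i j) =
      (LBINT s:{0<..}. of_real ((cmod (\<Sum>k\<in>UNIV. c$k * v k s))\<^sup>2) / (of_real s - z))"
proof -
  have e: "of_real ((cmod (\<Sum>k\<in>UNIV. c$k * v k s))\<^sup>2) / (of_real s - z) =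
      (\<Sum>i\<in>UNIV. \<Sum>j\<in>UNIV. (cnj (c$i) * c$j) * (cnj (v i s) * v j s / (of_real s - z)))" for s
  proof -
    have "complex_of_real ((cmod (\<Sum>k\<in>UNIV. c$k * v k s))\<^sup>2) = cnj (\<Sum>i\<in>UNIV. c$i * v i s) * (\<Sum>j\<in>UNIV. c$j * v j s)"
      by (subst complex_norm_square, rule mult.commute)
    also have "\<dots> = (\<Sum>i\<in>UNIV. \<Sum>j\<in>UNIV. (cnj (c$i) * c$j) * (cnj (v i s) * v j s))"
      by (subst cnj_sum, subst sum_product) (simp add: mult_ac)
    finally show ?thesis by (simp add: sum_divide_distrib)
  qed
  have i: "set_integrable lborel {0<..} (\<lambda>s. (cnj (c$i) * c$j) * (cnj (v i s) * v j s / (of_real s - z)))" for i j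
    by (intro set_integrable_mult_right vv_cauchy_integrable z)
  show "set_integrable lborel {0<..} (\<lambda>s. of_real ((cmod (\<Sum>k\<in>UNIV. c$k * v k s))\<^sup>2) / (of_real s - z))"
    unfolding e by (intro set_integrable_sum(1) i)
  show "(\<Sum>i\<in>UNIV. \<Sum>j\<in>UNIV. cnj (c$i) * c$j * self_energy v z i j) =
      (LBINT s:{0<..}. of_real ((cmod (\<Sum>k\<in>UNIV. c$k * v k s))\<^sup>2) / (of_real s - z))"
    unfolding e by (subst set_integrable_sum(2), intro set_integrable_sum(1) i, subst set_integrable_sum(2), rule i)
      (simp only: set_integral_mult_right self_energy_def)
qed

text \<open>\<open>Q\<close> is the integral of the density |\<Sum> c_k v_k|^2 divided by |s - z|^2.
  Both contributions to the imaginary part have the sign opposite to Im z; this is the source of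
  invertibility, of the Herglotz property and of the a priori bound on the resolvent.\<close>

lemma numerical_range:
  assumes z: "Im z \<noteq> 0"
  obtains Q where "0 \<le> Q" "Im (\<Sum>i\<in>UNIV. cnj (c$i) * (Mmat z *v c)$i) = - Im z * ((\<Sum>i\<in>UNIV. (cmod (c$i))\<^sup>2) + lam\<^sup>2 * Q)"
proof -
  define V where "V s = (cmod (\<Sum>k\<in>UNIV. c$k * v k s))\<^sup>2" for s
  define Q where "Q = (LBINT s:{0<..}. V s / (cmod (of_real s - z))\<^sup>2)"
  have ImV: "Im (of_real (V s) / (of_real s - z)) = Im z * (V s / (cmod (of_real s - z))\<^sup>2)" for s
    by (simp add: Im_divide cmod_power2)
  define S where "S = (\<Sum>i\<in>UNIV. \<Sum>j\<in>UNIV. cnj (c$i) * c$j * self_energy v z i j)"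
  define T where "T = (\<Sum>i\<in>UNIV. (of_real (w i) - z) * of_real ((cmod (c$i))\<^sup>2))"
  define L where "L = (\<Sum>i\<in>UNIV. cnj (c$i) * (Mmat z *v c)$i)"
  have "Im S = Im z * Q"
    unfolding S_def quadratic_form_self_energy(2)[OF z] V_def[symmetric]
    using quadratic_form_self_energy(1)[OF z, of c, folded V_def]
    by (subst Im_set_integral(2)) (simp_all only: ImV Q_def set_integral_mult_right)
  moreover have LE: "L = T - of_real (lam\<^sup>2) * S"
  proof -
    have "(Mmat z *v c)$i = (of_real (w i) - z) * c$i - of_real (lam\<^sup>2) * (\<Sum>j\<in>UNIV. self_energy v z i j * c$j)" for i
      by (simp add: matrix_vector_mult_def Mmat_entry left_diff_distrib sum_subtractf sum_distrib_left mult.assoc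
          if_distrib[of "\<lambda>u. u * _"] cong: if_cong)
    then have "cnj (c$i) * (Mmat z *v c)$i = (of_real (w i) - z) * of_real ((cmod (c$i))\<^sup>2) - of_real (lam\<^sup>2) * (\<Sum>j\<in>UNIV. cnj (c$i) * c$j * self_energy v z i j)" for i
      by (simp only: complex_norm_square right_diff_distrib sum_distrib_left mult_ac)
    then show ?thesis by (simp add: L_def T_def S_def sum_subtractf sum_distrib_left)
  qed
  moreover have "Im T = - Im z * (\<Sum>i\<in>UNIV. (cmod (c$i))\<^sup>2)"
    unfolding T_def by (simp add: sum_distrib_left sum_negf[symmetric] del: of_real_power)
  moreover have "Im L = Im T - lam\<^sup>2 * Im S"
    unfolding LE by (simp del: of_real_power)
  ultimately have "Im L = - Im z * ((\<Sum>i\<in>UNIV. (cmod (c$i))\<^sup>2) + lam\<^sup>2 * Q)"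
    by (simp only:) (simp add: algebra_simps)
  moreover have "0 \<le> Q" unfolding Q_def set_lebesgue_integral_def
    by (intro integral_nonneg_AE AE_I2) (auto simp: V_def indicator_def)
  ultimately show ?thesis using that unfolding L_def by blast
qed

lemma det_Mmat:
  assumes z: "Im z \<noteq> 0"
  shows "det (Mmat z) \<noteq> 0"
proof (rule det_nonzeroI)
  fix c assume c: "Mmat z *v c = 0"
  obtain Q where Q: "0 \<le> Q" "Im (\<Sum>i\<in>UNIV. cnj (c$i) * (Mmat z *v c)$i) = - Im z * ((\<Sum>i\<in>UNIV. (cmod (c$i))\<^sup>2) + lam\<^sup>2 * Q)"
    using numerical_range[OF z] by blast
  then have "(\<Sum>i\<in>UNIV. (cmod (c$i))\<^sup>2) + lam\<^sup>2 * Q = 0" using z by (simp add: c)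
  moreover have "0 \<le> lam\<^sup>2 * Q" using Q by simp
  moreover have "0 \<le> (\<Sum>i\<in>UNIV. (cmod (c$i))\<^sup>2)" by (intro sum_nonneg) simp
  ultimately have "(\<Sum>i\<in>UNIV. (cmod (c$i))\<^sup>2) = 0" by linarith
  then show "c = 0" by (simp add: sum_nonneg_eq_0_iff vec_eq_iff)
qed

text \<open>The continuum equation forces f = -\<lambda> \<Sum> c_k v_k / (x - z) almost everywhere,
  and inserting this into the discrete equations leaves K(z) - z. Conversely this f lies in the
  domain, since 1/(x - z) and x/(x - z) are bounded for non-real z.\<close>

lemma resolvent_sol_iff:
  assumes z: "Im z \<noteq> 0"
  shows "(\<exists>f. resolvent_sol w lam v z n c f) \<longleftrightarrow> Mmat z *v c = (\<chi> k. if k = n then 1 else 0)"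
proof -
  define f0 where "f0 x = - of_real lam * (\<Sum>k\<in>UNIV. c$k * v k x) / (of_real x - z)" for x
  have xz: "complex_of_real x - z \<noteq> 0" for x using z by auto
  have f0m [measurable]: "f0 \<in> borel_measurable borel" unfolding f0_def by measurable
  have inner0: "inner_pos (v k) f0 = - of_real lam * (\<Sum>j\<in>UNIV. self_energy v z k j * c$j)" for k
  proof -
    have e: "cnj (v k x) * f0 x = (\<Sum>j\<in>UNIV. (- of_real lam * c$j) * (cnj (v k x) * v j x / (of_real x - z)))" for x
      by (simp add: f0_def sum_distrib_left sum_divide_distrib sum_negf mult_ac)
    have "inner_pos (v k) f0 = (\<Sum>j\<in>UNIV. (- of_real lam * c$j) * self_energy v z k j)"
      unfolding inner_pos_def e self_energy_def
      by (subst set_integrable_sum(2), intro set_integrable_mult_right vv_cauchy_integrable z)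
         (simp only: set_integral_mult_right)
    then show ?thesis by (simp add: sum_distrib_left mult_ac)
  qed
  have Mc: "(Mmat z *v c)$k = (of_real (w k) - z) * c$k + of_real lam * inner_pos (v k) f0" for k
    unfolding inner0
    by (simp add: matrix_vector_mult_def Mmat_entry left_diff_distrib sum_subtractf sum_distrib_left mult.assoc power2_eq_square sum_negf
          if_distrib[of "\<lambda>u. u * _"] cong: if_cong)
  show ?thesis
  proof
    assume "\<exists>f. resolvent_sol w lam v z n c f"
    then obtain f where f: "resolvent_sol w lam v z n c f" by blast
    have fm [measurable]: "f \<in> borel_measurable borel" using f by (simp add: resolvent_sol_def L2pos_def)
    have ae: "AE x in lborel. 0 < x \<longrightarrow> (of_real x - z) * f x + of_real lam * (\<Sum>k\<in>UNIV. c$k * v k x) = 0"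
      using f by (simp add: resolvent_sol_def)
    have "AE x in lborel. 0 < x \<longrightarrow> f x = f0 x"
      using ae
    proof eventually_elim
      case (elim x)
      show ?case
      proof
        assume "0 < x"
        with elim have "(of_real x - z) * f x = - of_real lam * (\<Sum>k\<in>UNIV. c$k * v k x)"
          by (simp add: add_eq_0_iff)
        moreover have "f x = (of_real x - z) * f x / (of_real x - z)" using xz[of x] by simp
        ultimately show "f x = f0 x" by (simp only: f0_def)
      qed
    qed
    then have "inner_pos (v k) f = inner_pos (v k) f0" for k
      unfolding inner_pos_def set_lebesgue_integral_def
      by (intro integral_cong_AE) (auto simp: indicator_def)
    then show "Mmat z *v c = (\<chi> k. if k = n then 1 else 0)"
      using f by (simp add: vec_eq_iff Mc resolvent_sol_def)
  next
    assume M: "Mmat z *v c = (\<chi> k. if k = n then 1 else 0)"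
    have bnd: "set_integrable lborel {0<..} (\<lambda>x. (cmod (f0 x))\<^sup>2) \<and> set_integrable lborel {0<..} (\<lambda>x. (cmod (of_real x * f0 x))\<^sup>2)"
    proof -
      have V: "set_integrable lborel {0<..} (\<lambda>x. (real CARD('n) * (\<Sum>k\<in>UNIV. (cmod (c$k))\<^sup>2 * (cmod (v k x))\<^sup>2)) * D)" for D
        using v_L2 by (intro set_integrable_mult_left set_integrable_mult_right set_integrable_sum(1)) auto
      have "cmod (\<Sum>k\<in>UNIV. c$k * v k x) \<le> (\<Sum>k\<in>UNIV. cmod (c$k) * cmod (v k x))" for x
        by (rule order_trans[OF norm_sum]) (simp add: norm_mult)
      then have "(cmod (\<Sum>k\<in>UNIV. c$k * v k x))\<^sup>2 \<le> (\<Sum>k\<in>UNIV. cmod (c$k) * cmod (v k x))\<^sup>2" for x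
        by (intro power_mono) auto
      also have "(\<Sum>k\<in>UNIV. cmod (c$k) * cmod (v k x))\<^sup>2 \<le> real CARD('n) * (\<Sum>k\<in>UNIV. (cmod (c$k))\<^sup>2 * (cmod (v k x))\<^sup>2)" for x
        using sum_squared_le_sum_of_squares[of "\<lambda>k. cmod (c$k) * cmod (v k x)" UNIV]
        by (simp add: power_mult_distrib mult.commute)
      finally have Vb: "(cmod (\<Sum>k\<in>UNIV. c$k * v k x))\<^sup>2 \<le> real CARD('n) * (\<Sum>k\<in>UNIV. (cmod (c$k))\<^sup>2 * (cmod (v k x))\<^sup>2)" for x .
      \<comment> \<open>Treats f0 and x f0 at once: \<open>g\<close> is 1 or x, and only g/(x - z)
        has to be bounded.\<close>
      have gen: "set_integrable lborel {0<..} (\<lambda>x. (cmod (g x * f0 x))\<^sup>2)"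
        if g: "g \<in> borel_measurable borel" "\<And>x. cmod (g x / (of_real x - z)) \<le> B" for g B
      proof -
        have "set_integrable lborel {0<..} (\<lambda>x. complex_of_real ((cmod (g x * f0 x))\<^sup>2))"
        proof (rule set_integrable_bound_borel[OF V[of "(\<bar>lam\<bar> * B)\<^sup>2"]])
          show "(\<lambda>x. complex_of_real ((cmod (g x * f0 x))\<^sup>2)) \<in> borel_measurable borel" using g(1) by measurable
          fix x :: real
          have "g x * f0 x = - of_real lam * (\<Sum>k\<in>UNIV. c$k * v k x) * (g x / (of_real x - z))" by (simp add: f0_def)
          then have "(cmod (g x * f0 x))\<^sup>2 = (cmod (\<Sum>k\<in>UNIV. c$k * v k x))\<^sup>2 * (\<bar>lam\<bar> * cmod (g x / (of_real x - z)))\<^sup>2"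
            by (simp only: norm_mult norm_minus_cancel norm_of_real power_mult_distrib mult_ac)
          also have "\<dots> \<le> (real CARD('n) * (\<Sum>k\<in>UNIV. (cmod (c$k))\<^sup>2 * (cmod (v k x))\<^sup>2)) * (\<bar>lam\<bar> * B)\<^sup>2"
            by (intro mult_mono Vb power_mono mult_left_mono g(2) mult_nonneg_nonneg sum_nonneg) auto
          finally show "norm (complex_of_real ((cmod (g x * f0 x))\<^sup>2)) \<le> (real CARD('n) * (\<Sum>k\<in>UNIV. (cmod (c$k))\<^sup>2 * (cmod (v k x))\<^sup>2)) * (\<bar>lam\<bar> * B)\<^sup>2"
            by (simp only: norm_of_real) simp
        qed simp
        then have "integrable lborel (\<lambda>x. complex_of_real (indicat_real {0<..} x *\<^sub>R (cmod (g x * f0 x))\<^sup>2))"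
          unfolding set_integrable_def by (simp only: scaleR_conv_of_real[where 'a = complex] real_scaleR_def of_real_mult)
        then show ?thesis unfolding set_integrable_def complex_of_real_integrable_eq .
      qed
      have "cmod (of_real x / (of_real x - z)) \<le> 1 + cmod z * (1 / \<bar>Im z\<bar>)" for x
      proof -
        have "of_real x / (of_real x - z) = 1 + z * (1 / (of_real x - z))" using xz[of x] by (simp add: divide_simps)
        then have "cmod (of_real x / (of_real x - z)) \<le> cmod 1 + cmod (z * (1 / (of_real x - z)))" by (simp only: norm_triangle_ineq)
        also have "\<dots> \<le> 1 + cmod z * (1 / \<bar>Im z\<bar>)"
          unfolding norm_mult by (intro add_mono mult_left_mono norm_stieltjes_kernel_le z) auto
        finally show ?thesis .
      qed
      from gen[OF _ this] gen[of "\<lambda>_. 1", OF _ norm_stieltjes_kernel_le[OF z]] show ?thesis by simp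
    qed
    have "resolvent_sol w lam v z n c f0"
      unfolding resolvent_sol_def L2pos_def
    proof (intro conjI allI)
      fix k
      show "(complex_of_real (w k) - z) * c$k + complex_of_real lam * inner_pos (v k) f0 = (if k = n then 1 else 0)"
        using M by (simp add: vec_eq_iff flip: Mc)
      show "AE x in lborel. 0 < x \<longrightarrow> (complex_of_real x - z) * f0 x + complex_of_real lam * (\<Sum>k\<in>UNIV. c$k * v k x) = 0"
        by (rule AE_I2) (use xz in \<open>auto simp: f0_def\<close>)
    qed (use bnd in \<open>auto simp: power_mult_distrib norm_mult\<close>)
    then show "\<exists>f. resolvent_sol w lam v z n c f" by blast
  qed
qed

text \<open>Invertibility makes the discrete component unique, so the definite description in
  \<open>resolvent_entry\<close> denotes a column of the inverse.\<close>

lemma resolvent_entry_eq: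
  assumes z: "Im z \<noteq> 0"
  shows "resolvent_entry w lam v z m n = matrix_inv (Mmat z) $ m $ n"
proof -
  have "(THE c. \<exists>f. resolvent_sol w lam v z n c f) = matrix_inv (Mmat z) *v (\<chi> k. if k = n then 1 else 0)"
    unfolding resolvent_sol_iff[OF z] matrix_inv_solve[OF det_Mmat[OF z]] by simp
  then show ?thesis
    by (simp add: resolvent_entry_def matrix_vector_mult_def if_distrib[of "(*) _"] cong: if_cong)
qed

lemma resolvent_form_eq:
  assumes z: "Im z \<noteq> 0"
  shows "resolvent_form w lam v z u = (\<Sum>m\<in>UNIV. \<Sum>n\<in>UNIV. cnj (u$m) * u$n * matrix_inv (Mmat z) $ m $ n)"
  by (simp add: resolvent_form_def resolvent_entry_eq[OF z])

end

section \<open>The spectral measure\<close>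

lemma matrix_inv_adjoint:
  fixes A B :: "complex^'n^'n"
  assumes A: "det A \<noteq> 0" and B: "\<And>i j. B $ i $ j = cnj (A $ j $ i)"
  shows "matrix_inv B $ i $ j = cnj (matrix_inv A $ j $ i)"
proof -
  define C :: "complex^'n^'n" where "C = (\<chi> i j. cnj (matrix_inv A $ j $ i))"
  have "(B ** C) $ i $ j = (mat 1 :: complex^'n^'n) $ i $ j" for i j
  proof -
    have "(B ** C) $ i $ j = cnj ((matrix_inv A ** A) $ j $ i)"
      by (simp add: matrix_matrix_mult_def B C_def mult.commute)
    also have "\<dots> = (mat 1 :: complex^'n^'n) $ i $ j" by (simp add: matrix_inv_mult[OF A] mat_def)
    finally show ?thesis .
  qed
  then have BC: "B ** C = mat 1" by (simp add: vec_eq_iff)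
  then have "det B * det C = 1" by (metis det_I det_mul)
  then have dB: "det B \<noteq> 0" by auto
  have "matrix_inv B = matrix_inv B ** (B ** C)" by (simp add: BC)
  also have "\<dots> = C" by (simp add: matrix_mul_assoc matrix_inv_mult[OF dB])
  finally show ?thesis by (simp add: C_def)
qed

context friedrichs
begin

lemma self_energy_cnj:
  assumes "Im z \<noteq> 0"
  shows "self_energy v (cnj z) i j = cnj (self_energy v z j i)"
proof -
  have i: "integrable lborel (\<lambda>s. indicat_real {0<..} s *\<^sub>R (cnj (v j s) * v i s / (of_real s - z)))"
    using vv_cauchy_integrable[OF assms] by (simp add: set_integrable_def)
  show ?thesis
    unfolding self_energy_def set_lebesgue_integral_def integral_bounded_linear[OF bounded_linear_cnj i, symmetric]
    by (rule Bochner_Integration.integral_cong[OF refl]) (simp add: mult.commute)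
qed

lemma Mmat_cnj:
  assumes "Im z \<noteq> 0"
  shows "Mmat (cnj z) $ i $ j = cnj (Mmat z $ j $ i)"
  by (simp add: Mmat_entry self_energy_cnj[OF assms])

definition Fform :: "complex^'n \<Rightarrow> complex \<Rightarrow> complex" where
  "Fform u z = (\<Sum>m\<in>UNIV. \<Sum>n\<in>UNIV. cnj (u$m) * u$n * matrix_inv (Mmat z) $ m $ n)"

lemma Fform_solution: "Fform u z = (\<Sum>m\<in>UNIV. cnj (u$m) * (matrix_inv (Mmat z) *v u) $ m)"
  by (simp add: Fform_def matrix_vector_mult_def sum_distrib_left mult_ac)

lemma Fform_cnj:
  assumes z: "Im z \<noteq> 0"
  shows "Fform u (cnj z) = cnj (Fform u z)"
proof -
  have "matrix_inv (Mmat (cnj z)) $ m $ n = cnj (matrix_inv (Mmat z) $ n $ m)" for m n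
    by (rule matrix_inv_adjoint[OF det_Mmat[OF z] Mmat_cnj[OF z]])
  then have "Fform u (cnj z) = (\<Sum>m\<in>UNIV. \<Sum>n\<in>UNIV. cnj (cnj (u$n) * u$m * matrix_inv (Mmat z) $ n $ m))"
    unfolding Fform_def by (simp add: mult_ac)
  also have "\<dots> = (\<Sum>n\<in>UNIV. \<Sum>m\<in>UNIV. cnj (cnj (u$n) * u$m * matrix_inv (Mmat z) $ n $ m))"
    by (rule sum.swap)
  finally show ?thesis by (simp add: Fform_def)
qed

lemma self_energy_holomorphic: "(\<lambda>z. self_energy v z i j) holomorphic_on {z. 0 < Im z}"
  unfolding self_energy_def
  using cauchy_transform_holomorphic[of "\<lambda>s. cnj (v i s) * v j s"] vv_div_integrable[of "\<lambda>_. 1" 1 i j] by simp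

lemma Fform_holomorphic: "Fform u holomorphic_on {z. 0 < Im z}"
proof -
  have "(\<lambda>z. matrix_inv (Mmat z) $ m $ n) holomorphic_on {z. 0 < Im z}" for m n
  proof (rule holomorphic_on_matrix_inv)
    fix i j
    show "(\<lambda>z. Mmat z $ i $ j) holomorphic_on {z. 0 < Im z}"
      unfolding Mmat_entry by (cases "i = j") (auto intro!: holomorphic_intros self_energy_holomorphic)
  qed (use det_Mmat in auto)
  then show ?thesis unfolding Fform_def[abs_def] by (intro holomorphic_intros)
qed

lemma Mmat_solution:
  assumes "Im z \<noteq> 0"
  shows "Mmat z *v (matrix_inv (Mmat z) *v u) = u"
  using matrix_inv_solve[OF det_Mmat[OF assms], of _ u] by blast

text \<open>For c = (K(z) - z)^(-1) u the product of u with c is the conjugate of the product of c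
  with (K(z) - z) c, so the sign from the numerical range is reversed.\<close>

lemma Fform_Im_nonneg:
  assumes z: "0 < Im z"
  shows "0 \<le> Im (Fform u z)"
proof -
  have z': "Im z \<noteq> 0" using z by simp
  define c where "c = matrix_inv (Mmat z) *v u"
  have u: "Mmat z *v c = u" using Mmat_solution[OF z'] by (simp add: c_def)
  obtain Q where Q: "0 \<le> Q" "Im (\<Sum>i\<in>UNIV. cnj (c$i) * (Mmat z *v c)$i) = - Im z * ((\<Sum>i\<in>UNIV. (cmod (c$i))\<^sup>2) + lam\<^sup>2 * Q)"
    using numerical_range[OF z'] by blast
  have "Fform u z = cnj (\<Sum>i\<in>UNIV. cnj (c$i) * (Mmat z *v c)$i)"
    by (simp add: Fform_solution c_def[symmetric] u mult.commute)
  moreover have "Im (cnj x) = - Im x" for x by simp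
  ultimately have "Im (Fform u z) = Im z * ((\<Sum>i\<in>UNIV. (cmod (c$i))\<^sup>2) + lam\<^sup>2 * Q)" by (simp only: Q(2))
  moreover have "0 \<le> (\<Sum>i\<in>UNIV. (cmod (c$i))\<^sup>2)" by (intro sum_nonneg) simp
  ultimately show ?thesis using z Q(1) by simp
qed

text \<open>Let (K(z) - z) c = u. The matrix (K(z) - z) + z has bounded entries on Im z \<ge> e, so
  u + zc is O(|c|) and z times the error is O(|c|). The same relation gives |c| = O(1/|z|), which
  provides the second power.\<close>

lemma Fform_asymptotic:
  assumes e: "0 < e"
  shows "\<exists>C. \<forall>z. e \<le> Im z \<longrightarrow> norm (Fform u z + of_real (\<Sum>m\<in>UNIV. (cmod (u$m))\<^sup>2) / z) \<le> C / (norm z)\<^sup>2"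
proof -
  define N where "N = real CARD('n)"
  have N: "0 < N" by (simp add: N_def)
  define b where "b i j = (LBINT s:{0<..}. norm (cnj (v i s) * v j s))" for i j
  define \<kappa> where "\<kappa> = (\<Sum>i\<in>UNIV. \<bar>w i\<bar>) + lam\<^sup>2 * (\<Sum>i\<in>UNIV. \<Sum>j\<in>UNIV. b i j / e)"
  define U where "U = (\<Sum>i\<in>UNIV. norm (u$i))"
  define C1 where "C1 = U + N * \<kappa> * (N * U / e)"
  have b0: "0 \<le> b i j" for i j
    unfolding b_def set_lebesgue_integral_def by (intro integral_nonneg_AE AE_I2) auto
  have \<kappa>0: "0 \<le> \<kappa>" using b0 e by (auto simp: \<kappa>_def intro!: add_nonneg_nonneg sum_nonneg mult_nonneg_nonneg divide_nonneg_pos)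
  have U0: "0 \<le> U" by (simp add: U_def sum_nonneg)
  have main: "norm (Fform u z + of_real (\<Sum>m\<in>UNIV. (cmod (u$m))\<^sup>2) / z) \<le> (U * \<kappa> * C1) / (norm z)\<^sup>2" if z: "e \<le> Im z" for z
  proof -
    have z': "Im z \<noteq> 0" using z e by simp
    then have nz: "z \<noteq> 0" by auto
    define c where "c = matrix_inv (Mmat z) *v u"
    define A where "A = (\<Sum>i\<in>UNIV. norm (c$i))"
    have A0: "0 \<le> A" by (simp add: A_def sum_nonneg)
    have u: "Mmat z *v c = u" using Mmat_solution[OF z'] by (simp add: c_def)
    have S: "norm (self_energy v z i j) \<le> b i j / e" for i j
    proof -
      have "norm (self_energy v z i j) \<le> (LBINT s:{0<..}. norm (cnj (v i s) * v j s) / e)"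
        unfolding self_energy_def set_lebesgue_integral_def
      proof (rule Bochner_Integration.integral_norm_bound_integral)
        show "integrable lborel (\<lambda>s. indicat_real {0<..} s *\<^sub>R (cnj (v i s) * v j s / (of_real s - z)))"
          using vv_cauchy_integrable[OF z'] by (simp add: set_integrable_def)
        have "set_integrable lborel {0<..} (\<lambda>s. cnj (v i s) * v j s)" using vv_div_integrable[of "\<lambda>_. 1" 1 i j] by simp
        from set_integrable_divide[OF set_integrable_norm[OF this], of e]
        show "integrable lborel (\<lambda>s. indicat_real {0<..} s *\<^sub>R (norm (cnj (v i s) * v j s) / e))"
          by (simp add: set_integrable_def)
        fix s :: real
        have "norm (1 / (complex_of_real s - z)) \<le> 1 / e"
          using norm_stieltjes_kernel_le[OF z', of s] z e by (smt (verit) frac_le zero_less_one)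
        from mult_left_mono[OF this norm_ge_zero[of "cnj (v i s) * v j s"]]
        have "norm (cnj (v i s) * v j s / (of_real s - z)) \<le> norm (cnj (v i s) * v j s) / e"
          by (simp add: norm_divide norm_mult)
        then show "norm (indicat_real {0<..} s *\<^sub>R (cnj (v i s) * v j s / (of_real s - z))) \<le> indicat_real {0<..} s *\<^sub>R (norm (cnj (v i s) * v j s) / e)"
          by (auto simp: indicator_def)
      qed
      also have "\<dots> = b i j / e" by (simp add: b_def)
      finally show ?thesis .
    qed
    have K: "norm (Mmat z $ i $ j + (if i = j then z else 0)) \<le> \<kappa>" for i j
    proof -
      have "norm (Mmat z $ i $ j + (if i = j then z else 0)) = norm ((if i = j then of_real (w i) else 0) - of_real (lam\<^sup>2) * self_energy v z i j)"
        by (simp add: Mmat_entry)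
      also have "\<dots> \<le> norm (if i = j then complex_of_real (w i) else 0) + norm (of_real (lam\<^sup>2) * self_energy v z i j)"
        by (rule norm_triangle_ineq4)
      also have "\<dots> \<le> \<bar>w i\<bar> + lam\<^sup>2 * (b i j / e)"
        using mult_left_mono[OF S[of i j], of "lam\<^sup>2"] by (intro add_mono) (auto simp: norm_mult simp del: of_real_power)
      also have "\<dots> \<le> \<kappa>"
        unfolding \<kappa>_def
      proof (intro add_mono mult_left_mono)
        show "\<bar>w i\<bar> \<le> (\<Sum>i\<in>UNIV. \<bar>w i\<bar>)" by (rule member_le_sum) auto
        have "b i j / e \<le> (\<Sum>j\<in>UNIV. b i j / e)" by (rule member_le_sum) (use b0 e in auto)
        also have "\<dots> \<le> (\<Sum>i\<in>UNIV. \<Sum>j\<in>UNIV. b i j / e)"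
          by (rule member_le_sum[of i UNIV "\<lambda>i. \<Sum>j\<in>UNIV. b i j / e"]) (use b0 e in \<open>auto intro!: sum_nonneg\<close>)
        finally show "b i j / e \<le> (\<Sum>i\<in>UNIV. \<Sum>j\<in>UNIV. b i j / e)" .
      qed auto
      finally show ?thesis .
    qed
    \<comment> \<open>A first bound on c independent of z: the numerical range gives e \<Sum>|c_i|^2
      \<le> A U, and Cauchy-Schwarz compares this with the l1 norm \<open>A\<close>.\<close>
    have A1: "A \<le> N * U / e"
    proof (cases "A = 0")
      case False
      obtain Q where Q: "0 \<le> Q" "Im (\<Sum>i\<in>UNIV. cnj (c$i) * (Mmat z *v c)$i) = - Im z * ((\<Sum>i\<in>UNIV. (cmod (c$i))\<^sup>2) + lam\<^sup>2 * Q)"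
        using numerical_range[OF z'] by blast
      have "e * (\<Sum>i\<in>UNIV. (cmod (c$i))\<^sup>2) \<le> Im z * ((\<Sum>i\<in>UNIV. (cmod (c$i))\<^sup>2) + lam\<^sup>2 * Q)"
        using z e Q(1) by (intro mult_mono) (auto intro: sum_nonneg)
      also have "\<dots> \<le> norm (\<Sum>i\<in>UNIV. cnj (c$i) * u$i)"
        using abs_Im_le_cmod[of "\<Sum>i\<in>UNIV. cnj (c$i) * u$i"] Q(2)[unfolded u] by linarith
      also have "\<dots> \<le> (\<Sum>i\<in>UNIV. norm (c$i) * norm (u$i))"
        by (rule order_trans[OF norm_sum]) (simp add: norm_mult)
      also have "\<dots> \<le> (\<Sum>i\<in>UNIV. norm (c$i) * U)"
        by (intro sum_mono mult_left_mono) (auto simp: U_def intro!: member_le_sum)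
      also have "\<dots> = A * U" by (simp add: A_def sum_distrib_right)
      finally have 1: "e * (\<Sum>i\<in>UNIV. (cmod (c$i))\<^sup>2) \<le> A * U" .
      have "A\<^sup>2 \<le> (\<Sum>i\<in>UNIV. (cmod (c$i))\<^sup>2) * N"
        unfolding A_def N_def by (rule sum_squared_le_sum_of_squares)
      then have "e * A\<^sup>2 \<le> e * ((\<Sum>i\<in>UNIV. (cmod (c$i))\<^sup>2) * N)" using e by (intro mult_left_mono) auto
      also have "\<dots> \<le> (A * U) * N" using mult_right_mono[OF 1, of N] N by (simp add: mult.assoc)
      finally have "A * (e * A) \<le> A * (N * U)" by (simp add: power2_eq_square mult_ac)
      then have "e * A \<le> N * U" using False A0 by (simp add: mult_le_cancel_left)
      then show ?thesis using e by (simp add: pos_le_divide_eq mult.commute)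
    qed (use N U0 e in simp)
    define k where "k i = (\<Sum>j\<in>UNIV. (Mmat z $ i $ j + (if i = j then z else 0)) * c $ j)" for i
    have kc: "k i = u $ i + z * c $ i" for i
      unfolding u[symmetric] k_def
      by (simp add: matrix_vector_mult_def distrib_right sum.distrib if_distrib[of "\<lambda>u. u * _"] cong: if_cong)
    have kb: "norm (k i) \<le> \<kappa> * A" for i
      unfolding k_def A_def sum_distrib_left
      by (rule order_trans[OF norm_sum], rule sum_mono, unfold norm_mult, rule mult_right_mono[OF K norm_ge_zero])
    have "norm z * norm (c$i) \<le> \<kappa> * A + norm (u$i)" for i
    proof -
      have "z * c$i = k i - u$i" by (simp add: kc)
      then have "norm (z * c$i) \<le> norm (k i) + norm (u$i)" by (simp only: norm_triangle_ineq4)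
      then show ?thesis using kb[of i] by (simp add: norm_mult)
    qed
    then have "(\<Sum>i\<in>UNIV. norm z * norm (c$i)) \<le> (\<Sum>i\<in>UNIV. \<kappa> * A + norm (u$i))" by (intro sum_mono)
    then have "norm z * A \<le> U + N * \<kappa> * A"
      by (simp add: A_def U_def N_def sum.distrib sum_distrib_left[symmetric])
    also have "\<dots> \<le> C1" unfolding C1_def using A1 N \<kappa>0 by (intro add_left_mono mult_left_mono) auto
    finally have zA: "norm z * A \<le> C1" .
    have "z * (Fform u z + of_real (\<Sum>m\<in>UNIV. (cmod (u$m))\<^sup>2) / z) = (\<Sum>m\<in>UNIV. cnj (u$m) * k m)"
    proof -
      have "of_real (\<Sum>m\<in>UNIV. (cmod (u$m))\<^sup>2) = (\<Sum>m\<in>UNIV. cnj (u$m) * u$m)"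
        by (simp only: of_real_sum complex_norm_square mult.commute)
      moreover have "z * (x + y / z) = z * x + y" for x y using nz by (simp add: distrib_left)
      ultimately show ?thesis
        by (simp only:) (simp add: kc Fform_solution c_def[symmetric] distrib_left sum.distrib sum_distrib_left mult_ac)
    qed
    then have "norm z * norm (Fform u z + of_real (\<Sum>m\<in>UNIV. (cmod (u$m))\<^sup>2) / z) = norm (\<Sum>m\<in>UNIV. cnj (u$m) * k m)"
      by (metis norm_mult)
    also have "\<dots> \<le> (\<Sum>m\<in>UNIV. norm (u$m) * (\<kappa> * A))"
      by (rule order_trans[OF norm_sum]) (auto simp: norm_mult intro!: sum_mono mult_left_mono kb)
    also have "\<dots> = U * \<kappa> * A" by (simp add: U_def sum_distrib_right mult.assoc)
    finally have "norm z * (norm z * norm (Fform u z + of_real (\<Sum>m\<in>UNIV. (cmod (u$m))\<^sup>2) / z)) \<le> norm z * (U * \<kappa> * A)"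
      by (intro mult_left_mono) auto
    also have "\<dots> = U * \<kappa> * (norm z * A)" by simp
    also have "\<dots> \<le> U * \<kappa> * C1" using U0 \<kappa>0 zA by (intro mult_left_mono) auto
    finally show ?thesis using nz by (simp add: pos_le_divide_eq power2_eq_square mult_ac)
  qed
  show ?thesis using main by blast
qed

text \<open>The Herglotz representation is normalised to mass 1, so the form is divided by q = |u|^2
  and the measure rescaled; u = 0 is served by the zero measure. The lower half plane follows by
  conjugation.\<close>

lemma ex_spectral_measure: "\<exists>\<mu>. is_spectral_measure w lam v u \<mu>"
proof (cases "u = 0")
  case True
  have "is_spectral_measure w lam v u (null_measure borel)"
    by (auto simp: is_spectral_measure_def True resolvent_form_def intro!: finite_measureI)
  then show ?thesis by blast
next
  case False
  define q where "q = (\<Sum>m\<in>UNIV. (cmod (u$m))\<^sup>2)"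
  have q: "0 < q"
  proof -
    obtain m where "u$m \<noteq> 0" using False by (auto simp: vec_eq_iff)
    then show ?thesis unfolding q_def by (intro sum_pos2[of UNIV m]) auto
  qed
  have "\<exists>\<mu>. real_distribution \<mu> \<and> (\<forall>z. 0 < Im z \<longrightarrow> (\<integral>x. 1 / (complex_of_real x - z) \<partial>\<mu>) = Fform u z / of_real q)"
  proof (rule herglotz_stieltjes)
    show "(\<lambda>z. Fform u z / of_real q) holomorphic_on {z. 0 < Im z}"
      using q by (intro holomorphic_intros Fform_holomorphic) auto
    show "0 \<le> Im (Fform u z / of_real q)" if "0 < Im z" for z
      using Fform_Im_nonneg[OF that, of u] q by simp
    fix e :: real assume "0 < e"
    then obtain C where C: "\<And>z. e \<le> Im z \<Longrightarrow> norm (Fform u z + of_real q / z) \<le> C / (norm z)\<^sup>2"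
      using Fform_asymptotic[of e u] unfolding q_def by blast
    have "norm (Fform u z / of_real q + 1 / z) \<le> (C / q) / (norm z)\<^sup>2" if z: "e \<le> Im z" for z
    proof -
      have "Fform u z / of_real q + 1 / z = (Fform u z + of_real q / z) / of_real q"
        using q by (simp add: add_divide_distrib)
      then have "norm (Fform u z / of_real q + 1 / z) = norm (Fform u z + of_real q / z) / q"
        using q by (simp add: norm_divide)
      also have "\<dots> \<le> (C / (norm z)\<^sup>2) / q" using C[OF z] q by (intro divide_right_mono) auto
      finally show ?thesis by (simp add: mult.commute)
    qed
    then show "\<exists>C. \<forall>z. e \<le> Im z \<longrightarrow> norm (Fform u z / of_real q + 1 / z) \<le> C / (norm z)\<^sup>2" by blast
  qed
  then obtain \<mu> where \<mu>: "real_distribution \<mu>" "\<And>z. 0 < Im z \<Longrightarrow> (\<integral>x. 1 / (complex_of_real x - z) \<partial>\<mu>) = Fform u z / of_real q"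
    by blast
  interpret real_distribution \<mu> by fact
  define \<nu> where "\<nu> = density \<mu> (\<lambda>_. ennreal q)"
  have sets: "sets \<nu> = sets borel" by (simp add: \<nu>_def)
  have fin: "finite_measure \<nu>"
  proof (rule finite_measureI)
    have "emeasure \<nu> (space \<nu>) = ennreal q * emeasure \<mu> (space \<mu>)"
      unfolding \<nu>_def by (simp add: emeasure_density_const)
    then show "emeasure \<nu> (space \<nu>) \<noteq> \<infinity>" using emeasure_space_1 by simp
  qed
  have up: "(\<integral>x. 1 / (complex_of_real x - z) \<partial>\<nu>) = Fform u z" if z: "0 < Im z" for z
  proof -
    have "(\<integral>x. 1 / (complex_of_real x - z) \<partial>\<nu>) = (\<integral>x. q *\<^sub>R (1 / (complex_of_real x - z)) \<partial>\<mu>)"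
      unfolding \<nu>_def using q by (intro integral_density) auto
    also have "\<dots> = q *\<^sub>R (\<integral>x. 1 / (complex_of_real x - z) \<partial>\<mu>)" by (rule integral_scaleR_right)
    finally show ?thesis unfolding \<mu>(2)[OF z] using q by (simp add: scaleR_conv_of_real)
  qed
  have "(\<integral>x. 1 / (complex_of_real x - z) \<partial>\<nu>) = Fform u z" if z: "Im z \<noteq> 0" for z
  proof (cases "0 < Im z")
    case False
    then have z1: "0 < Im (cnj z)" using z by simp
    have "(\<integral>x. 1 / (complex_of_real x - z) \<partial>\<nu>) = (\<integral>x. cnj (1 / (complex_of_real x - cnj z)) \<partial>\<nu>)" by simp
    also have "\<dots> = cnj (\<integral>x. 1 / (complex_of_real x - cnj z) \<partial>\<nu>)"
      by (rule integral_bounded_linear[OF bounded_linear_cnj]) (rule integrable_stieltjes_kernel[OF fin sets], use z in simp)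
    also have "\<dots> = Fform u z" using up[OF z1] Fform_cnj[of "cnj z" u] z by simp
    finally show ?thesis .
  qed (rule up)
  then have "is_spectral_measure w lam v u \<nu>"
    using fin sets by (simp add: is_spectral_measure_def resolvent_form_eq Fform_def)
  then show ?thesis by blast
qed

lemma spec_meas_is_spectral_measure: "is_spectral_measure w lam v u (spec_meas w lam v u)"
  unfolding spec_meas_def
proof (rule theI')
  obtain \<mu> where \<mu>: "is_spectral_measure w lam v u \<mu>" using ex_spectral_measure by blast
  show "\<exists>!\<mu>. is_spectral_measure w lam v u \<mu>"
  proof (rule ex1I[where a = \<mu>], rule \<mu>)
    fix \<nu> assume "is_spectral_measure w lam v u \<nu>"
    with \<mu> show "\<nu> = \<mu>" by (intro stieltjes_unique) (auto simp: is_spectral_measure_def)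
  qed
qed

lemma spec_meas_stieltjes:
  "finite_measure (spec_meas w lam v u)" "sets (spec_meas w lam v u) = sets borel"
  "Im z \<noteq> 0 \<Longrightarrow> (\<integral>x. 1 / (complex_of_real x - z) \<partial>spec_meas w lam v u) = Fform u z"
  using spec_meas_is_spectral_measure[of u] by (auto simp: is_spectral_measure_def resolvent_form_eq Fform_def)

end

section \<open>Boundary values of the resolvent in a sector\<close>

lemma holomorphic_diff_bigo:
  assumes "f holomorphic_on S" "open S" "0 \<in> S"
  shows "(\<lambda>z. f z - f 0) \<in> O[at 0 within T](\<lambda>z. z)"
proof -
  obtain D where "(f has_field_derivative D) (at 0)"
    using assms by (metis holomorphic_on_imp_differentiable_at field_differentiable_def)
  then have "((\<lambda>z. (f z - f 0) / z) \<longlongrightarrow> D) (at 0)"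
    by (simp add: has_field_derivative_iff)
  then have "(\<lambda>z. f z - f 0) \<in> O[at 0](\<lambda>z. z)"
    by (rule bigoI_tendsto) (simp add: eventually_at_filter)
  then show ?thesis by (rule landau_o.big.filter_mono[OF at_le, rotated]) simp
qed

lemma norm_Ln_le:
  assumes "z \<noteq> 0"
  shows "norm (Ln z) \<le> \<bar>ln (norm z)\<bar> + pi"
proof -
  have "norm (Ln z) \<le> \<bar>Re (Ln z)\<bar> + \<bar>Im (Ln z)\<bar>" by (rule cmod_le)
  then show ?thesis using assms mpi_less_Im_Ln[of z] Im_Ln_le_pi[of z] by simp
qed

text \<open>Two error scales in one function: |z| for \<open>b\<close> = 0 and |z|(1 + |ln |z||) for
  \<open>b\<close> = 1. Complex values allow its use in Landau sets of complex functions.\<close>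

definition log_err :: "real \<Rightarrow> complex \<Rightarrow> complex" where
  "log_err b z = of_real (norm z * (1 + b * \<bar>ln (norm z)\<bar>))"

lemma norm_log_err: "0 \<le> b \<Longrightarrow> norm (log_err b z) = norm z * (1 + b * \<bar>ln (norm z)\<bar>)"
  unfolding log_err_def norm_of_real by (intro abs_of_nonneg mult_nonneg_nonneg add_nonneg_nonneg) auto

lemma id_bigo_log_err:
  assumes "0 \<le> b"
  shows "(\<lambda>z. z) \<in> O[F](log_err b)"
proof (rule landau_o.bigI[of 1])
  have "norm z * 1 \<le> norm z * (1 + b * \<bar>ln (norm z)\<bar>)" for z :: complex
    using assms by (intro mult_left_mono) auto
  then show "\<forall>\<^sub>F z in F. norm z \<le> 1 * norm (log_err b z)" by (simp add: norm_log_err[OF assms])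
qed simp

lemma log_err_tendsto_0: "(log_err 1 \<longlongrightarrow> 0) (at 0 within S)"
proof -
  have "((\<lambda>x::real. x * (1 + 1 * \<bar>ln x\<bar>)) \<longlongrightarrow> 0) (at_right 0)" by real_asymp
  moreover have "filterlim (norm :: complex \<Rightarrow> real) (at_right 0) (at 0)"
    unfolding filterlim_at by (auto simp: eventually_at_filter intro!: tendsto_norm_zero)
  ultimately have "((\<lambda>z::complex. norm z * (1 + 1 * \<bar>ln (norm z)\<bar>)) \<longlongrightarrow> 0) (at 0)"
    by (rule filterlim_compose)
  then have "((\<lambda>z::complex. complex_of_real (norm z * (1 + 1 * \<bar>ln (norm z)\<bar>))) \<longlongrightarrow> of_real 0) (at 0)"
    by (rule tendsto_of_real)
  then show ?thesis
    unfolding log_err_def[abs_def] using tendsto_within_subset by fastforce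
qed

text \<open>Here the cases n_b = 1 and n_b \<ge> 2 separate: for k \<ge> 2 a power of |z| is left
  over to absorb the logarithm, as x |ln x| \<le> 1 on (0, 1); for k = 1 the logarithm
  survives.\<close>

lemma log_mult_bigo_log_err:
  fixes f :: "complex \<Rightarrow> complex" and a :: complex
  assumes f: "f \<in> O[at 0 within S](\<lambda>z. z ^ k)" and k: "1 \<le> k" and b: "b = 1 \<or> b = 0 \<and> 2 \<le> k"
  shows "(\<lambda>z. (Ln z - a) * f z) \<in> O[at 0 within S](log_err b)"
proof -
  obtain C where C: "0 < C" "\<forall>\<^sub>F z in at 0 within S. norm (f z) \<le> C * norm (z ^ k)"
    using f by (elim landau_o.bigE) auto
  define D where "D = pi + norm a"
  have D: "0 \<le> D" by (simp add: D_def)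
  have "\<forall>\<^sub>F z in at 0 within S. z \<noteq> 0" by (simp add: eventually_at_filter)
  moreover have "\<forall>\<^sub>F z in at 0 within S. norm z < 1"
    unfolding eventually_at by (intro exI[of _ 1]) auto
  ultimately have "\<forall>\<^sub>F z in at 0 within S. norm ((Ln z - a) * f z) \<le> (C * (1 + D)) * norm (log_err b z)"
    using C(2)
  proof eventually_elim
    case (elim z)
    define x where "x = norm z"
    have x: "0 < x" "x < 1" using elim by (auto simp: x_def)
    have l: "norm (Ln z - a) \<le> \<bar>ln x\<bar> + D"
      using norm_triangle_ineq4[of "Ln z" a] norm_Ln_le[OF elim(1)] by (simp add: D_def x_def)
    have key: "(\<bar>ln x\<bar> + D) * x ^ k \<le> (1 + D) * (x * (1 + b * \<bar>ln x\<bar>))"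
      using b
    proof
      assume b: "b = 1"
      have "x ^ k \<le> x ^ 1" using x k by (intro power_decreasing) auto
      then have "(\<bar>ln x\<bar> + D) * x ^ k \<le> (\<bar>ln x\<bar> + D) * x" using D by (intro mult_left_mono) auto
      also have "\<dots> \<le> ((1 + D) * (1 + \<bar>ln x\<bar>)) * x"
      proof (rule mult_right_mono)
        have "l + D \<le> (1 + D) * (1 + l)" if "0 \<le> l" for l
          using mult_nonneg_nonneg[OF D that] that by (simp add: algebra_simps)
        then show "\<bar>ln x\<bar> + D \<le> (1 + D) * (1 + \<bar>ln x\<bar>)" by simp
      qed (use x in simp)
      finally show ?thesis by (simp add: b mult_ac)
    next
      assume b: "b = 0 \<and> 2 \<le> k"
      then have "x ^ k \<le> x ^ 2" using x by (intro power_decreasing) auto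
      then have "(\<bar>ln x\<bar> + D) * x ^ k \<le> (\<bar>ln x\<bar> + D) * x ^ 2" using D by (intro mult_left_mono) auto
      also have "\<dots> = ((\<bar>ln x\<bar> + D) * x) * x" by (simp add: power2_eq_square)
      also have "\<dots> \<le> (1 + D) * x"
      proof (rule mult_right_mono)
        have "- ln x \<le> 1 / x - 1" using ln_le_minus_one[of "1 / x"] x by (simp add: ln_div)
        then have "- ln x * x \<le> (1 / x - 1) * x" using x by (intro mult_right_mono) auto
        then have "\<bar>ln x\<bar> * x \<le> 1" using x by (simp add: left_diff_distrib)
        moreover have "D * x \<le> D" using D x by (simp add: mult_left_le)
        ultimately show "(\<bar>ln x\<bar> + D) * x \<le> 1 + D" by (simp add: distrib_right)
      qed (use x in simp)
      finally show ?thesis by (simp add: b)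
    qed
    have "norm ((Ln z - a) * f z) \<le> (\<bar>ln x\<bar> + D) * (C * x ^ k)"
      unfolding norm_mult using l elim(3) D by (intro mult_mono) (auto simp: x_def norm_power)
    also have "\<dots> = C * ((\<bar>ln x\<bar> + D) * x ^ k)" by simp
    also have "\<dots> \<le> C * ((1 + D) * (x * (1 + b * \<bar>ln x\<bar>)))" using key C(1) by (intro mult_left_mono) auto
    finally show ?case using b by (subst norm_log_err) (auto simp: x_def mult_ac)
  qed
  then show ?thesis by (rule landau_o.bigI[rotated]) (use C D in auto)
qed

text \<open>Filling in the limit at the vertex gives a continuous function on the closed sector,
  hence a bounded one on its compact part.\<close>

lemma bounded_on_sector:
  fixes f :: "complex \<Rightarrow> complex"
  assumes cont: "continuous_on (sector \<tau> - {0}) f" and lim: "(f \<longlongrightarrow> L) (at 0 within sector \<tau>)"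
    and far: "\<And>z. z \<in> sector \<tau> \<Longrightarrow> R \<le> norm z \<Longrightarrow> norm (f z) \<le> B"
  obtains C where "\<And>z. z \<in> sector \<tau> \<Longrightarrow> z \<noteq> 0 \<Longrightarrow> norm (f z) \<le> C"
proof -
  define h where "h z = (if z = 0 then L else f z)" for z
  have "continuous_on (sector \<tau>) h"
    unfolding continuous_on_def
  proof
    fix z assume z: "z \<in> sector \<tau>"
    show "(h \<longlongrightarrow> h z) (at z within sector \<tau>)"
    proof (cases "z = 0")
      case True
      have "\<forall>\<^sub>F y in at 0 within sector \<tau>. f y = h y" by (simp add: h_def eventually_at_filter)
      with lim show ?thesis unfolding True by (simp add: h_def[of 0] tendsto_cong)
    next
      case False
      have "(f \<longlongrightarrow> f z) (at z within sector \<tau> - {0})" using cont z False by (simp add: continuous_on_def)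
      moreover have "at z within sector \<tau> - {0} = at z within sector \<tau>"
        by (rule at_within_nhd[of _ "- {0}"]) (use False in auto)
      ultimately have "(f \<longlongrightarrow> f z) (at z within sector \<tau>)" by simp
      moreover have "\<forall>\<^sub>F y in at z within sector \<tau>. f y = h y"
      proof -
        have "\<forall>\<^sub>F y in nhds z. y \<noteq> 0" using False by (rule t1_space_nhds)
        then show ?thesis unfolding eventually_at_filter by eventually_elim (simp add: h_def)
      qed
      ultimately show ?thesis using False by (simp add: h_def[of z] tendsto_cong)
    qed
  qed
  then have "compact (h ` (sector \<tau> \<inter> cball 0 R))"
    by (intro compact_continuous_image closed_Int_compact closed_sector) (auto intro: continuous_on_subset)
  then obtain M where M: "\<And>z. z \<in> sector \<tau> \<Longrightarrow> norm z \<le> R \<Longrightarrow> norm (h z) \<le> M"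
    using compact_imp_bounded bounded_iff by (metis IntI imageI mem_cball_0)
  show ?thesis
  proof (rule that[of "max M B"])
    fix z assume z: "z \<in> sector \<tau>" "z \<noteq> 0"
    then show "norm (f z) \<le> max M B"
      using M[OF z(1)] far[OF z(1)] by (cases "norm z \<le> R") (auto simp: h_def)
  qed
qed

section \<open>Continuation of K(z) - z across the positive axis\<close>

context friedrichs
begin

definition regular_half_plane :: "complex set" where
  "regular_half_plane = {z. 0 < Re z} \<inter> (\<Inter>i. \<Inter>j. {z. poly (rr i j) z \<noteq> 0})"

text \<open>Continuation of \<open>K(z) - z\<close> across \<open>(0, \<infinity>)\<close> from the upper (\<open>s = 1\<close>) and from the
  lower (\<open>s = -1\<close>) half plane.\<close>

definition Msec :: "real \<Rightarrow> complex \<Rightarrow> complex^'n^'n" where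
  "Msec s z = (\<chi> i j. (if i = j then of_real (w i) - z else 0)
     - of_real (lam\<^sup>2) * (cauchy_reg (pp i j) (rr i j) z - (Ln z - \<i> * of_real (s * pi)) * ratio (pp i j) (rr i j) z))"

lemma open_rr: "open {z. poly (rr i j) z \<noteq> 0}"
  by (intro open_Collect_neq continuous_intros)

lemma open_regular_half_plane: "open regular_half_plane"
  unfolding regular_half_plane_def
  by (intro open_Int open_INT ballI open_rr finite) (auto simp: open_halfspace_Re_gt)

lemma of_real_regular: "0 < x \<Longrightarrow> of_real x \<in> regular_half_plane"
  using ff_nz by (simp add: regular_half_plane_def)

lemma Msec_holomorphic: "(\<lambda>z. Msec s z $ i $ j) holomorphic_on regular_half_plane"
proof -
  have U: "regular_half_plane \<subseteq> {z. poly (rr i j) z \<noteq> 0}" "regular_half_plane \<inter> \<real>\<^sub>\<le>\<^sub>0 = {}"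
    by (auto simp: regular_half_plane_def complex_nonpos_Reals_iff)
  have "(\<lambda>z. (if i = j then of_real (w i) - z else 0)) holomorphic_on regular_half_plane"
    by (cases "i = j") (auto intro!: holomorphic_intros)
  then show ?thesis
    unfolding Msec_def vec_lambda_beta using U
    by (intro holomorphic_intros holomorphic_on_subset[OF ff.cauchy_reg_holomorphic] holomorphic_on_subset[OF ff.ratio_holomorphic]) auto
qed

text \<open>Ln(-z) equals Ln z - i\<pi> above the axis and Ln z + i\<pi> below it, so the sign of Im
  z selects the branch.\<close>

lemma Mmat_eq_Msec:
  assumes z: "z \<in> regular_half_plane" "Im z \<noteq> 0"
  shows "Mmat z = Msec (sgn (Im z)) z"
proof -
  have ne: "z \<notin> complex_of_real ` {0..}" using z by auto
  have "Ln (- z) = Ln z - \<i> * of_real (sgn (Im z) * pi)"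
    using z by (subst Ln_minus) (auto simp: sgn_if regular_half_plane_def)
  moreover have "self_energy v z i j = cauchy_reg (pp i j) (rr i j) z - Ln (- z) * ratio (pp i j) (rr i j) z" for i j
    unfolding self_energy_eq by (rule ff.cauchy_integral[OF _ ne]) (use z in \<open>auto simp: regular_half_plane_def\<close>)
  ultimately show ?thesis by (simp add: vec_eq_iff Mmat_entry Msec_def)
qed

lemma Kmat_0_entry: "Kmat w lam v 0 $ i $ j = (if i = j then of_real (w i) else 0) - of_real (lam\<^sup>2) * cauchy_reg (pp i j) (rr i j) 0"
  unfolding Kmat_def self_energy_eq ff.cauchy_integral_0 by simp

lemma PV_D_eq:
  assumes x: "0 < x"
  shows "PV_D v x i j = cauchy_reg (pp i j) (rr i j) (of_real x) - of_real (ln x) * ratio (pp i j) (rr i j) (of_real x)"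
proof -
  have "(LBINT s:{0<..} - {x - e..x + e}. cnj (v i s) * v j s / complex_of_real (s - x)) =
     (LBINT s:{0<..} - {x - e..x + e}. ratio (pp i j) (rr i j) (of_real s) / of_real (s - x))" for e
    by (rule vv_ratio_cong) auto
  then show ?thesis
    unfolding PV_D_def using ff.principal_value[OF x] by (simp only: tendsto_Lim[OF trivial_limit_at_right_real])
qed

text \<open>The principal value supplies B(x) - ln(x) \<Gamma>(x) and the shift of the logarithm the
  term with i\<pi>\<lambda>^2 \<Gamma>(x). Thus the standing assumption speaks about the
  continuations on the axis.\<close>

lemma Kpm_shift_eq_Msec:
  assumes "0 < x"
  shows "Kpm_shift w lam v pp rr s x = Msec s (of_real x)"
  using assms by (simp add: vec_eq_iff Kpm_shift_def Msec_def PV_D_eq Gam_eq_ratio Ln_of_real algebra_simps)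

text \<open>The terms z and B(z) - B(0) are O(z) in any case; the logarithm times \<Gamma> alone
  decides the error scale.\<close>

lemma Msec_diff_bigo:
  assumes f: "\<And>i j. ratio (pp i j) (rr i j) \<in> O[at 0 within S](\<lambda>z. z ^ k)" and k: "1 \<le> k" and b: "b = 1 \<or> b = 0 \<and> 2 \<le> k"
  shows "(\<lambda>z. Kmat w lam v 0 $ i $ j - Msec s z $ i $ j) \<in> O[at 0 within S](log_err b)"
proof -
  have b0: "0 \<le> b" using b by auto
  have "(\<lambda>z. if i = j then z else 0) \<in> O[at 0 within S](log_err b)"
    using id_bigo_log_err[OF b0] by (cases "i = j") auto
  moreover have "(\<lambda>z. cauchy_reg (pp i j) (rr i j) z - cauchy_reg (pp i j) (rr i j) 0) \<in> O[at 0 within S](log_err b)"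
    by (rule landau_o.big_trans[OF holomorphic_diff_bigo[OF ff.cauchy_reg_holomorphic open_rr] id_bigo_log_err[OF b0]])
      (use ff_nz[rule_format, of 0 i j] in simp)
  moreover have "(\<lambda>z. (Ln z - \<i> * of_real (s * pi)) * ratio (pp i j) (rr i j) z) \<in> O[at 0 within S](log_err b)"
    by (rule log_mult_bigo_log_err[OF f k b])
  ultimately have "(\<lambda>z. (if i = j then z else 0) + of_real (lam\<^sup>2) *
      ((cauchy_reg (pp i j) (rr i j) z - cauchy_reg (pp i j) (rr i j) 0) - (Ln z - \<i> * of_real (s * pi)) * ratio (pp i j) (rr i j) z))
      \<in> O[at 0 within S](log_err b)"
    using lam_nz by (intro sum_in_bigo) (auto intro!: sum_in_bigo)
  moreover have "Kmat w lam v 0 $ i $ j - Msec s z $ i $ j = (if i = j then z else 0) + of_real (lam\<^sup>2) *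
      ((cauchy_reg (pp i j) (rr i j) z - cauchy_reg (pp i j) (rr i j) 0) - (Ln z - \<i> * of_real (s * pi)) * ratio (pp i j) (rr i j) z)" for z
    by (simp add: Kmat_0_entry Msec_def algebra_simps)
  ultimately show ?thesis by simp
qed

lemma ratio_bigo_id: "ratio (pp i j) (rr i j) \<in> O[at 0 within S](\<lambda>z. z ^ 1)"
  using holomorphic_diff_bigo[OF ff.ratio_holomorphic open_rr, of i j S] ff_nz[rule_format, of 0 i j] by simp

text \<open>\<Gamma>(0) = 0 makes \<Gamma> at least O(z), which beats the logarithm at the branch
  point.\<close>

lemma Msec_tendsto: "((\<lambda>z. Msec s z $ i $ j) \<longlongrightarrow> Kmat w lam v 0 $ i $ j) (at 0 within S)"
proof -
  have "(\<lambda>z. Kmat w lam v 0 $ i $ j - Msec s z $ i $ j) \<in> O[at 0 within S](log_err 1)"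
    by (rule Msec_diff_bigo[OF ratio_bigo_id]) auto
  then obtain C where C: "\<forall>\<^sub>F z in at 0 within S. norm (Kmat w lam v 0 $ i $ j - Msec s z $ i $ j) \<le> C * norm (log_err 1 z)"
    by (elim landau_o.bigE)
  have "((\<lambda>z. Kmat w lam v 0 $ i $ j - Msec s z $ i $ j) \<longlongrightarrow> 0) (at 0 within S)"
    by (rule Lim_null_comparison[OF C]) (use tendsto_mult_right_zero[OF tendsto_norm_zero[OF log_err_tendsto_0]] in auto)
  then have "((\<lambda>z. Kmat w lam v 0 $ i $ j - (Kmat w lam v 0 $ i $ j - Msec s z $ i $ j)) \<longlongrightarrow> Kmat w lam v 0 $ i $ j - 0) (at 0 within S)"
    by (intro tendsto_intros)
  then show ?thesis by simp
qed

text \<open>The logarithm grows, but |ln x| \<le> x for x \<ge> 1 and \<Gamma> is O(1/x^2), so their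
  product stays bounded and the matrix is -z plus bounded entries.\<close>

lemma Msec_far_entry:
  "\<exists>\<kappa> R. 0 \<le> \<kappa> \<and> (\<forall>z. R \<le> norm z \<longrightarrow> poly (rr i j) z \<noteq> 0 \<and>
     (\<forall>s\<in>{1, -1}. norm (Msec s z $ i $ j + (if i = j then z else 0)) \<le> \<kappa>))"
proof -
  obtain B1 R1 where 1: "1 \<le> R1" "\<And>z. R1 \<le> norm z \<Longrightarrow> norm (cauchy_reg (pp i j) (rr i j) z) \<le> B1"
    using ff.cauchy_reg_bounded_far[of i j] by blast
  have r0: "rr i j \<noteq> 0" using ff.r_neq_0 .
  obtain B2 R2 where 2: "1 \<le> R2" "\<And>x. R2 \<le> norm x \<Longrightarrow> norm (poly (pp i j) x / poly (rr i j) x) \<le> B2 * norm x ^ degree (pp i j) / norm x ^ degree (rr i j)"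
    using poly_quotient_decay[OF r0] by blast
  obtain R3 where 3: "\<And>z. R3 \<le> norm z \<Longrightarrow> poly (rr i j) z \<noteq> 0"
  proof -
    have "finite {z. poly (rr i j) z = 0}" by (rule poly_roots_finite[OF r0])
    then have "bounded {z. poly (rr i j) z = 0}" by (rule finite_imp_bounded)
    then obtain b where "\<And>z. poly (rr i j) z = 0 \<Longrightarrow> norm z \<le> b" by (auto simp: bounded_iff)
    then show ?thesis using that[of "b + 1"] by fastforce
  qed
  define \<kappa> where "\<kappa> = \<bar>w i\<bar> + lam\<^sup>2 * (\<bar>B1\<bar> + (1 + 2 * pi) * \<bar>B2\<bar>)"
  have "norm (Msec s z $ i $ j + (if i = j then z else 0)) \<le> \<kappa>"
    if z: "R1 \<le> norm z" "R2 \<le> norm z" and s: "s \<in> {1, -1}" for s z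
  proof -
    define x where "x = norm z"
    have x: "1 \<le> x" "z \<noteq> 0" using 1(1) z by (auto simp: x_def)
    have rb: "norm (ratio (pp i j) (rr i j) z) \<le> \<bar>B2\<bar> / x\<^sup>2"
    proof -
      have "norm (ratio (pp i j) (rr i j) z) \<le> B2 * x ^ degree (pp i j) / x ^ degree (rr i j)"
        using 2(2)[OF z(2)] by (simp add: ratio_def x_def)
      also have "\<dots> \<le> \<bar>B2\<bar> * x ^ degree (pp i j) / x ^ degree (rr i j)"
        using x by (intro divide_right_mono mult_right_mono) auto
      also have "\<dots> \<le> \<bar>B2\<bar> * x ^ degree (pp i j) / x ^ (degree (pp i j) + 2)"
        using x ff_deg by (intro divide_left_mono power_increasing mult_pos_pos zero_less_power) auto
      also have "\<dots> = \<bar>B2\<bar> / x\<^sup>2" using x by (simp add: power_add power2_eq_square)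
      finally show ?thesis .
    qed
    have lb: "norm (Ln z - \<i> * of_real (s * pi)) \<le> x + 2 * pi"
    proof -
      have "norm (Ln z - \<i> * of_real (s * pi)) \<le> norm (Ln z) + norm (\<i> * of_real (s * pi))" by (rule norm_triangle_ineq4)
      also have "norm (\<i> * of_real (s * pi)) = pi" using s by (auto simp: norm_mult)
      also have "norm (Ln z) \<le> \<bar>ln x\<bar> + pi" using norm_Ln_le[OF x(2)] by (simp add: x_def)
      also have "\<bar>ln x\<bar> \<le> x" using x ln_le_minus_one[of x] by simp
      finally show ?thesis by simp
    qed
    have "norm ((Ln z - \<i> * of_real (s * pi)) * ratio (pp i j) (rr i j) z) \<le> (x + 2 * pi) * (\<bar>B2\<bar> / x\<^sup>2)"
      unfolding norm_mult using lb rb x by (intro mult_mono) auto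
    also have "\<dots> \<le> ((1 + 2 * pi) * x) * (\<bar>B2\<bar> / x\<^sup>2)"
      using x by (intro mult_right_mono) (auto simp: algebra_simps)
    also have "\<dots> = (1 + 2 * pi) * \<bar>B2\<bar> / x" using x by (simp add: power2_eq_square)
    also have "\<dots> \<le> (1 + 2 * pi) * \<bar>B2\<bar> / 1" using x by (intro divide_left_mono) (auto intro!: mult_nonneg_nonneg)
    finally have lr: "norm ((Ln z - \<i> * of_real (s * pi)) * ratio (pp i j) (rr i j) z) \<le> (1 + 2 * pi) * \<bar>B2\<bar>" by simp
    have cb: "norm (cauchy_reg (pp i j) (rr i j) z) \<le> \<bar>B1\<bar>" using 1(2)[OF z(1)] by linarith
    have "norm (Msec s z $ i $ j + (if i = j then z else 0)) = norm ((if i = j then of_real (w i) else 0) - of_real (lam\<^sup>2) * (cauchy_reg (pp i j) (rr i j) z - (Ln z - \<i> * of_real (s * pi)) * ratio (pp i j) (rr i j) z))"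
      by (simp add: Msec_def)
    also have "\<dots> \<le> norm (if i = j then complex_of_real (w i) else 0) + norm (of_real (lam\<^sup>2) * (cauchy_reg (pp i j) (rr i j) z - (Ln z - \<i> * of_real (s * pi)) * ratio (pp i j) (rr i j) z))"
      by (rule norm_triangle_ineq4)
    also have "\<dots> \<le> \<bar>w i\<bar> + lam\<^sup>2 * (\<bar>B1\<bar> + (1 + 2 * pi) * \<bar>B2\<bar>)"
    proof (rule add_mono)
      have "norm (cauchy_reg (pp i j) (rr i j) z - (Ln z - \<i> * of_real (s * pi)) * ratio (pp i j) (rr i j) z) \<le> \<bar>B1\<bar> + (1 + 2 * pi) * \<bar>B2\<bar>"
        by (rule order_trans[OF norm_triangle_ineq4 add_mono[OF cb lr]])
      then have "lam\<^sup>2 * norm (cauchy_reg (pp i j) (rr i j) z - (Ln z - \<i> * of_real (s * pi)) * ratio (pp i j) (rr i j) z) \<le> lam\<^sup>2 * (\<bar>B1\<bar> + (1 + 2 * pi) * \<bar>B2\<bar>)"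
        by (rule mult_left_mono) simp
      then show "norm (of_real (lam\<^sup>2) * (cauchy_reg (pp i j) (rr i j) z - (Ln z - \<i> * of_real (s * pi)) * ratio (pp i j) (rr i j) z)) \<le> lam\<^sup>2 * (\<bar>B1\<bar> + (1 + 2 * pi) * \<bar>B2\<bar>)"
        unfolding norm_mult norm_of_real by simp
    qed simp
    finally show ?thesis by (simp add: \<kappa>_def)
  qed
  moreover have "0 \<le> \<kappa>" by (simp add: \<kappa>_def)
  ultimately show ?thesis using 3 by (intro exI[of _ \<kappa>] exI[of _ "max R1 (max R2 R3)"]) auto
qed

lemma Msec_far:
  obtains \<kappa> R where "0 \<le> \<kappa>" "\<And>z. R \<le> norm z \<Longrightarrow> 0 < Re z \<Longrightarrow> z \<in> regular_half_plane"
    "\<And>z s i j. R \<le> norm z \<Longrightarrow> s \<in> {1, -1} \<Longrightarrow> norm (Msec s z $ i $ j + (if i = j then z else 0)) \<le> \<kappa>"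
proof -
  obtain \<kappa> R where kR: "\<And>i j. 0 \<le> \<kappa> i j" "\<And>i j z. R i j \<le> norm z \<Longrightarrow> poly (rr i j) z \<noteq> 0"
     "\<And>i j z s. R i j \<le> norm z \<Longrightarrow> s \<in> {1, -1} \<Longrightarrow> norm (Msec s z $ i $ j + (if i = j then z else 0)) \<le> \<kappa> i j"
    using Msec_far_entry by metis
  define K where "K = (\<Sum>i\<in>UNIV. \<Sum>j\<in>UNIV. \<kappa> i j)"
  define Q where "Q = (\<Sum>i\<in>UNIV. \<Sum>j\<in>UNIV. \<bar>R i j\<bar>)"
  have member: "a i j \<le> (\<Sum>i\<in>UNIV. \<Sum>j\<in>UNIV. a i j)" if "\<And>i j. 0 \<le> a i j" for a :: "'n \<Rightarrow> 'n \<Rightarrow> real" and i j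
  proof -
    have "a i j \<le> (\<Sum>j\<in>UNIV. a i j)" by (rule member_le_sum) (use that in auto)
    also have "\<dots> \<le> (\<Sum>i\<in>UNIV. \<Sum>j\<in>UNIV. a i j)"
      by (rule member_le_sum[of i UNIV "\<lambda>i. \<Sum>j\<in>UNIV. a i j"]) (use that in \<open>auto intro!: sum_nonneg\<close>)
    finally show ?thesis .
  qed
  have kK: "\<kappa> i j \<le> K" for i j unfolding K_def by (rule member) (rule kR(1))
  have RQ: "R i j \<le> Q" for i j using member[of "\<lambda>i j. \<bar>R i j\<bar>" i j] unfolding Q_def by linarith
  show ?thesis
  proof (rule that[of K Q])
    show "0 \<le> K" using kR(1) by (auto simp: K_def intro!: sum_nonneg)
    show "z \<in> regular_half_plane" if "Q \<le> norm z" "0 < Re z" for z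
      using kR(2) RQ that order_trans by (fastforce simp: regular_half_plane_def)
    show "norm (Msec s z $ i $ j + (if i = j then z else 0)) \<le> K" if "Q \<le> norm z" "s \<in> {1, -1}" for z s i j
      using kR(3)[OF order_trans[OF RQ that(1)] that(2)] kK order_trans by blast
  qed
qed

end

lemma bigo_sum:
  fixes f :: "'i \<Rightarrow> 'b \<Rightarrow> complex"
  assumes "\<And>i. i \<in> A \<Longrightarrow> f i \<in> O[F](g)"
  shows "(\<lambda>x. \<Sum>i\<in>A. f i x) \<in> O[F](g)"
proof (cases "finite A")
  case True
  then show ?thesis using assms by (induction A) (auto intro!: sum_in_bigo)
qed simp

lemma eventually_within_iff_norm:
  "eventually P (at (0::complex) within S) \<longleftrightarrow> (\<exists>d>0. \<forall>z\<in>S. z \<noteq> 0 \<and> norm z < d \<longrightarrow> P z)"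
  by (simp add: eventually_at)

text \<open>Taylor's formula on a small closed disc, with the remainder controlled by the (k+1)-st
  derivative; since p(0) = 0 and the lower coefficients vanish, only the term of order k
  remains.\<close>

lemma ratio_taylor:
  assumes "poly r 0 \<noteq> 0" and k: "1 \<le> k" and p0: "poly p 0 = 0"
    and low: "\<And>j. 1 \<le> j \<Longrightarrow> j < k \<Longrightarrow> (deriv ^^ j) (ratio p r) 0 = 0"
  shows "(\<lambda>z. ratio p r z - (deriv ^^ k) (ratio p r) 0 / fact k * z ^ k) \<in> O[at 0 within T](\<lambda>z. z ^ (k + 1))"
proof -
  define S where "S = {z. poly r z \<noteq> 0}"
  have S: "open S" unfolding S_def by (intro open_Collect_neq continuous_intros)
  have hol: "ratio p r holomorphic_on S" unfolding ratio_def[abs_def] S_def by (intro holomorphic_intros) auto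
  have "0 \<in> S" using assms(1) by (simp add: S_def)
  then obtain e where e: "0 < e" "cball 0 e \<subseteq> S" using S open_contains_cball by blast
  have holn: "(deriv ^^ i) (ratio p r) holomorphic_on S" for i
    by (rule holomorphic_higher_deriv[OF hol S])
  have "compact ((deriv ^^ (Suc k)) (ratio p r) ` cball 0 e)"
    by (intro compact_continuous_image continuous_on_subset[OF holomorphic_on_imp_continuous_on[OF holn] e(2)]) simp
  then obtain B where B: "\<And>z. z \<in> cball 0 e \<Longrightarrow> norm ((deriv ^^ (Suc k)) (ratio p r) z) \<le> B"
    using compact_imp_bounded bounded_iff by (metis imageI)
  have est: "norm (ratio p r z - (deriv ^^ k) (ratio p r) 0 / fact k * z ^ k) \<le> B / fact k * norm (z ^ (k + 1))" if z: "z \<in> cball 0 e" for z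
  proof -
    have "norm ((deriv ^^ 0) (ratio p r) z - (\<Sum>i\<le>k. (deriv ^^ i) (ratio p r) 0 * (z - 0) ^ i / fact i)) \<le> B * norm (z - 0) ^ (Suc k) / fact k"
    proof (rule complex_Taylor[of "cball 0 e"])
      fix i :: nat and x :: complex assume x: "x \<in> cball 0 e"
      then have "(deriv ^^ i) (ratio p r) field_differentiable at x"
        using holn S e(2) by (meson holomorphic_on_imp_differentiable_at subsetD)
      then show "((deriv ^^ i) (ratio p r) has_field_derivative (deriv ^^ (Suc i)) (ratio p r) x) (at x within cball 0 e)"
        by (simp add: DERIV_deriv_iff_field_differentiable has_field_derivative_at_within)
    qed (use B e z in auto)
    moreover have "(\<Sum>i\<le>k. (deriv ^^ i) (ratio p r) 0 * (z - 0) ^ i / fact i) = (\<Sum>i\<in>{k}. (deriv ^^ i) (ratio p r) 0 * (z - 0) ^ i / fact i)"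
    proof (rule sum.mono_neutral_right)
      show "\<forall>i\<in>{..k} - {k}. (deriv ^^ i) (ratio p r) 0 * (z - 0) ^ i / fact i = 0"
      proof
        fix i assume "i \<in> {..k} - {k}"
        then show "(deriv ^^ i) (ratio p r) 0 * (z - 0) ^ i / fact i = 0"
          using low[of i] p0 by (cases "i = 0") (auto simp: ratio_def)
      qed
    qed auto
    ultimately show ?thesis by (simp add: norm_mult norm_power)
  qed
  show ?thesis
  proof (rule landau_o.bigI[of "max 1 (B / fact k)"])
    have "\<forall>\<^sub>F z in at 0 within T. z \<in> cball 0 e"
      using e unfolding eventually_at by (intro exI[of _ e]) (auto simp: dist_commute)
    then show "\<forall>\<^sub>F z in at 0 within T. norm (ratio p r z - (deriv ^^ k) (ratio p r) 0 / fact k * z ^ k) \<le> max 1 (B / fact k) * norm (z ^ (k + 1))"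
    proof eventually_elim
      case (elim z)
      have "B / fact k * norm (z ^ (k + 1)) \<le> max 1 (B / fact k) * norm (z ^ (k + 1))" by (intro mult_right_mono) auto
      then show ?case using est[OF elim] by linarith
    qed
  qed simp
qed

lemma zero_notin_interior_lower_wedge: "0 \<notin> interior (lower_wedge \<tau>)"
proof
  assume "0 \<in> interior (lower_wedge \<tau>)"
  then obtain e where e: "0 < e" "ball 0 e \<subseteq> lower_wedge \<tau>" by (auto simp: mem_interior)
  have "\<i> * of_real (e / 2) \<in> ball 0 e" using e by (simp add: norm_mult)
  then have "\<i> * of_real (e / 2) \<in> lower_wedge \<tau>" using e by blast
  then show False using e by (simp add: lower_wedge_def)
qed

text \<open>The product \<phi> of both determinants is treated as one function. It is nonzero on the
  axis by the standing assumption, near 0 because both matrices tend to K(0), and far out because -z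
  dominates.\<close>

lemma (in friedrichs) ex_regular_sector:
  assumes standing: "\<forall>x::real. 0 < x \<longrightarrow> (\<forall>s\<in>{1, -1}. det (Kpm_shift w lam v pp rr s x) \<noteq> 0)"
    and regular: "det (Kmat w lam v 0) \<noteq> 0"
  shows "\<exists>\<tau>. 0 < \<tau> \<and> \<tau> \<le> 1 \<and> (\<forall>z\<in>sector \<tau>. z \<noteq> 0 \<longrightarrow> z \<in> regular_half_plane \<and> (\<forall>s\<in>{1, -1}. det (Msec s z) \<noteq> 0))"
proof -
  define \<phi> where "\<phi> z = det (Msec 1 z) * det (Msec (-1) z)" for z
  have \<phi>c: "continuous_on regular_half_plane \<phi>"
    unfolding \<phi>_def by (intro holomorphic_on_imp_continuous_on holomorphic_intros holomorphic_on_det Msec_holomorphic)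
  have pos: "of_real x \<in> regular_half_plane \<and> \<phi> (of_real x) \<noteq> 0" if "0 < x" for x
    using standing that of_real_regular by (simp add: \<phi>_def Kpm_shift_eq_Msec)
  have det_near: "\<forall>\<^sub>F z in at 0 within sector 1. det (Msec s z) \<noteq> 0" for s
    by (rule tendsto_imp_eventually_ne[OF tendsto_det[OF Msec_tendsto] regular])
  have "open (\<Inter>i. \<Inter>j. {z. poly (rr i j) z \<noteq> 0})" by (intro open_INT ballI open_rr finite)
  moreover have "0 \<in> (\<Inter>i. \<Inter>j. {z. poly (rr i j) z \<noteq> 0})" using ff_nz[rule_format, of 0] by simp
  ultimately have "\<forall>\<^sub>F z in at 0 within sector 1. z \<in> (\<Inter>i. \<Inter>j. {z. poly (rr i j) z \<noteq> 0})"
    unfolding eventually_at_filter by (rule eventually_mono[OF eventually_nhds_in_open]) simp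
  then have "\<forall>\<^sub>F z in at 0 within sector 1. z \<in> (\<Inter>i. \<Inter>j. {z. poly (rr i j) z \<noteq> 0}) \<and> \<phi> z \<noteq> 0"
    using det_near[of 1] det_near[of "-1"] by eventually_elim (simp add: \<phi>_def)
  then obtain \<delta> where \<delta>: "0 < \<delta>" "\<And>z. z \<in> sector 1 \<Longrightarrow> z \<noteq> 0 \<Longrightarrow> norm z < \<delta> \<Longrightarrow> z \<in> (\<Inter>i. \<Inter>j. {z. poly (rr i j) z \<noteq> 0}) \<and> \<phi> z \<noteq> 0"
    unfolding eventually_within_iff_norm by blast
  have near: "z \<in> regular_half_plane \<and> \<phi> z \<noteq> 0" if "z \<in> sector 1" "z \<noteq> 0" "norm z < \<delta>" for z
    using \<delta>(2)[OF that] sector_Re_pos[OF _ that(1,2)] by (simp add: regular_half_plane_def)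
  obtain \<kappa> R where R: "0 \<le> \<kappa>" "\<And>z. R \<le> norm z \<Longrightarrow> 0 < Re z \<Longrightarrow> z \<in> regular_half_plane"
    "\<And>z s i j. R \<le> norm z \<Longrightarrow> s \<in> {1, -1} \<Longrightarrow> norm (Msec s z $ i $ j + (if i = j then z else 0)) \<le> \<kappa>"
    using Msec_far by blast
  define Q where "Q = max R (max 1 (2 * (real CARD('n) * \<kappa>)))"
  have far: "z \<in> regular_half_plane \<and> \<phi> z \<noteq> 0" if "z \<in> sector 1" "Q \<le> norm z" for z
  proof -
    have z: "R \<le> norm z" "1 \<le> norm z" "real CARD('n) * \<kappa> \<le> norm z / 2" using that by (auto simp: Q_def)
    then have z0: "z \<noteq> 0" by auto
    have "det (Msec s z) \<noteq> 0" if s: "s \<in> {1, -1}" for s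
    proof (rule det_nonzeroI)
      fix x assume x: "Msec s z *v x = 0"
      have "norm z / 2 * (\<Sum>i\<in>UNIV. norm (x $ i)) \<le> (\<Sum>i\<in>UNIV. norm ((Msec s z *v x) $ i))"
        by (rule shifted_matrix_lower_bound[OF R(3)[OF z(1) s] z(3)])
      then have "norm z * (\<Sum>i\<in>UNIV. norm (x $ i)) \<le> 0" by (simp add: x)
      then have "(\<Sum>i\<in>UNIV. norm (x $ i)) \<le> 0" using z0 by (simp add: mult_le_0_iff)
      moreover have "0 \<le> (\<Sum>i\<in>UNIV. norm (x $ i))" by (intro sum_nonneg) simp
      ultimately have "(\<Sum>i\<in>UNIV. norm (x $ i)) = 0" by linarith
      then show "x = 0" by (simp add: sum_nonneg_eq_0_iff vec_eq_iff)
    qed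
    then show ?thesis using R(2)[OF z(1)] sector_Re_pos[OF _ that(1) z0] by (simp add: \<phi>_def)
  qed
  obtain \<tau> where "0 < \<tau>" "\<tau> \<le> 1" "\<And>z. z \<in> sector \<tau> \<Longrightarrow> z \<noteq> 0 \<Longrightarrow> z \<in> regular_half_plane \<and> \<phi> z \<noteq> 0"
    using sector_nonvanishing[OF open_regular_half_plane \<phi>c pos near \<delta>(1) far] by blast
  then show ?thesis by (intro exI[of _ \<tau>]) (simp add: \<phi>_def)
qed

section \<open>The continued spectral density on a regular sector\<close>

locale friedrichs_sector = friedrichs w lam v pp rr
  for w :: "'n::finite \<Rightarrow> real" and lam v pp rr +
  fixes \<tau> :: real
  assumes \<tau>: "0 < \<tau>" "\<tau> \<le> 1"
    and sector_regular: "\<And>z. z \<in> sector \<tau> \<Longrightarrow> z \<noteq> 0 \<Longrightarrow> z \<in> regular_half_plane"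
    and sector_det: "\<And>s z. s \<in> {1, -1} \<Longrightarrow> z \<in> sector \<tau> \<Longrightarrow> z \<noteq> 0 \<Longrightarrow> det (Msec s z) \<noteq> 0"
    and regular: "det (Kmat w lam v 0) \<noteq> 0"
begin

definition Rsec :: "real \<Rightarrow> complex \<Rightarrow> complex^'n^'n" where
  "Rsec s z = matrix_inv (Msec s z)"

abbreviation K0inv :: "complex^'n^'n" where
  "K0inv \<equiv> matrix_inv (Kmat w lam v 0)"

text \<open>Both resolvents are continued off the axis, so for Im z \<noteq> 0 one of them is
  evaluated on the second sheet: the one with index -1 above the axis, the one with index 1 below.
  This makes the product holomorphic across the positive axis.\<close>

definition gfun :: "'n \<Rightarrow> 'n \<Rightarrow> complex \<Rightarrow> complex" where
  "gfun m n z = of_real (lam\<^sup>2) * (\<Sum>a\<in>UNIV. \<Sum>b\<in>UNIV. Rsec 1 z $ m $ a * ratio (pp a b) (rr a b) z * Rsec (-1) z $ b $ n)"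

lemma Rsec_continuous:
  assumes s: "s \<in> {1, -1}"
  shows "continuous_on (sector \<tau> - {0}) (\<lambda>z. Rsec s z $ i $ j)"
  unfolding Rsec_def
proof (rule continuous_on_matrix_inv)
  show "continuous_on (sector \<tau> - {0}) (\<lambda>z. Msec s z $ i $ j)" for i j
    by (rule continuous_on_subset[OF holomorphic_on_imp_continuous_on[OF Msec_holomorphic]]) (use sector_regular in auto)
qed (use sector_det[OF s] in auto)

lemma interior_lower_wedge_subset: "interior (lower_wedge \<tau>) \<subseteq> sector \<tau> - {0}"
  using lower_wedge_subset_sector[OF \<tau>(1)] interior_subset[of "lower_wedge \<tau>"] zero_notin_interior_lower_wedge by blast

lemma Rsec_holomorphic:
  assumes s: "s \<in> {1, -1}"
  shows "(\<lambda>z. Rsec s z $ i $ j) holomorphic_on interior (lower_wedge \<tau>)"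
  unfolding Rsec_def
proof (rule holomorphic_on_matrix_inv)
  show "(\<lambda>z. Msec s z $ i $ j) holomorphic_on interior (lower_wedge \<tau>)" for i j
    by (rule holomorphic_on_subset[OF Msec_holomorphic]) (use sector_regular interior_lower_wedge_subset in auto)
qed (use sector_det[OF s] interior_lower_wedge_subset in auto)

lemma Rsec_tendsto: "((\<lambda>z. Rsec s z $ i $ j) \<longlongrightarrow> K0inv $ i $ j) (at 0 within S)"
  unfolding Rsec_def by (rule tendsto_matrix_inv[OF Msec_tendsto regular])

text \<open>Near 0 the entry has a limit. Far out, a column of the inverse is mapped to a unit
  vector, and |z|/2 \<ge> 1 in the lower bound for the shifted matrix limits its l1 norm to
  1.\<close>

lemma Rsec_bounded:
  assumes s: "s \<in> {1, -1}"
  shows "\<exists>C\<ge>0. \<forall>z\<in>sector \<tau>. z \<noteq> 0 \<longrightarrow> norm (Rsec s z $ i $ j) \<le> C"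
proof -
  obtain \<kappa> R where R: "0 \<le> \<kappa>" "\<And>z s i j. R \<le> norm z \<Longrightarrow> s \<in> {1, -1} \<Longrightarrow> norm (Msec s z $ i $ j + (if i = j then z else 0)) \<le> \<kappa>"
    using Msec_far by metis
  define Q where "Q = max R (max 2 (2 * (real CARD('n) * \<kappa>)))"
  have far: "norm (Rsec s z $ i $ j) \<le> 1" if z: "z \<in> sector \<tau>" "Q \<le> norm z" for z
  proof -
    have z': "R \<le> norm z" "2 \<le> norm z" "real CARD('n) * \<kappa> \<le> norm z / 2" using z by (auto simp: Q_def)
    then have z0: "z \<noteq> 0" by auto
    define x :: "complex^'n" where "x = (\<chi> k. Rsec s z $ k $ j)"
    have "Msec s z *v x = (\<chi> k. if k = j then 1 else 0)"
    proof -
      have "(Msec s z *v x) $ k = (Msec s z ** Rsec s z) $ k $ j" for k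
        by (simp add: matrix_vector_mult_def matrix_matrix_mult_def x_def)
      then show ?thesis
        using matrix_inv_mult(1)[OF sector_det[OF s z(1) z0]] by (simp add: vec_eq_iff Rsec_def mat_def)
    qed
    then have "(\<Sum>k\<in>UNIV. norm ((Msec s z *v x) $ k)) = 1"
      by (simp add: if_distrib[of norm] cong: if_cong)
    moreover have "norm z / 2 * (\<Sum>i\<in>UNIV. norm (x $ i)) \<le> (\<Sum>i\<in>UNIV. norm ((Msec s z *v x) $ i))"
      by (rule shifted_matrix_lower_bound[OF R(2)[OF z'(1) s] z'(3)])
    moreover have "1 * (\<Sum>i\<in>UNIV. norm (x $ i)) \<le> norm z / 2 * (\<Sum>i\<in>UNIV. norm (x $ i))"
      using z'(2) by (intro mult_right_mono sum_nonneg) auto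
    moreover have "norm (x $ i) \<le> (\<Sum>i\<in>UNIV. norm (x $ i))" by (rule member_le_sum) auto
    ultimately show ?thesis by (simp add: x_def)
  qed
  obtain C where "\<And>z. z \<in> sector \<tau> \<Longrightarrow> z \<noteq> 0 \<Longrightarrow> norm (Rsec s z $ i $ j) \<le> C"
    using bounded_on_sector[OF Rsec_continuous[OF s] Rsec_tendsto far] by blast
  then show ?thesis by (intro exI[of _ "max 0 C"]) (auto intro: max.coboundedI2)
qed

lemma rr_sector: "z \<in> sector \<tau> \<Longrightarrow> poly (rr a b) z \<noteq> 0"
  using sector_regular[of z] ff_nz[rule_format, of 0 a b] by (cases "z = 0") (auto simp: regular_half_plane_def)

lemma Rsec_jump:
  assumes z: "z \<in> sector \<tau>" "z \<noteq> 0"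
  shows "Rsec 1 z $ m $ n - Rsec (-1) z $ m $ n = 2 * \<i> * pi * gfun m n z"
proof -
  have M: "Rsec 1 z - Rsec (-1) z = Rsec 1 z ** (Msec (-1) z - Msec 1 z) ** Rsec (-1) z"
    unfolding Rsec_def by (rule matrix_inv_diff) (use sector_det[OF _ z] in auto)
  have "Rsec 1 z $ m $ n - Rsec (-1) z $ m $ n = (Rsec 1 z ** (Msec (-1) z - Msec 1 z) ** Rsec (-1) z) $ m $ n"
    using arg_cong[OF M, of "\<lambda>A. A $ m $ n"] by (simp only: vector_minus_component)
  also have "\<dots> = (\<Sum>a\<in>UNIV. \<Sum>b\<in>UNIV. Rsec 1 z $ m $ a * (Msec (-1) z - Msec 1 z) $ a $ b * Rsec (-1) z $ b $ n)"
    by (rule triple_product_entry)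
  finally have eq: "Rsec 1 z $ m $ n - Rsec (-1) z $ m $ n = (\<Sum>a\<in>UNIV. \<Sum>b\<in>UNIV. Rsec 1 z $ m $ a * (Msec (-1) z - Msec 1 z) $ a $ b * Rsec (-1) z $ b $ n)" .
  have D: "(Msec (-1) z - Msec 1 z) $ a $ b = 2 * \<i> * pi * of_real (lam\<^sup>2) * ratio (pp a b) (rr a b) z" for a b
    by (simp add: Msec_def algebra_simps)
  show ?thesis unfolding eq D by (simp add: gfun_def sum_distrib_left mult_ac)
qed

lemma gfun_0 [simp]: "gfun m n 0 = 0" by (simp add: gfun_def)

text \<open>The resolvents are bounded, so the quadratic decay is that of \<Gamma>.\<close>

lemma gfun_bound: "\<exists>C. \<forall>z\<in>sector \<tau>. norm (gfun m n z) \<le> C / (1 + (norm z)\<^sup>2)"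
proof -
  have "\<exists>C. \<forall>z\<in>sector \<tau>. norm (ratio (pp a b) (rr a b) z) \<le> C / (1 + (norm z)\<^sup>2)" for a b
    using ff.ratio_decay[OF closed_sector rr_sector, of \<tau> a b] by metis
  then obtain G where G: "\<And>a b z. z \<in> sector \<tau> \<Longrightarrow> norm (ratio (pp a b) (rr a b) z) \<le> G a b / (1 + (norm z)\<^sup>2)"
    by metis
  obtain C1 where C1: "\<And>a. 0 \<le> C1 a" "\<And>a z. z \<in> sector \<tau> \<Longrightarrow> z \<noteq> 0 \<Longrightarrow> norm (Rsec 1 z $ m $ a) \<le> C1 a"
    using Rsec_bounded[of 1 m] by (metis insertI1)
  obtain C2 where C2: "\<And>b. 0 \<le> C2 b" "\<And>b z. z \<in> sector \<tau> \<Longrightarrow> z \<noteq> 0 \<Longrightarrow> norm (Rsec (-1) z $ b $ n) \<le> C2 b"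
    using Rsec_bounded[of "-1" _ n] by (metis insertI1 insert_commute)
  define C where "C = lam\<^sup>2 * (\<Sum>a\<in>UNIV. \<Sum>b\<in>UNIV. C1 a * G a b * C2 b)"
  have main: "norm (gfun m n z) \<le> C / (1 + (norm z)\<^sup>2)" if z: "z \<in> sector \<tau>" "z \<noteq> 0" for z
  proof -
    have "norm (gfun m n z) = lam\<^sup>2 * norm (\<Sum>a\<in>UNIV. \<Sum>b\<in>UNIV. Rsec 1 z $ m $ a * ratio (pp a b) (rr a b) z * Rsec (-1) z $ b $ n)"
      unfolding gfun_def norm_mult norm_of_real by simp
    also have "\<dots> \<le> lam\<^sup>2 * (\<Sum>a\<in>UNIV. \<Sum>b\<in>UNIV. C1 a * (G a b / (1 + (norm z)\<^sup>2)) * C2 b)"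
    proof (rule mult_left_mono)
      show "norm (\<Sum>a\<in>UNIV. \<Sum>b\<in>UNIV. Rsec 1 z $ m $ a * ratio (pp a b) (rr a b) z * Rsec (-1) z $ b $ n) \<le> (\<Sum>a\<in>UNIV. \<Sum>b\<in>UNIV. C1 a * (G a b / (1 + (norm z)\<^sup>2)) * C2 b)"
      proof (intro order_trans[OF norm_sum] sum_mono)
        fix a b
        show "norm (Rsec 1 z $ m $ a * ratio (pp a b) (rr a b) z * Rsec (-1) z $ b $ n) \<le> C1 a * (G a b / (1 + (norm z)\<^sup>2)) * C2 b"
          unfolding norm_mult
          by (intro mult_mono C1 C2 z G mult_nonneg_nonneg order_trans[OF norm_ge_zero G[OF z(1)]]) auto
      qed
    qed simp
    also have "\<dots> = C / (1 + (norm z)\<^sup>2)" by (simp add: C_def sum_divide_distrib[symmetric])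
    finally show ?thesis .
  qed
  show ?thesis
  proof (intro exI[of _ "max 0 C"] ballI)
    fix z assume z: "z \<in> sector \<tau>"
    have "C / (1 + (norm z)\<^sup>2) \<le> max 0 C / (1 + (norm z)\<^sup>2)" by (intro divide_right_mono) auto
    then show "norm (gfun m n z) \<le> max 0 C / (1 + (norm z)\<^sup>2)"
      using main[OF z] by (cases "z = 0") auto
  qed
qed

lemma ratio_continuous: "continuous_on (sector \<tau>) (ratio (pp a b) (rr a b))"
  by (rule continuous_on_subset[OF holomorphic_on_imp_continuous_on[OF ff.ratio_holomorphic]]) (use rr_sector in auto)

lemma gfun_continuous: "continuous_on (sector \<tau>) (gfun m n)"
  unfolding continuous_on_def
proof
  fix z assume z: "z \<in> sector \<tau>"
  have r: "(ratio (pp a b) (rr a b) \<longlongrightarrow> ratio (pp a b) (rr a b) z) (at z within sector \<tau>)" for a b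
    using ratio_continuous z by (simp add: continuous_on_def)
  show "(gfun m n \<longlongrightarrow> gfun m n z) (at z within sector \<tau>)"
  proof (cases "z = 0")
    case True
    have "((\<lambda>z. of_real (lam\<^sup>2) * (\<Sum>a\<in>UNIV. \<Sum>b\<in>UNIV. Rsec 1 z $ m $ a * ratio (pp a b) (rr a b) z * Rsec (-1) z $ b $ n)) \<longlongrightarrow>
       of_real (lam\<^sup>2) * (\<Sum>a\<in>UNIV. \<Sum>b\<in>UNIV. K0inv $ m $ a * ratio (pp a b) (rr a b) 0 * K0inv $ b $ n)) (at 0 within sector \<tau>)"
      by (intro tendsto_mult tendsto_const tendsto_sum Rsec_tendsto r[unfolded True])
    then show ?thesis unfolding True by (simp add: gfun_def[abs_def])
  next
    case False
    have w: "at z within sector \<tau> - {0} = at z within sector \<tau>"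
      by (rule at_within_nhd[of _ "- {0}"]) (use False in auto)
    have "((\<lambda>y. Rsec s y $ i $ j) \<longlongrightarrow> Rsec s z $ i $ j) (at z within sector \<tau>)" if "s \<in> {1, -1}" for s i j
      using Rsec_continuous[OF that, of i j] z False unfolding continuous_on_def w[symmetric] by blast
    then show ?thesis unfolding gfun_def[abs_def]
      by (intro tendsto_mult tendsto_const tendsto_sum r) auto
  qed
qed

lemma gfun_holomorphic: "gfun m n holomorphic_on interior (lower_wedge \<tau>)"
proof -
  have "ratio (pp a b) (rr a b) holomorphic_on interior (lower_wedge \<tau>)" for a b
    by (rule holomorphic_on_subset[OF ff.ratio_holomorphic]) (use rr_sector interior_lower_wedge_subset in auto)
  then show ?thesis unfolding gfun_def[abs_def] by (intro holomorphic_intros Rsec_holomorphic) auto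
qed

lemma Rsec_diff_bigo:
  assumes f: "\<And>i j. ratio (pp i j) (rr i j) \<in> O[at 0 within sector \<tau>](\<lambda>z. z ^ k)" and k: "1 \<le> k" and b: "b = 1 \<or> b = 0 \<and> 2 \<le> k"
    and s: "s \<in> {1, -1}"
  shows "(\<lambda>z. Rsec s z $ i $ j - K0inv $ i $ j) \<in> O[at 0 within sector \<tau>](log_err b)"
proof -
  have R1: "(\<lambda>z. Rsec s z $ i $ a) \<in> O[at 0 within sector \<tau>](\<lambda>_. 1)" for i a
    by (rule bigoI_tendsto[where c = "K0inv $ i $ a"]) (use Rsec_tendsto in auto)
  have "(\<lambda>z. Rsec s z $ i $ a * (Kmat w lam v 0 $ a $ c - Msec s z $ a $ c) * K0inv $ c $ j) \<in> O[at 0 within sector \<tau>](\<lambda>z. 1 * log_err b z * 1)" for a c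
    by (intro landau_o.big.mult R1 Msec_diff_bigo[OF f k b]) simp
  then have "(\<lambda>z. \<Sum>a\<in>UNIV. \<Sum>c\<in>UNIV. Rsec s z $ i $ a * (Kmat w lam v 0 $ a $ c - Msec s z $ a $ c) * K0inv $ c $ j) \<in> O[at 0 within sector \<tau>](log_err b)"
    by (intro bigo_sum) simp
  moreover have "\<forall>\<^sub>F z in at 0 within sector \<tau>. Rsec s z $ i $ j - K0inv $ i $ j = (\<Sum>a\<in>UNIV. \<Sum>c\<in>UNIV. Rsec s z $ i $ a * (Kmat w lam v 0 $ a $ c - Msec s z $ a $ c) * K0inv $ c $ j)"
    unfolding eventually_within_iff_norm
  proof (intro exI[of _ 1] conjI ballI impI)
    fix z assume z: "z \<in> sector \<tau>" "z \<noteq> 0 \<and> norm z < 1"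
    have M: "Rsec s z - K0inv = Rsec s z ** (Kmat w lam v 0 - Msec s z) ** K0inv"
      unfolding Rsec_def by (rule matrix_inv_diff[OF _ regular], rule sector_det[OF s z(1)]) (use z(2) in blast)
    have "Rsec s z $ i $ j - K0inv $ i $ j = (Rsec s z ** (Kmat w lam v 0 - Msec s z) ** K0inv) $ i $ j"
      using arg_cong[OF M, of "\<lambda>A. A $ i $ j"] by (simp only: vector_minus_component)
    then show "Rsec s z $ i $ j - K0inv $ i $ j = (\<Sum>a\<in>UNIV. \<Sum>c\<in>UNIV. Rsec s z $ i $ a * (Kmat w lam v 0 $ a $ c - Msec s z $ a $ c) * K0inv $ c $ j)"
      unfolding triple_product_entry by simp
  qed simp
  ultimately show ?thesis by (simp only: landau_o.big.in_cong)
qed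

text \<open>Each resolvent contributes a relative error \<open>log_err b\<close>, multiplied by
  \<Gamma> = O(z^k); the Taylor error z^(k+1) is covered by the same scale.\<close>

lemma gfun_expansion_bigo:
  fixes \<Gamma> :: "complex^'n^'n"
  assumes rat: "\<And>i j. (\<lambda>z. ratio (pp i j) (rr i j) z - \<Gamma> $ i $ j * z ^ k) \<in> O[at 0 within sector \<tau>](\<lambda>z. z ^ (k + 1))"
    and k: "1 \<le> k" and b: "b = 1 \<or> b = 0 \<and> 2 \<le> k"
  shows "(\<lambda>z. gfun m n z - of_real (lam\<^sup>2) * (K0inv ** \<Gamma> ** K0inv) $ m $ n * z ^ k) \<in> O[at 0 within sector \<tau>](\<lambda>z. z ^ k * log_err b z)"
proof -
  let ?F = "at (0::complex) within sector \<tau>"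
  have b0: "0 \<le> b" using b by auto
  have zk1: "(\<lambda>z. z ^ (k + 1)) \<in> O[?F](\<lambda>z. z ^ k * log_err b z)"
  proof -
    have "(\<lambda>z. z ^ k * z) \<in> O[?F](\<lambda>z. z ^ k * log_err b z)"
      by (intro landau_o.big.mult id_bigo_log_err[OF b0]) simp
    then show ?thesis by (simp add: mult.commute)
  qed
  have rat': "ratio (pp i j) (rr i j) \<in> O[?F](\<lambda>z. z ^ k)" for i j
  proof -
    have "(\<lambda>z::complex. z ^ k * z) \<in> O[?F](\<lambda>z. z ^ k * 1)"
    proof (intro landau_o.big.mult)
      show "(\<lambda>z::complex. z) \<in> O[?F](\<lambda>_. 1)"
        by (rule landau_o.bigI[of 1]) (auto simp: eventually_within_iff_norm intro: exI[of _ 1])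
    qed simp
    then have "(\<lambda>z. ratio (pp i j) (rr i j) z - \<Gamma> $ i $ j * z ^ k) \<in> O[?F](\<lambda>z. z ^ k)"
      using landau_o.big_trans[OF rat] by (simp add: mult.commute)
    moreover have "(\<lambda>z. \<Gamma> $ i $ j * z ^ k) \<in> O[?F](\<lambda>z. z ^ k)" by simp
    ultimately have "(\<lambda>z. (ratio (pp i j) (rr i j) z - \<Gamma> $ i $ j * z ^ k) + \<Gamma> $ i $ j * z ^ k) \<in> O[?F](\<lambda>z. z ^ k)"
      by (rule sum_in_bigo(1))
    then show ?thesis by simp
  qed
  have R1: "(\<lambda>z. Rsec s z $ i $ a) \<in> O[?F](\<lambda>_. 1)" for s i a
    by (rule bigoI_tendsto[where c = "K0inv $ i $ a"]) (use Rsec_tendsto in auto)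
  note Rd = Rsec_diff_bigo[OF rat' k b]
  have t: "(\<lambda>z. Rsec 1 z $ m $ a * ratio (pp a c) (rr a c) z * Rsec (-1) z $ c $ n - K0inv $ m $ a * (\<Gamma> $ a $ c * z ^ k) * K0inv $ c $ n) \<in> O[?F](\<lambda>z. z ^ k * log_err b z)" for a c
  proof -
    have "(\<lambda>z. ratio (pp a c) (rr a c) z * (Rsec 1 z $ m $ a - K0inv $ m $ a) * Rsec (-1) z $ c $ n) \<in> O[?F](\<lambda>z. z ^ k * log_err b z * 1)"
      by (intro landau_o.big.mult Rd rat' R1) auto
    then have t1: "(\<lambda>z. ratio (pp a c) (rr a c) z * (Rsec 1 z $ m $ a - K0inv $ m $ a) * Rsec (-1) z $ c $ n) \<in> O[?F](\<lambda>z. z ^ k * log_err b z)"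
      by (simp only: mult_1_right)
    have "(\<lambda>z. K0inv $ m $ a * (ratio (pp a c) (rr a c) z - \<Gamma> $ a $ c * z ^ k) * Rsec (-1) z $ c $ n) \<in> O[?F](\<lambda>z. 1 * (z ^ k * log_err b z) * 1)"
      by (intro landau_o.big.mult landau_o.big_trans[OF rat zk1] R1) auto
    then have t2: "(\<lambda>z. K0inv $ m $ a * (ratio (pp a c) (rr a c) z - \<Gamma> $ a $ c * z ^ k) * Rsec (-1) z $ c $ n) \<in> O[?F](\<lambda>z. z ^ k * log_err b z)"
      by (simp only: mult_1_right mult_1_left)
    have "(\<lambda>z. (K0inv $ m $ a * (\<Gamma> $ a $ c * z ^ k)) * (Rsec (-1) z $ c $ n - K0inv $ c $ n)) \<in> O[?F](\<lambda>z. (1 * (1 * z ^ k)) * log_err b z)"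
      by (intro landau_o.big.mult Rd) auto
    then have t3: "(\<lambda>z. (K0inv $ m $ a * (\<Gamma> $ a $ c * z ^ k)) * (Rsec (-1) z $ c $ n - K0inv $ c $ n)) \<in> O[?F](\<lambda>z. z ^ k * log_err b z)"
      by (simp only: mult_1_left)
    \<comment> \<open>The factors are replaced by their leading terms one at a time:
      \<open>x\<close> and \<open>u\<close> stand for the two resolvents and \<open>y\<close> for
      \<Gamma>.\<close>
    have "y * (x - x0) * u + x0 * (y - y0) * u + (x0 * y0) * (u - u0) = x * y * u - x0 * y0 * u0" for x x0 y y0 u u0 :: complex
      by (simp add: algebra_simps)
    with sum_in_bigo(1)[OF sum_in_bigo(1)[OF t1 t2] t3] show ?thesis by (simp only:)
  qed
  have "(\<lambda>z. of_real (lam\<^sup>2) * (\<Sum>a\<in>UNIV. \<Sum>c\<in>UNIV. Rsec 1 z $ m $ a * ratio (pp a c) (rr a c) z * Rsec (-1) z $ c $ n - K0inv $ m $ a * (\<Gamma> $ a $ c * z ^ k) * K0inv $ c $ n)) \<in> O[?F](\<lambda>z. 1 * (z ^ k * log_err b z))"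
    by (intro landau_o.big.mult bigo_sum t) simp
  moreover have "of_real (lam\<^sup>2) * (\<Sum>a\<in>UNIV. \<Sum>c\<in>UNIV. Rsec 1 z $ m $ a * ratio (pp a c) (rr a c) z * Rsec (-1) z $ c $ n - K0inv $ m $ a * (\<Gamma> $ a $ c * z ^ k) * K0inv $ c $ n)
     = gfun m n z - of_real (lam\<^sup>2) * (K0inv ** \<Gamma> ** K0inv) $ m $ n * z ^ k" for z
    unfolding triple_product_entry gfun_def
    by (simp add: sum_subtractf right_diff_distrib sum_distrib_left sum_distrib_right mult_ac)
  ultimately show ?thesis by (simp only: mult_1_left)
qed

text \<open>The rotated integral needs one bound on the whole sector. Beyond the radius \<delta> of
  the local estimate, g and c z^k are together at most |B|/\<delta>^(k+1) + |c|/\<delta> times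
  |z|^(k+1).\<close>

lemma gfun_expansion:
  fixes \<Gamma> :: "complex^'n^'n"
  assumes rat: "\<And>i j. (\<lambda>z. ratio (pp i j) (rr i j) z - \<Gamma> $ i $ j * z ^ k) \<in> O[at 0 within sector \<tau>](\<lambda>z. z ^ (k + 1))"
    and k: "1 \<le> k" and b: "b = 1 \<or> b = 0 \<and> 2 \<le> k"
  shows "\<exists>D\<ge>0. \<forall>z\<in>sector \<tau>. z \<noteq> 0 \<longrightarrow>
    norm (gfun m n z - of_real (lam\<^sup>2) * (K0inv ** \<Gamma> ** K0inv) $ m $ n * z ^ k) \<le> D * norm z ^ (k + 1) * (1 + b * \<bar>ln (norm z)\<bar>)"
proof -
  define c where "c = of_real (lam\<^sup>2) * (K0inv ** \<Gamma> ** K0inv) $ m $ n"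
  have b0: "0 \<le> b" using b by auto
  obtain C where C: "0 < C" "\<forall>\<^sub>F z in at 0 within sector \<tau>. norm (gfun m n z - c * z ^ k) \<le> C * norm (z ^ k * log_err b z)"
    using gfun_expansion_bigo[OF rat k b, of m n] unfolding c_def by (elim landau_o.bigE) auto
  then obtain \<delta> where \<delta>: "0 < \<delta>" "\<And>z. z \<in> sector \<tau> \<Longrightarrow> z \<noteq> 0 \<Longrightarrow> norm z < \<delta> \<Longrightarrow> norm (gfun m n z - c * z ^ k) \<le> C * norm (z ^ k * log_err b z)"
    unfolding eventually_within_iff_norm by blast
  obtain B where B: "\<And>z. z \<in> sector \<tau> \<Longrightarrow> norm (gfun m n z) \<le> B / (1 + (norm z)\<^sup>2)" using gfun_bound by blast
  define D where "D = C + (\<bar>B\<bar> / \<delta> ^ (k + 1) + norm c / \<delta>)"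
  have D0: "0 \<le> \<bar>B\<bar> / \<delta> ^ (k + 1) + norm c / \<delta>" using \<delta>(1) by simp
  have "norm (gfun m n z - c * z ^ k) \<le> D * norm z ^ (k + 1) * (1 + b * \<bar>ln (norm z)\<bar>)" if z: "z \<in> sector \<tau>" "z \<noteq> 0" for z
  proof (cases "norm z < \<delta>")
    case True
    have "norm (gfun m n z - c * z ^ k) \<le> C * norm (z ^ k * log_err b z)" by (rule \<delta>(2)[OF z True])
    also have "\<dots> = C * norm z ^ (k + 1) * (1 + b * \<bar>ln (norm z)\<bar>)"
      by (simp add: norm_mult norm_power norm_log_err[OF b0])
    also have "\<dots> \<le> D * norm z ^ (k + 1) * (1 + b * \<bar>ln (norm z)\<bar>)"
      using D0 b0 by (intro mult_right_mono) (auto simp: D_def)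
    finally show ?thesis .
  next
    case False
    define x where "x = norm z"
    have x: "\<delta> \<le> x" "0 < x" using False z by (auto simp: x_def)
    have "norm (gfun m n z) \<le> B / (1 + x\<^sup>2)" using B[OF z(1)] by (simp add: x_def)
    also have "\<dots> \<le> \<bar>B\<bar> / (1 + x\<^sup>2)" by (intro divide_right_mono) auto
    also have "\<dots> \<le> \<bar>B\<bar> / 1" by (intro divide_left_mono) (auto intro: add_pos_nonneg)
    also have "\<dots> \<le> \<bar>B\<bar> / \<delta> ^ (k + 1) * x ^ (k + 1)"
    proof -
      have "\<delta> ^ (k + 1) \<le> x ^ (k + 1)" using x \<delta>(1) by (intro power_mono) auto
      then have "\<bar>B\<bar> * \<delta> ^ (k + 1) \<le> \<bar>B\<bar> * x ^ (k + 1)" by (intro mult_left_mono) auto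
      then show ?thesis using \<delta>(1) by (simp add: pos_le_divide_eq)
    qed
    finally have 1: "norm (gfun m n z) \<le> \<bar>B\<bar> / \<delta> ^ (k + 1) * x ^ (k + 1)" .
    have "norm (c * z ^ k) = norm c * x ^ k" by (simp add: norm_mult norm_power x_def)
    also have "\<dots> \<le> norm c * (x ^ k * (x / \<delta>))"
    proof (rule mult_left_mono)
      have "1 \<le> x / \<delta>" using x \<delta>(1) by simp
      then have "x ^ k * 1 \<le> x ^ k * (x / \<delta>)" using x by (intro mult_left_mono) auto
      then show "x ^ k \<le> x ^ k * (x / \<delta>)" by simp
    qed simp
    also have "\<dots> = norm c / \<delta> * x ^ (k + 1)" by simp
    finally have 2: "norm (c * z ^ k) \<le> norm c / \<delta> * x ^ (k + 1)" .
    have "norm (gfun m n z - c * z ^ k) \<le> norm (gfun m n z) + norm (c * z ^ k)" by (rule norm_triangle_ineq4)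
    also have "\<dots> \<le> (\<bar>B\<bar> / \<delta> ^ (k + 1) + norm c / \<delta>) * x ^ (k + 1)" using 1 2 by (simp add: distrib_right)
    also have "\<dots> \<le> D * x ^ (k + 1)" using C(1) x by (intro mult_right_mono) (auto simp: D_def)
    also have "\<dots> = D * x ^ (k + 1) * 1" by simp
    also have "\<dots> \<le> D * x ^ (k + 1) * (1 + b * \<bar>ln x\<bar>)"
      using b0 x D0 C(1) by (intro mult_left_mono) (auto simp: D_def)
    finally show ?thesis by (simp add: x_def)
  qed
  moreover have "0 \<le> D" using D0 C(1) by (simp add: D_def)
  ultimately show ?thesis unfolding c_def by blast
qed

end

section \<open>The reduced time evolution\<close>

context friedrichs_sector
begin

definition Rform :: "real \<Rightarrow> complex^'n \<Rightarrow> complex \<Rightarrow> complex" where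
  "Rform s u z = (\<Sum>m\<in>UNIV. \<Sum>n\<in>UNIV. cnj (u$m) * u$n * Rsec s z $ m $ n)"

lemma Rform_continuous:
  assumes "s \<in> {1, -1}"
  shows "continuous_on (sector \<tau> - {0}) (Rform s u)"
  unfolding Rform_def[abs_def] by (intro continuous_intros Rsec_continuous assms)

lemma Fform_eq_Rform:
  assumes "z \<in> sector \<tau>" "Im z \<noteq> 0"
  shows "Fform u z = Rform (sgn (Im z)) u z"
proof -
  have "z \<noteq> 0" using assms by auto
  then show ?thesis
    using Mmat_eq_Msec[OF sector_regular[OF assms(1)] assms(2)] by (simp add: Fform_def Rform_def Rsec_def)
qed

lemma cnj_sector: "cnj z \<in> sector \<tau> \<longleftrightarrow> z \<in> sector \<tau>"
  by (simp add: sector_def)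

text \<open>Off the axis both sides are values of the true resolvent form, which commutes with
  conjugation; the identity passes to the axis by continuity.\<close>

lemma Rform_cnj_real:
  assumes x: "0 < x"
  shows "cnj (Rform 1 u (of_real x)) = Rform (-1) u (of_real x)"
proof -
  define h where "h z = cnj (Rform 1 u z) - Rform (-1) u (cnj z)" for z
  have hc: "continuous_on (sector \<tau> - {0}) h"
    unfolding h_def
    by (intro continuous_intros Rform_continuous continuous_on_compose2[OF Rform_continuous])
       (auto simp: cnj_sector)
  \<comment> \<open>Points above x that stay in the sector, as their slope \<tau>/(n+1) is at most
    \<tau>.\<close>
  define X where "X n = Complex x (\<tau> * x / real (Suc n))" for n
  have Xs: "X n \<in> sector \<tau> - {0}" and Xi: "0 < Im (X n)" for n
  proof -
    have "\<tau> * x / real (Suc n) \<le> \<tau> * x / 1" using \<tau> x by (intro divide_left_mono) auto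
    then show "X n \<in> sector \<tau> - {0}" using \<tau> x by (auto simp: X_def sector_def complex_eq_iff)
    show "0 < Im (X n)" using \<tau> x by (simp add: X_def)
  qed
  have lim: "X \<longlonglongrightarrow> Complex x 0"
    unfolding X_def by (intro tendsto_Complex tendsto_const) real_asymp
  have xs: "Complex x 0 \<in> sector \<tau> - {0}" using \<tau> x by (auto simp: sector_def complex_eq_iff)
  have "(\<lambda>n. h (X n)) \<longlonglongrightarrow> h (Complex x 0)"
    by (rule continuous_on_tendsto_compose[OF hc lim xs]) (use Xs in auto)
  moreover have "h (X n) = 0" for n
  proof -
    have "Rform 1 u (X n) = Fform u (X n)" using Fform_eq_Rform[of "X n" u] Xs Xi[of n] by auto
    moreover have "Rform (-1) u (cnj (X n)) = Fform u (cnj (X n))"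
      using Fform_eq_Rform[of "cnj (X n)" u] Xs[of n] Xi[of n] by (auto simp: cnj_sector)
    moreover have "Fform u (cnj (X n)) = cnj (Fform u (X n))" by (rule Fform_cnj) (use Xi[of n] in simp)
    ultimately show ?thesis by (simp add: h_def)
  qed
  ultimately have "h (Complex x 0) = 0" by (simp add: LIMSEQ_const_iff)
  then show ?thesis by (simp add: h_def complex_of_real_def complex_cnj)
qed

text \<open>The two boundary values of the form are conjugate on the axis, so its jump, which the
  entries of g describe, is 2i times the imaginary part.\<close>

lemma Im_Rform_real:
  assumes x: "0 < x"
  shows "of_real (Im (Rform 1 u (of_real x))) = pi * (\<Sum>m\<in>UNIV. \<Sum>n\<in>UNIV. cnj (u$m) * u$n * gfun m n (of_real x))"
proof -
  have s: "of_real x \<in> sector \<tau>" "of_real x \<noteq> (0::complex)" using \<tau> x by (auto intro: of_real_in_sector)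
  have "Rform 1 u (of_real x) - Rform (-1) u (of_real x) = (\<Sum>m\<in>UNIV. \<Sum>n\<in>UNIV. cnj (u$m) * u$n * (Rsec 1 (of_real x) $ m $ n - Rsec (-1) (of_real x) $ m $ n))"
    by (simp add: Rform_def right_diff_distrib sum_subtractf)
  also have "\<dots> = 2 * \<i> * pi * (\<Sum>m\<in>UNIV. \<Sum>n\<in>UNIV. cnj (u$m) * u$n * gfun m n (of_real x))"
    unfolding Rsec_jump[OF s] by (simp add: sum_distrib_left mult_ac)
  finally have "Rform 1 u (of_real x) - cnj (Rform 1 u (of_real x)) = 2 * \<i> * pi * (\<Sum>m\<in>UNIV. \<Sum>n\<in>UNIV. cnj (u$m) * u$n * gfun m n (of_real x))"
    by (simp only: Rform_cnj_real[OF x])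
  moreover have "y - cnj y = 2 * \<i> * of_real (Im y)" for y by (simp add: complex_eq_iff)
  ultimately show ?thesis by simp
qed

lemma gfun_mult_integrable:
  assumes \<phi>: "\<phi> \<in> borel_measurable borel" "\<And>x. norm (\<phi> x) \<le> 1"
  shows "set_integrable lborel {0<..} (\<lambda>x. gfun m n (of_real x) * \<phi> x)"
proof -
  obtain C where C: "\<And>z. z \<in> sector \<tau> \<Longrightarrow> norm (gfun m n z) \<le> C / (1 + (norm z)\<^sup>2)" using gfun_bound by blast
  define k where "k x = indicator {0..} x *\<^sub>R gfun m n (complex_of_real x)" for x
  have "continuous_on {0..} (\<lambda>x. gfun m n (complex_of_real x))"
    by (rule continuous_on_compose2[OF gfun_continuous]) (use \<tau> in \<open>auto intro!: continuous_intros of_real_in_sector\<close>)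
  then have km: "k \<in> borel_measurable borel"
    unfolding k_def[abs_def] by (intro borel_measurable_continuous_on_indicator) auto
  have "set_integrable lborel {0<..} (\<lambda>x. k x * \<phi> x)"
  proof (rule set_integrable_decay[where C = C])
    show "(\<lambda>x. k x * \<phi> x) \<in> borel_measurable lborel" using km \<phi>(1) by simp
    fix x :: real assume x: "x \<in> {0<..}"
    have "norm (gfun m n (of_real x)) * norm (\<phi> x) \<le> norm (gfun m n (of_real x)) * 1"
      by (intro mult_left_mono \<phi>) auto
    also have "\<dots> \<le> C / (1 + x\<^sup>2)" using C[of "of_real x"] x \<tau> by (simp add: of_real_in_sector)
    finally show "norm (k x * \<phi> x) \<le> C / (1 + x\<^sup>2)" using x by (simp add: k_def norm_mult)
  qed simp
  then show ?thesis by (rule set_integrable_cong[THEN iffD1, rotated -1]) (auto simp: k_def)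
qed

text \<open>Stieltjes inversion turns the spectral measure on (0,\<infinity>) into a density, namely
  the quadratic form of g; linearity of the integral then reduces everything to the entries.\<close>

lemma spectral_integral:
  assumes \<phi>: "\<phi> \<in> borel_measurable borel" "\<And>x. norm (\<phi> x) \<le> 1"
  shows "(LINT x:{0<..}|spec_meas w lam v u. \<phi> x) = (\<Sum>m\<in>UNIV. \<Sum>n\<in>UNIV. cnj (u$m) * u$n * (LBINT x:{0<..}. gfun m n (of_real x) * \<phi> x))"
proof -
  have e: "of_real (Im (Rform 1 u (of_real x))) * y = (\<Sum>m\<in>UNIV. \<Sum>n\<in>UNIV. (pi * cnj (u$m) * u$n) * (gfun m n (of_real x) * y))" if "0 < x" for x y
    unfolding Im_Rform_real[OF that] by (simp add: sum_distrib_left sum_distrib_right mult_ac)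
  have i: "set_integrable lborel {0<..} (\<lambda>x. (pi * cnj (u$m) * u$n) * (gfun m n (of_real x) * \<psi> x))"
    if "\<psi> \<in> borel_measurable borel" "\<And>x. norm (\<psi> x) \<le> 1" for m n \<psi>
    by (intro set_integrable_mult_right gfun_mult_integrable that)
  \<comment> \<open>Taking 1 for the test function gives the integrability of the density that the
    inversion requires.\<close>
  have "set_integrable lborel {0<..} (\<lambda>x. complex_of_real (Im (Rform 1 u (of_real x))))"
  proof -
    have "set_integrable lborel {0<..} (\<lambda>x. \<Sum>m\<in>UNIV. \<Sum>n\<in>UNIV. (pi * cnj (u$m) * u$n) * (gfun m n (of_real x) * 1))"
      by (intro set_integrable_sum(1) i) auto
    then show ?thesis
      by (rule set_integrable_cong[THEN iffD1, rotated -1]) (use e[of _ 1] in auto)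
  qed
  then have "integrable lborel (\<lambda>x. complex_of_real (indicat_real {0<..} x *\<^sub>R Im (Rform 1 u (of_real x))))"
    unfolding set_integrable_def by (simp only: scaleR_conv_of_real[where 'a = complex] real_scaleR_def of_real_mult)
  then have int: "set_integrable lborel {0<..} (\<lambda>x. Im (Rform 1 u (of_real x)))"
    unfolding set_integrable_def complex_of_real_integrable_eq .
  have sub: "{z. 0 < Re z \<and> 0 \<le> Im z \<and> Im z \<le> \<tau> * Re z} \<subseteq> sector \<tau> - {0}" by (auto simp: sector_def)
  have "pi * (LINT x:{0<..}|spec_meas w lam v u. \<phi> x) = (LBINT x:{0<..}. of_real (Im (Rform 1 u (of_real x))) * \<phi> x)"
  proof (rule stieltjes_density[OF spec_meas_stieltjes(1,2) \<tau>(1) _ _ int \<phi>(1)])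
    show "continuous_on {z. 0 < Re z \<and> 0 \<le> Im z \<and> Im z \<le> \<tau> * Re z} (Rform 1 u)"
      by (rule continuous_on_subset[OF Rform_continuous sub]) simp
    fix z assume z: "0 < Re z" "0 < Im z" "Im z \<le> \<tau> * Re z"
    then have "z \<in> sector \<tau>" by (simp add: sector_def)
    then show "(\<integral>x. 1 / (complex_of_real x - z) \<partial>spec_meas w lam v u) = Rform 1 u z"
      using spec_meas_stieltjes(3)[of z u] Fform_eq_Rform[of z u] z by simp
  qed
  also have "\<dots> = (LBINT x:{0<..}. \<Sum>m\<in>UNIV. \<Sum>n\<in>UNIV. (pi * cnj (u$m) * u$n) * (gfun m n (of_real x) * \<phi> x))"
    by (rule set_lebesgue_integral_cong) (auto simp: e)
  also have "\<dots> = (\<Sum>m\<in>UNIV. \<Sum>n\<in>UNIV. (pi * cnj (u$m) * u$n) * (LBINT x:{0<..}. gfun m n (of_real x) * \<phi> x))"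
    by (subst set_integrable_sum(2), intro set_integrable_sum(1) i \<phi>, subst set_integrable_sum(2), rule i[OF \<phi>])
       (simp only: set_integral_mult_right)
  also have "\<dots> = pi * (\<Sum>m\<in>UNIV. \<Sum>n\<in>UNIV. cnj (u$m) * u$n * (LBINT x:{0<..}. gfun m n (of_real x) * \<phi> x))"
    by (simp add: sum_distrib_left mult_ac)
  finally show ?thesis by simp
qed

lemma sesquilinear_two_vectors:
  fixes X :: "'n \<Rightarrow> 'n \<Rightarrow> complex"
  shows "(\<Sum>a\<in>UNIV. \<Sum>b\<in>UNIV. cnj ((if a = m then 1 else 0) + c * (if a = n then 1 else 0)) * ((if b = m then 1 else 0) + c * (if b = n then 1 else 0)) * X a b)
    = X m m + c * X m n + cnj c * X n m + cnj c * c * X n n"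
proof -
  have 1: "(\<Sum>a\<in>UNIV. ((if a = m then 1 else 0) + d * (if a = n then 1 else 0)) * f a) = f m + d * f n" for f :: "'n \<Rightarrow> complex" and d
    by (simp add: distrib_right sum.distrib if_distrib[of "\<lambda>u. u * _"] if_distrib[of "\<lambda>u. _ * u"] mult.assoc cong: if_cong)
  have "(\<Sum>a\<in>UNIV. \<Sum>b\<in>UNIV. cnj ((if a = m then 1 else 0) + c * (if a = n then 1 else 0)) * ((if b = m then 1 else 0) + c * (if b = n then 1 else 0)) * X a b)
     = (\<Sum>a\<in>UNIV. ((if a = m then 1 else 0) + cnj c * (if a = n then 1 else 0)) * (\<Sum>b\<in>UNIV. ((if b = m then 1 else 0) + c * (if b = n then 1 else 0)) * X a b))"
    by (simp add: sum_distrib_left mult.assoc if_distrib[of cnj] cong: if_cong)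
  also have "\<dots> = X m m + c * X m n + cnj c * (X n m + c * X n n)" unfolding 1 ..
  finally show ?thesis by (simp add: algebra_simps)
qed

text \<open>Polarisation: for c = i^k, k = 0, ..., 3, the weight cnj(c) turns the coefficients 1, c,
  cnj(c), |c|^2 of the four entries into cnj(c), 1, cnj(c)^2, cnj(c), and all of these except the
  constant 1 sum to zero.\<close>

lemma reduced_evolution_eq:
  "reduced_evolution w lam v t m n = (LBINT x:{0<..}. gfun m n (of_real x) * exp (- \<i> * of_real t * of_real x))"
proof -
  define X where "X a b = (LBINT x:{0<..}. gfun a b (of_real x) * exp (- \<i> * of_real t * of_real x))" for a b
  have m: "(\<lambda>x. exp (- \<i> * of_real t * complex_of_real x)) \<in> borel_measurable borel"
    by (intro borel_measurable_continuous_onI continuous_intros)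
  have b: "norm (exp (- \<i> * of_real t * complex_of_real x)) \<le> 1" for x by (simp add: norm_exp_eq_Re)
  have q: "set_lebesgue_integral (spec_meas w lam v (\<chi> j. (if j = m then 1 else 0) + c * (if j = n then 1 else 0)))
          {0<..} (\<lambda>x. exp (- \<i> * complex_of_real t * complex_of_real x)) = X m m + c * X m n + cnj c * X n m + cnj c * c * X n n" for c
    unfolding spectral_integral[OF m b] X_def[symmetric] vec_lambda_beta by (rule sesquilinear_two_vectors)
  show ?thesis
    unfolding reduced_evolution_def q X_def[symmetric]
    by (simp add: lessThan_Suc eval_nat_numeral algebra_simps)
qed

lemma evolution_asymptotic:
  fixes \<Gamma> :: "complex^'n^'n"
  assumes rat: "\<And>i j. (\<lambda>z. ratio (pp i j) (rr i j) z - \<Gamma> $ i $ j * z ^ k) \<in> O[at 0 within sector \<tau>](\<lambda>z. z ^ (k + 1))"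
    and k: "1 \<le> k" and b: "b = 1 \<or> b = 0 \<and> 2 \<le> k"
  shows "\<exists>E. \<forall>t\<ge>1. norm (reduced_evolution w lam v t m n
      - of_real (lam\<^sup>2) * (K0inv ** \<Gamma> ** K0inv) $ m $ n * fact k / (\<i> * of_real t) ^ (k + 1)) \<le> E * (1 + b * ln t) / t ^ (k + 2)"
proof -
  obtain D where D: "0 \<le> D" "\<And>z. z \<in> sector \<tau> \<Longrightarrow> z \<noteq> 0 \<Longrightarrow>
    norm (gfun m n z - of_real (lam\<^sup>2) * (K0inv ** \<Gamma> ** K0inv) $ m $ n * z ^ k) \<le> D * norm z ^ (k + 1) * (1 + b * \<bar>ln (norm z)\<bar>)"
    using gfun_expansion[OF rat k b] by blast
  obtain C where C: "\<And>z. z \<in> sector \<tau> \<Longrightarrow> norm (gfun m n z) \<le> C / (1 + (norm z)\<^sup>2)" using gfun_bound by blast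
  have sub: "lower_wedge \<tau> \<subseteq> sector \<tau>" by (rule lower_wedge_subset_sector[OF \<tau>(1)])
  have b0: "0 \<le> b" using b by auto
  show ?thesis
    unfolding reduced_evolution_eq
    by (rule watson_rotated[OF \<tau>(1) continuous_on_subset[OF gfun_continuous sub] gfun_holomorphic _ b0 D(1)])
       (use C D(2) sub in auto)
qed

end

theorem theorem1:
  fixes w :: "'n::{finite,linorder} \<Rightarrow> real" and lam :: real
    and v :: "'n \<Rightarrow> real \<Rightarrow> complex"
    and pp rr :: "'n \<Rightarrow> 'n \<Rightarrow> complex poly" and nb :: nat
  assumes w_mono: "\<forall>i j. i \<le> j \<longrightarrow> w i \<le> w j"
    and lam_nz: "lam \<noteq> 0"
    and v_meas: "\<forall>n. v n \<in> borel_measurable lborel"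
    and v_L2: "\<forall>n. set_integrable lborel {0<..} (\<lambda>x. (cmod (v n x))\<^sup>2)"
    and ff: "\<forall>m n. AE x in lborel. 0 < x \<longrightarrow>
               cnj (v m x) * v n x = poly (pp m n) (complex_of_real x) / poly (rr m n) (complex_of_real x)"
    and ff_deg: "\<forall>m n. degree (pp m n) + 2 \<le> degree (rr m n)"
    and ff_nz: "\<forall>m n. \<forall>x::real. 0 \<le> x \<longrightarrow> poly (rr m n) (complex_of_real x) \<noteq> 0"
    and ff_0: "\<forall>m n. poly (pp m n) 0 = 0"
    and standing: "\<forall>x::real. 0 < x \<longrightarrow> (\<forall>s\<in>{1, -1}. det (Kpm_shift w lam v pp rr s x) \<noteq> 0)"
    and regular: "det (Kmat w lam v 0) \<noteq> 0"
    and nb: "is_nb pp rr nb"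
  shows
    "(2 \<le> nb \<and> is_na lam v pp rr 1 \<longrightarrow>
       (\<forall>m n. (\<lambda>t. cmod (reduced_evolution w lam v t m n
            - complex_of_real (lam\<^sup>2) * fact nb / (\<i> * complex_of_real t) ^ (nb + 1)
              * (matrix_inv (Kmat w lam v 0) ** Gcoeff pp rr nb ** matrix_inv (Kmat w lam v 0)) $ m $ n))
          \<in> O[at_top](\<lambda>t. t powr (- real (nb + 2)))))
   \<and> (nb = 1 \<and> (\<exists>na\<ge>1. is_na lam v pp rr na) \<longrightarrow>
       (\<forall>m n. (\<lambda>t. cmod (reduced_evolution w lam v t m n
            - complex_of_real (lam\<^sup>2) * fact nb / (\<i> * complex_of_real t) ^ (nb + 1)
              * (matrix_inv (Kmat w lam v 0) ** Gcoeff pp rr nb ** matrix_inv (Kmat w lam v 0)) $ m $ n))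
          \<in> O[at_top](\<lambda>t. t powr (-3) * ln t)))"
proof -
  interpret F: friedrichs w lam v pp rr
    by unfold_locales (fact lam_nz v_meas v_L2 ff ff_deg ff_nz ff_0)+
  obtain \<tau> where \<tau>: "0 < \<tau>" "\<tau> \<le> 1"
    "\<And>z. z \<in> sector \<tau> \<Longrightarrow> z \<noteq> 0 \<Longrightarrow> z \<in> F.regular_half_plane \<and> (\<forall>s\<in>{1, -1}. det (F.Msec s z) \<noteq> 0)"
    using F.ex_regular_sector[OF standing regular] by blast
  interpret S: friedrichs_sector w lam v pp rr \<tau>
    by unfold_locales (use \<tau> regular in auto)
  have nb1: "1 \<le> nb" using nb by (simp add: is_nb_def)
  have rat: "(\<lambda>z. ratio (pp i j) (rr i j) z - Gcoeff pp rr nb $ i $ j * z ^ nb) \<in> O[at 0 within sector \<tau>](\<lambda>z. z ^ (nb + 1))" for i j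
  proof -
    have G: "Gcoeff pp rr k $ i $ j = (deriv ^^ k) (ratio (pp i j) (rr i j)) 0 / fact k" for k
      by (simp add: Gcoeff_def Gam_def ratio_def[abs_def])
    have "(deriv ^^ k) (ratio (pp i j) (rr i j)) 0 = 0" if "1 \<le> k" "k < nb" for k
      using nb that G[of k] by (simp add: is_nb_def)
    then show ?thesis
      unfolding G using ff_nz[rule_format, of 0 i j] ff_0 nb1 by (intro ratio_taylor) auto
  qed
  note main = S.evolution_asymptotic[OF rat nb1]
  have swap: "complex_of_real (lam\<^sup>2) * fact nb / (\<i> * complex_of_real t) ^ (nb + 1) * M =
      complex_of_real (lam\<^sup>2) * M * fact nb / (\<i> * complex_of_real t) ^ (nb + 1)" for t M
    by simp
  show ?thesis
  proof (intro conjI impI allI)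
    fix m n assume "2 \<le> nb \<and> is_na lam v pp rr 1"
    then obtain E where E: "\<And>t. 1 \<le> t \<Longrightarrow> norm (reduced_evolution w lam v t m n
      - of_real (lam\<^sup>2) * (S.K0inv ** Gcoeff pp rr nb ** S.K0inv) $ m $ n * fact nb / (\<i> * of_real t) ^ (nb + 1)) \<le> E * (1 + 0 * ln t) / t ^ (nb + 2)"
      \<comment> \<open>The value \<open>b\<close> = 0 is admissible because nb \<ge> 2, so no
        logarithm appears.\<close>
      using main[of 0 m n] by blast
    show "(\<lambda>t. cmod (reduced_evolution w lam v t m n
            - complex_of_real (lam\<^sup>2) * fact nb / (\<i> * complex_of_real t) ^ (nb + 1)
              * (matrix_inv (Kmat w lam v 0) ** Gcoeff pp rr nb ** matrix_inv (Kmat w lam v 0)) $ m $ n))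
          \<in> O[at_top](\<lambda>t. t powr (- real (nb + 2)))"
      unfolding swap
    proof (rule bigoI)
      show "\<forall>\<^sub>F t in at_top. norm (cmod (reduced_evolution w lam v t m n
            - complex_of_real (lam\<^sup>2) * (S.K0inv ** Gcoeff pp rr nb ** S.K0inv) $ m $ n * fact nb / (\<i> * complex_of_real t) ^ (nb + 1)))
          \<le> E * norm (t powr (- real (nb + 2)))"
        using eventually_ge_at_top[of 1]
      proof eventually_elim
        case (elim t)
        have "t powr (- real (nb + 2)) = 1 / t ^ (nb + 2)"
          using elim by (simp only: powr_minus powr_realpow) (simp add: divide_inverse)
        then show ?case using E[OF elim] elim by simp
      qed
    qed
  next
    fix m n assume "nb = 1 \<and> (\<exists>na\<ge>1. is_na lam v pp rr na)"
    then have nb_1: "nb = 1" by simp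
    obtain E where E: "\<And>t. 1 \<le> t \<Longrightarrow> norm (reduced_evolution w lam v t m n
      - of_real (lam\<^sup>2) * (S.K0inv ** Gcoeff pp rr nb ** S.K0inv) $ m $ n * fact nb / (\<i> * of_real t) ^ (nb + 1)) \<le> E * (1 + 1 * ln t) / t ^ (nb + 2)"
      using main[of 1 m n] by blast
    show "(\<lambda>t. cmod (reduced_evolution w lam v t m n
            - complex_of_real (lam\<^sup>2) * fact nb / (\<i> * complex_of_real t) ^ (nb + 1)
              * (matrix_inv (Kmat w lam v 0) ** Gcoeff pp rr nb ** matrix_inv (Kmat w lam v 0)) $ m $ n))
          \<in> O[at_top](\<lambda>t. t powr (-3) * ln t)"
      unfolding swap
    proof (rule bigoI)
      show "\<forall>\<^sub>F t in at_top. norm (cmod (reduced_evolution w lam v t m n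
            - complex_of_real (lam\<^sup>2) * (S.K0inv ** Gcoeff pp rr nb ** S.K0inv) $ m $ n * fact nb / (\<i> * complex_of_real t) ^ (nb + 1)))
          \<le> (2 * \<bar>E\<bar>) * norm (t powr (-3) * ln t)"
        \<comment> \<open>For t \<ge> e one has 1 \<le> ln t, hence 1 + ln t \<le> 2 ln t; this is
          the origin of the factor 2.\<close>
        using eventually_ge_at_top[of "exp 1"]
      proof eventually_elim
        case (elim t)
        have t1: "1 \<le> t" using elim exp_ge_add_one_self[of "1::real"] by linarith
        have l: "1 \<le> ln t" using elim t1 by (simp add: ln_ge_iff)
        have p: "t powr (-3) = 1 / t ^ 3"
          using t1 powr_realpow[of t 3] by (simp add: powr_minus divide_inverse)
        have "E * (1 + 1 * ln t) / t ^ (nb + 2) \<le> \<bar>E\<bar> * (2 * ln t) / t ^ (nb + 2)"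
          using l t1 by (intro divide_right_mono mult_mono) auto
        also have "\<dots> = (2 * \<bar>E\<bar>) * norm (t powr (-3) * ln t)"
          using l t1 by (simp add: p nb_1 numeral_3_eq_3)
        finally show ?case using E[OF t1] by simp
      qed
    qed
  qed
qed

end
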